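(* Suppose $(\epsilon_1,\ldots,\epsilon_n)\in\{0,1\}^n$ is a permutation of $(\epsilon'_1,\ldots,\epsilon'_n)$. Let $\mathcal W=W^{(\epsilon_1)}\otimes\cdots\otimes W^{(\epsilon_n)}$ and $\mathcal W'=W^{(\epsilon'_1)}\otimes\cdots\otimes W^{(\epsilon'_n)}$. Then there is an invertible linear map $\Phi:\mathcal W\otimes\mathcal W\to\mathcal W'\otimes\mathcal W'$ such that $$\Phi\,S^{\mathrm{tr}}(z|\epsilon_1,\ldots,\epsilon_n)=S^{\mathrm{tr}}(z|\epsilon'_1,\ldots,\epsilon'_n)\,\Phi,\qquad \Phi\,S^{s,t}(z|\epsilon_1,\ldots,\epsilon_n)=S^{s,t}(z|\epsilon'_1,\ldots,\epsilon'_n)\,\Phi$$ for $s,t\in\{1,2\}$.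
   Context: $q$ is generic; $z$ is an indeterminate and matrix elements are regarded as power series in $z$. $(q^a)_m=\prod_{k=1}^m(1-q^{ak})$ for a positive integer $a$ (so $(q^{s^2})_m$ means $(q)_m$ for $s=1$ and $(q^4)_m$ for $s=2$), $\binom{m}{k}_{q^2}=\frac{(q^2)_m}{(q^2)_k(q^2)_{m-k}}$ (zero unless $0\le k\le m$). $F$ has basis $|m\rangle$, $m\in\mathbb Z_{\ge0}$; $V$ has basis $|0\rangle,|1\rangle$; $W^{(0)}=F$, $W^{(1)}=V$; $\mathcal W=W^{(\epsilon_1)}\otimes\cdots\otimes W^{(\epsilon_n)}$ has basis $|\mathbf m\rangle=|m_1,\ldots,m_n\rangle$ ($m_i\in\mathbb Z_{\ge0}$ if $\epsilon_i=0$, $m_i\in\{0,1\}$ if $\epsilon_i=1$). For nonnegative integer indices $$\mathscr S^{(0)\,a,b,c}_{\ \ \ \,i,j,k}=\delta_{a+b,i+j}\delta_{b+c,j+k}\sum_{\lambda,\mu\ge0,\ \lambda+\mu=b}(-1)^\lambda q^{i(c-j)+(k+1)\lambda+\mu(\mu-k)}\frac{(q^2)_{c+\mu}}{(q^2)_c}\binom{i}{\mu}_{q^2}\binom{j}{\lambda}_{q^2}.$$ $\mathscr S^{(1)\,a,b,c}_{\ \ \ \,i,j,k}$ ($a,b,i,j\in\{0,1\}$, $c,k\in\mathbb Z_{\ge0}$) is zero except $\mathscr S^{(1)0,0,c}_{\ \ \ 0,0,k}=\mathscr S^{(1)1,1,c}_{\ \ \ 1,1,k}=\delta_{c,k}$,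 $\mathscr S^{(1)0,1,c}_{\ \ \ 0,1,k}=-\delta_{c,k}q^{k+1}$, $\mathscr S^{(1)1,0,c}_{\ \ \ 1,0,k}=\delta_{c,k}q^k$, $\mathscr S^{(1)0,1,c}_{\ \ \ 1,0,k}=\delta_{c,k-1}(1-q^{2k})$, $\mathscr S^{(1)1,0,c}_{\ \ \ 0,1,k}=\delta_{c,k+1}$. The operators $S(z)=S(z|\epsilon_1,\ldots,\epsilon_n)$ on $\mathcal W\otimes\mathcal W$ are $S(z)(|\mathbf i\rangle\otimes|\mathbf j\rangle)=\sum_{\mathbf a,\mathbf b}S(z)^{\mathbf a,\mathbf b}_{\mathbf i,\mathbf j}|\mathbf a\rangle\otimes|\mathbf b\rangle$ with (sums over nonnegative integers) $$S^{\mathrm{tr}}(z)^{\mathbf a,\mathbf b}_{\mathbf i,\mathbf j}=\varrho(z)\sum_{c_0,\ldots,c_{n-1}}z^{c_0}\prod_{k=1}^n\mathscr S^{(\epsilon_k)\,a_k,b_k,c_{k-1}}_{\ \ \ \ \,i_k,j_k,c_k}\quad(c_n:=c_0),$$ $$S^{s,t}(z)^{\mathbf a,\mathbf b}_{\mathbf i,\mathbf j}=\varrho(z)\sum_{c_0,\ldots,c_n}\frac{z^{c_0}(q^2)_{sc_0}}{(q^{s^2})_{c_0}(q^{t^2})_{c_n}}\prod_{k=1}^n\mathscr S^{(\epsilon_k)\,a_k,b_k,c'_{k-1}}_{\ \ \ \ \,i_k,j_k,c''_k},$$ where $c'_0=sc_0$, $c'_k=c_k$ for $1\le k\le n-1$,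 $c''_k=c_k$ for $1\le k\le n-1$, $c''_n=tc_n$. Here $\varrho(z)$ is a scalar normalization factor, taken to be the same for $(\epsilon_1,\ldots,\epsilon_n)$ and $(\epsilon'_1,\ldots,\epsilon'_n)$. *)

theory Defs
  imports
    Complex_Main
    "HOL-Library.Multiset"
    "HOL-Library.Poly_Mapping"
    "HOL-Computational_Algebra.Formal_Power_Series"
begin

text \<open>
  \<open>qpoch q a m\<close> is \<open>(q\<^sup>a)\<^sub>m\<close>; in particular \<open>(q\<^sup>2)\<^sub>m\<close> is \<open>qpoch q 2 m\<close>.
\<close>

definition qpoch :: "'k::field \<Rightarrow> nat \<Rightarrow> nat \<Rightarrow> 'k" where
  "qpoch q a m = (\<Prod>k=1..m. 1 - q ^ (a * k))"

definition qbinom2 :: "'k::field \<Rightarrow> nat \<Rightarrow> nat \<Rightarrow> 'k" where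
  "qbinom2 q m k = (if k \<le> m then qpoch q 2 m / (qpoch q 2 k * qpoch q 2 (m - k)) else 0)"

text \<open>
  In the three-dimensional operators, \<open>\<S> q a b c i j k\<close> carries the upper indices \<open>a, b, c\<close>
  first and the lower indices \<open>i, j, k\<close> last.
\<close>

definition S3_0 :: "'k::field \<Rightarrow> nat \<Rightarrow> nat \<Rightarrow> nat \<Rightarrow> nat \<Rightarrow> nat \<Rightarrow> nat \<Rightarrow> 'k" where
  "S3_0 q a b c i j k =
    (if a + b = i + j \<and> b + c = j + k then
       (\<Sum>(l, m) \<in> {(l, m). l + m = b}.
          (- 1) ^ l
          * q powi (int i * (int c - int j) + (int k + 1) * int l + int m * (int m - int k))
          * (qpoch q 2 (c + m) / qpoch q 2 c) * qbinom2 q i m * qbinom2 q j l)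
     else 0)"

definition S3_1 :: "'k::field \<Rightarrow> nat \<Rightarrow> nat \<Rightarrow> nat \<Rightarrow> nat \<Rightarrow> nat \<Rightarrow> nat \<Rightarrow> 'k" where
  "S3_1 q a b c i j k =
    (if (a, b, i, j) = (0, 0, 0, 0) \<or> (a, b, i, j) = (1, 1, 1, 1) then of_bool (c = k)
     else if (a, b, i, j) = (0, 1, 0, 1) then - (of_bool (c = k) * q ^ (k + 1))
     else if (a, b, i, j) = (1, 0, 1, 0) then of_bool (c = k) * q ^ k
     else if (a, b, i, j) = (0, 1, 1, 0) then of_bool (c + 1 = k) * (1 - q ^ (2 * k))
     else if (a, b, i, j) = (1, 0, 0, 1) then of_bool (c = k + 1)
     else 0)"

definition S3 :: "'k::field \<Rightarrow> nat \<Rightarrow> nat \<Rightarrow> nat \<Rightarrow> nat \<Rightarrow> nat \<Rightarrow> nat \<Rightarrow> nat \<Rightarrow> 'k" where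
  "S3 q \<epsilon> = (if \<epsilon> = 0 then S3_0 q else S3_1 q)"

text \<open>
  Multi-indices are lists, so the sites \<open>1, \<dots>, n\<close> become positions \<open>0, \<dots>, n - 1\<close>.
  The tensor product \<open>\<W> \<otimes> \<W>\<close> is the free module on the pairs of basis labels of \<open>\<W>\<close>, realised
  as a submodule of the finitely supported functions on pairs of lists.
  Over \<open>'k\<close> this is \<open>\<W> \<otimes> \<W>\<close> itself; over \<open>'k fps\<close> it is \<open>\<W> \<otimes> \<W>\<close> with scalars extended to power
  series in \<open>z\<close>, which is where \<open>S(z)\<close> acts.
\<close>

type_synonym label = "nat list \<times> nat list"

definition W_basis :: "nat list \<Rightarrow> nat list set" where
  "W_basis \<epsilon> = {m. length m = length \<epsilon> \<and> (\<forall>k<length \<epsilon>. \<epsilon> ! k = 1 \<longrightarrow> m ! k \<in> {0, 1})}"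

definition WW :: "nat list \<Rightarrow> (label \<Rightarrow>\<^sub>0 'r::zero) set" where
  "WW \<epsilon> = {v. Poly_Mapping.keys v \<subseteq> W_basis \<epsilon> \<times> W_basis \<epsilon>}"

definition scale :: "'k::field \<Rightarrow> (label \<Rightarrow>\<^sub>0 'k) \<Rightarrow> (label \<Rightarrow>\<^sub>0 'k)" where
  "scale c v = Poly_Mapping.map ((*) c) v"

text \<open>
  Matrix elements \<open>S(z)\<^bsup>a,b\<^esup>\<^bsub>i,j\<^esub>\<close>.  The coefficient of \<open>z ^ r\<close> collects the terms with
  \<open>c\<^sub>0 = r\<close>; restricting to the nonzero terms makes this sum finite
  (lemmas \<open>finite_tr_terms\<close> and \<open>finite_bd_terms\<close> below).
  The list \<open>c\<close> is \<open>c\<^sub>0, \<dots>, c\<^bsub>n-1\<^esub>\<close> for the trace and \<open>c\<^sub>0, \<dots>, c\<^sub>n\<close> for the boundary vectors.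
\<close>

definition tr_term ::
  "'k::field \<Rightarrow> nat list \<Rightarrow> label \<Rightarrow> label \<Rightarrow> nat list \<Rightarrow> 'k" where
  "tr_term q \<epsilon> = (\<lambda>(a, b) (i, j) c.
     \<Prod>k<length \<epsilon>. S3 q (\<epsilon> ! k) (a ! k) (b ! k) (c ! k)
                              (i ! k) (j ! k) (c ! (Suc k mod length \<epsilon>)))"

definition tr_elem :: "'k::field fps \<Rightarrow> 'k \<Rightarrow> nat list \<Rightarrow> label \<Rightarrow> label \<Rightarrow> 'k fps" where
  "tr_elem \<rho> q \<epsilon> ab ij = \<rho> * Abs_fps (\<lambda>r.
     \<Sum>c | length c = length \<epsilon> \<and> c ! 0 = r \<and> tr_term q \<epsilon> ab ij c \<noteq> 0. tr_term q \<epsilon> ab ij c)"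

definition bd_term ::
  "nat \<Rightarrow> nat \<Rightarrow> 'k::field \<Rightarrow> nat list \<Rightarrow> label \<Rightarrow> label \<Rightarrow> nat list \<Rightarrow> 'k" where
  "bd_term s t q \<epsilon> = (\<lambda>(a, b) (i, j) c.
     let n = length \<epsilon>;
         c' = (\<lambda>k. if k = 0 then s * c ! 0 else c ! k);
         c'' = (\<lambda>k. if k = n then t * c ! n else c ! k)
     in qpoch q 2 (s * c ! 0) / (qpoch q (s\<^sup>2) (c ! 0) * qpoch q (t\<^sup>2) (c ! n))
        * (\<Prod>k=1..n. S3 q (\<epsilon> ! (k - 1)) (a ! (k - 1)) (b ! (k - 1)) (c' (k - 1))
                                        (i ! (k - 1)) (j ! (k - 1)) (c'' k)))"

definition bd_elem ::
  "nat \<Rightarrow> nat \<Rightarrow> 'k::field fps \<Rightarrow> 'k \<Rightarrow> nat list \<Rightarrow> label \<Rightarrow> label \<Rightarrow> 'k fps" where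
  "bd_elem s t \<rho> q \<epsilon> ab ij = \<rho> * Abs_fps (\<lambda>r.
     \<Sum>c | length c = Suc (length \<epsilon>) \<and> c ! 0 = r \<and> bd_term s t q \<epsilon> ab ij c \<noteq> 0.
        bd_term s t q \<epsilon> ab ij c)"

text \<open>
  The power-series-linear operator on \<open>\<W> \<otimes> \<W>\<close> with matrix \<open>M ab ij\<close> (row \<open>ab\<close>, column \<open>ij\<close>).
  Each column has finitely many nonzero entries in the cases of interest
  (lemmas \<open>finite_tr_column\<close> and \<open>finite_bd_column\<close> below).
\<close>

definition mat_op ::
  "nat list \<Rightarrow> (label \<Rightarrow> label \<Rightarrow> 'r::comm_ring_1) \<Rightarrow> (label \<Rightarrow>\<^sub>0 'r) \<Rightarrow> (label \<Rightarrow>\<^sub>0 'r)" where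
  "mat_op \<epsilon> M v =
     (\<Sum>ij \<in> Poly_Mapping.keys v.
        \<Sum>ab | ab \<in> W_basis \<epsilon> \<times> W_basis \<epsilon> \<and> M ab ij \<noteq> 0.
           Poly_Mapping.single ab (M ab ij * Poly_Mapping.lookup v ij))"

definition S_tr ::
  "'k::field fps \<Rightarrow> 'k \<Rightarrow> nat list \<Rightarrow> (label \<Rightarrow>\<^sub>0 'k fps) \<Rightarrow> (label \<Rightarrow>\<^sub>0 'k fps)" where
  "S_tr \<rho> q \<epsilon> = mat_op \<epsilon> (tr_elem \<rho> q \<epsilon>)"

definition S_bd ::
  "nat \<Rightarrow> nat \<Rightarrow> 'k::field fps \<Rightarrow> 'k \<Rightarrow> nat list \<Rightarrow> (label \<Rightarrow>\<^sub>0 'k fps) \<Rightarrow> (label \<Rightarrow>\<^sub>0 'k fps)" where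
  "S_bd s t \<rho> q \<epsilon> = mat_op \<epsilon> (bd_elem s t \<rho> q \<epsilon>)"

text \<open>
  The extension of a \<open>'k\<close>-linear map to power series coefficients, determined by its values on
  the basis vectors.
\<close>

definition extend_z ::
  "((label \<Rightarrow>\<^sub>0 'k::field) \<Rightarrow> (label \<Rightarrow>\<^sub>0 'k)) \<Rightarrow> (label \<Rightarrow>\<^sub>0 'k fps) \<Rightarrow> (label \<Rightarrow>\<^sub>0 'k fps)" where
  "extend_z \<Phi> v =
     (\<Sum>x \<in> Poly_Mapping.keys v. let w = \<Phi> (Poly_Mapping.single x 1) in
        \<Sum>y \<in> Poly_Mapping.keys w.
           Poly_Mapping.single y (fps_const (Poly_Mapping.lookup w y) * Poly_Mapping.lookup v x))"

lemma lookup_scale [simp]: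
  "Poly_Mapping.lookup (scale c v) x = c * Poly_Mapping.lookup v x"
  by (auto simp: scale_def Poly_Mapping.map.rep_eq when_def)

lemma vector_space_scale: "vector_space (scale :: 'k::field \<Rightarrow> _)"
  by standard (auto intro!: poly_mapping_eqI simp: lookup_add algebra_simps)

lemma S3_conservation:
  assumes "S3 q e a b c i j k \<noteq> 0"
  shows "a + b = i + j \<and> b + c = j + k"
  using assms by (auto simp: S3_def S3_0_def S3_1_def split: if_splits)

lemma finite_bounded_lists: "finite {c :: nat list. length c = n \<and> (\<forall>k<n. c ! k \<le> M)}"
proof (rule finite_subset)
  show "{c. length c = n \<and> (\<forall>k<n. c ! k \<le> M)} \<subseteq> {c. set c \<subseteq> {..M} \<and> length c = n}"
    by (auto simp: in_set_conv_nth)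
qed (simp add: finite_lists_length_eq)

lemma finite_tr_terms:
  "finite {c. length c = length \<epsilon> \<and> c ! 0 = r \<and> tr_term q \<epsilon> ab ij c \<noteq> 0}"
proof -
  obtain a b where ab: "ab = (a, b)" by fastforce
  obtain i j where ij: "ij = (i, j)" by fastforce
  define n where "n = length \<epsilon>"
  define M where "M = r + (\<Sum>l<n. b ! l)"
  have bound: "c ! k \<le> M"
    if c: "c ! 0 = r" "tr_term q \<epsilon> ab ij c \<noteq> 0" and "k < n" for c k
  proof -
    have nz: "S3 q (\<epsilon> ! l) (a ! l) (b ! l) (c ! l) (i ! l) (j ! l) (c ! (Suc l mod n)) \<noteq> 0"
      if "l < n" for l
      using c(2) that by (auto simp: tr_term_def ab ij n_def)
    have "c ! k \<le> r + (\<Sum>l<k. b ! l)" using \<open>k < n\<close>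
    proof (induction k)
      case 0
      then show ?case using c by simp
    next
      case (Suc k)
      then show ?case using S3_conservation[OF nz[of k]] by simp
    qed
    also have "\<dots> \<le> M"
      unfolding M_def using \<open>k < n\<close> by (intro add_left_mono sum_mono2) auto
    finally show ?thesis .
  qed
  show ?thesis
    by (rule finite_subset[OF _ finite_bounded_lists[of n M]]) (auto simp: bound n_def)
qed

lemma finite_bd_terms:
  assumes "t \<noteq> 0"
  shows "finite {c. length c = Suc (length \<epsilon>) \<and> c ! 0 = r \<and> bd_term s t q \<epsilon> ab ij c \<noteq> 0}"
proof -
  obtain a b where ab: "ab = (a, b)" by fastforce
  obtain i j where ij: "ij = (i, j)" by fastforce
  define n where "n = length \<epsilon>"
  define M where "M = r + s * r + (\<Sum>l<n. b ! l)"
  have bound: "c ! k \<le> M"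
    if c: "c ! 0 = r" "bd_term s t q \<epsilon> ab ij c \<noteq> 0" and "k < Suc n" for c k
  proof -
    have nz: "S3 q (\<epsilon> ! l) (a ! l) (b ! l) (if l = 0 then s * c ! 0 else c ! l)
        (i ! l) (j ! l) (if Suc l = n then t * c ! n else c ! Suc l) \<noteq> 0"
      if "l < n" for l
    proof -
      have "\<forall>k\<in>{1..n}. S3 q (\<epsilon> ! (k - 1)) (a ! (k - 1)) (b ! (k - 1))
         (if k - 1 = 0 then s * c ! 0 else c ! (k - 1)) (i ! (k - 1)) (j ! (k - 1))
         (if k = n then t * c ! n else c ! k) \<noteq> 0"
        using c(2) by (simp add: bd_term_def ab ij n_def Let_def cong: if_cong split del: if_split)
      from this[rule_format, of "Suc l"] that show ?thesis by (simp cong: if_cong split del: if_split)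
    qed
    have "c ! k \<le> r + s * r + (\<Sum>l<k. b ! l)" using \<open>k < Suc n\<close>
    proof (induction k)
      case 0
      then show ?case using c by simp
    next
      case (Suc k)
      have "(if Suc k = n then t * c ! n else c ! Suc k)
          \<le> b ! k + (if k = 0 then s * c ! 0 else c ! k)"
        using S3_conservation[OF nz[of k]] Suc.prems by linarith
      moreover have "c ! Suc k \<le> (if Suc k = n then t * c ! n else c ! Suc k)"
        using assms by (cases t) auto
      moreover have "(if k = 0 then s * c ! 0 else c ! k) \<le> r + s * r + (\<Sum>l<k. b ! l)"
        using c Suc by auto
      ultimately show ?case by simp
    qed
    also have "\<dots> \<le> M"
      unfolding M_def using \<open>k < Suc n\<close> by (intro add_left_mono sum_mono2) auto
    finally show ?thesis .
  qed
  show ?thesis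
    by (rule finite_subset[OF _ finite_bounded_lists[of "Suc n" M]]) (auto simp: bound n_def)
qed

lemma finite_column:
  assumes "\<And>a b k. M (a, b) (i, j) \<noteq> 0 \<Longrightarrow> k < length \<epsilon> \<Longrightarrow> a ! k + b ! k = i ! k + (j ! k :: nat)"
  shows "finite {ab \<in> W_basis \<epsilon> \<times> W_basis \<epsilon>. M ab (i, j) \<noteq> 0}"
proof -
  define n where "n = length \<epsilon>"
  define B where "B = (\<Sum>k<n. i ! k + j ! k)"
  let ?L = "{c. length c = n \<and> (\<forall>k<n. c ! k \<le> B)}"
  have "a ! k \<le> B \<and> b ! k \<le> B" if "M (a, b) (i, j) \<noteq> 0" "k < n" for a b k
  proof -
    have "i ! k + j ! k \<le> B"
      unfolding B_def using that(2) by (intro member_le_sum) auto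
    then show ?thesis using assms[OF that(1), of k] that(2) by (simp add: n_def)
  qed
  then have "{ab \<in> W_basis \<epsilon> \<times> W_basis \<epsilon>. M ab (i, j) \<noteq> 0} \<subseteq> ?L \<times> ?L"
    by (auto simp: W_basis_def n_def)
  then show ?thesis
    by (rule finite_subset) (intro finite_cartesian_product finite_bounded_lists)
qed

lemma finite_tr_column: "finite {ab \<in> W_basis \<epsilon> \<times> W_basis \<epsilon>. tr_elem \<rho> q \<epsilon> ab ij \<noteq> 0}"
proof -
  obtain i j where ij: "ij = (i, j)" by fastforce
  show ?thesis unfolding ij
  proof (rule finite_column)
    fix a b k
    assume nz: "tr_elem \<rho> q \<epsilon> (a, b) (i, j) \<noteq> 0" and k: "k < length \<epsilon>"
    have "\<exists>c. tr_term q \<epsilon> (a, b) (i, j) c \<noteq> 0"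
      using nz by (rule contrapos_np) (simp add: tr_elem_def fps_zero_def [symmetric])
    then obtain c where "tr_term q \<epsilon> (a, b) (i, j) c \<noteq> 0" ..
    with k show "a ! k + b ! k = i ! k + j ! k"
      by (auto simp: tr_term_def dest!: S3_conservation)
  qed
qed

lemma finite_bd_column: "finite {ab \<in> W_basis \<epsilon> \<times> W_basis \<epsilon>. bd_elem s t \<rho> q \<epsilon> ab ij \<noteq> 0}"
proof -
  obtain i j where ij: "ij = (i, j)" by fastforce
  show ?thesis unfolding ij
  proof (rule finite_column)
    fix a b k
    assume nz: "bd_elem s t \<rho> q \<epsilon> (a, b) (i, j) \<noteq> 0" and k: "k < length \<epsilon>"
    have "\<exists>c. bd_term s t q \<epsilon> (a, b) (i, j) c \<noteq> 0"
      using nz by (rule contrapos_np) (simp add: bd_elem_def fps_zero_def [symmetric])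
    then obtain c where "bd_term s t q \<epsilon> (a, b) (i, j) c \<noteq> 0" ..
    then have "\<forall>l\<in>{1..length \<epsilon>}. a ! (l - 1) + b ! (l - 1) = i ! (l - 1) + j ! (l - 1)"
      by (auto simp: bd_term_def Let_def dest!: S3_conservation)
    from this[rule_format, of "Suc k"] k show "a ! k + b ! k = i ! k + j ! k"
      by simp
  qed
qed

end

theory Submission
  imports Defs "HOL-Library.Function_Algebras"
begin

text \<open>
  Any two orders of the same sites differ by exchanges of neighbours, and exchanging two equal sites
  changes nothing, so it suffices to compare \<open>\<epsilon> = (\<dots>, 0, 1, \<dots>)\<close> with \<open>\<epsilon>' = (\<dots>, 1, 0, \<dots>)\<close>
  (\<open>sort_zeros_ones\<close>).

  A matrix element of \<open>S(z)\<close> lets an auxiliary oscillator pass through the sites one after the other.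
  The conservation laws determine its state after each site from the state before it, and the
  trace or the boundary vectors see only the two ends of this path (\<open>tr_coeff_chain\<close>,
  \<open>bd_coeff_chain\<close>).  A map \<open>\<Phi>\<close> that acts on two neighbouring sites and carries the product of
  their two local operators to the product in the other order, over the same auxiliary space,
  therefore intertwines the trace operator and all boundary operators at once (\<open>chain_exchange\<close>).

  For the local problem write \<open>R\<close> for the operator of a site 0, and let \<open>K\<^sub>n, a\<^sub>n\<^sup>+, a\<^sub>n\<^sup>-\<close> act on the
  \<open>n\<close>-th of its three factors by
  \<open>K|m\<rangle> = q ^ m |m\<rangle>\<close>, \<open>a\<^sup>+|m\<rangle> = |m + 1\<rangle>\<close>, \<open>a\<^sup>-|m\<rangle> = (1 - q ^ (2 * m)) |m - 1\<rangle>\<close>.  A site 1 does nothing on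
  \<open>|0\<rangle> \<otimes> |0\<rangle>\<close> and \<open>|1\<rangle> \<otimes> |1\<rangle>\<close>; on \<open>u = |0\<rangle> \<otimes> |1\<rangle>\<close> and \<open>w = |1\<rangle> \<otimes> |0\<rangle>\<close> it is the matrix \<open>M\<close> with rows
  \<open>(- q K\<^sub>3, a\<^sub>3\<^sup>-)\<close> and \<open>(a\<^sub>3\<^sup>+, K\<^sub>3)\<close>, where the auxiliary space is the third factor.  On the span of \<open>u\<close> and
  \<open>w\<close> the requirement is \<open>\<Phi> R M = M R \<Phi>\<close>, and it is met by the matrix with rows
  \<open>(K\<^sub>1 - q K\<^sub>2, a\<^sub>1\<^sup>+ a\<^sub>2\<^sup>-)\<close> and \<open>(a\<^sub>1\<^sup>- a\<^sub>2\<^sup>+, K\<^sub>2 - q K\<^sub>1)\<close>.  Indeed \<open>M\<^sup>2 = 1\<close>, so the requirement is equivalent to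
  \<open>(M \<Phi>) R = R (\<Phi> M)\<close>, and each of the four entries of this equation is a combination of the
  classical relations that say how \<open>R\<close> conjugates
  \<open>K\<^sub>2 a\<^sub>3\<^sup>+, K\<^sub>2 a\<^sub>3\<^sup>-, a\<^sub>2\<^sup>+, a\<^sub>2\<^sup>-\<close> and back.  Those relations hold on \<open>|0, 0, k\<rangle>\<close> by inspection and propagate to
  \<open>|i, j, k\<rangle>\<close> because \<open>K\<^sub>2 a\<^sub>1\<^sup>+\<close> and \<open>a\<^sub>2\<^sup>+\<close> generate this vector from \<open>|0, 0, k\<rangle>\<close>.

  Finally \<open>\<Phi>\<^sup>2\<close> is the scalar \<open>(1 - q ^ (x + y + 1))\<^sup>2\<close> on the states whose site 0 carries \<open>x\<close> and \<open>y\<close>, so after division by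
  \<open>1 - q ^ (x + y + 1)\<close>, which is nonzero for generic \<open>q\<close>, it is an involution and hence invertible
  (\<open>stay_hop_row_square\<close>).
\<close>

section \<open>The R-operator and its q-binomial formula\<close>

text \<open>
  A function \<open>f\<close> stands for the vector with coefficients \<open>f a b c\<close> with respect to the basis \<open>|a, b, c\<rangle>\<close> of
  \<open>F \<otimes> F \<otimes> F\<close>.  All functions are allowed, because the operators used below have finite rows.
\<close>

type_synonym 'k vec3 = "nat \<Rightarrow> nat \<Rightarrow> nat \<Rightarrow> 'k"

locale generic_q =
  fixes q :: "'k::field_char_0"
  assumes q_nz: "q \<noteq> 0" and q_pow: "m > 0 \<Longrightarrow> q ^ m \<noteq> 1"
begin

lemma q_pow_nz [simp]: "q ^ m \<noteq> 0"
  using q_nz by simp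

lemma q_double: "q ^ (2 * n) = q ^ n * q ^ n" "q ^ (n * 2) = q ^ n * q ^ n"
  by (simp_all add: mult_2 mult_2_right power_add)

lemma qpoch_Suc: "qpoch q a (Suc m) = qpoch q a m * (1 - q ^ (a * Suc m))"
  by (simp add: qpoch_def)

lemma qpoch_0 [simp]: "qpoch q a 0 = 1"
  by (simp add: qpoch_def)

lemma qpoch_nz: "a > 0 \<Longrightarrow> qpoch q a m \<noteq> 0"
  unfolding qpoch_def using q_pow by force

lemma qbinom2_0 [simp]: "qbinom2 q m 0 = 1"
  by (simp add: qbinom2_def qpoch_nz)

lemma qbinom2_eq_0: "m < k \<Longrightarrow> qbinom2 q m k = 0"
  by (simp add: qbinom2_def)

text \<open>
  Of the two q-Pascal rules this is the one whose power of \<open>q\<close> fits the exponents of \<open>R\<close>, for the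
  recursion in the first index as well as in the second.
\<close>

lemma qbinom2_Pascal:
  "qbinom2 q (Suc m) (Suc k) = qbinom2 q m (Suc k) + q ^ (2 * (m - k)) * qbinom2 q m k"
proof (cases "k < m")
  case True
  then obtain d where m: "m = Suc (k + d)"
    by (metis less_imp_Suc_add add_Suc_right)
  have nz: "1 - q ^ (2 * Suc k) \<noteq> 0" "1 - q ^ (2 * Suc d) \<noteq> 0"
    using q_pow[of "2 * Suc k"] q_pow[of "2 * Suc d"] by auto
  have eq: "1 - q ^ (2 * Suc m) = (1 - q ^ (2 * Suc d)) + q ^ (2 * Suc d) * (1 - q ^ (2 * Suc k))"
    by (simp add: m algebra_simps power_add [symmetric] del: mult_Suc) (simp add: power_add algebra_simps)
  have qp: "qpoch q 2 k \<noteq> 0" "qpoch q 2 d \<noteq> 0" "qpoch q 2 m \<noteq> 0"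
    by (simp_all add: qpoch_nz)
  have e1: "qbinom2 q (Suc m) (Suc k) =
     qpoch q 2 m * (1 - q ^ (2 * Suc m)) / (qpoch q 2 k * (1 - q ^ (2 * Suc k)) * (qpoch q 2 d * (1 - q ^ (2 * Suc d))))"
    unfolding qbinom2_def using m by (simp add: qpoch_Suc del: mult_Suc power_Suc mult_Suc_right)
  have e2: "qbinom2 q m (Suc k) = qpoch q 2 m / (qpoch q 2 k * (1 - q ^ (2 * Suc k)) * qpoch q 2 d)"
    unfolding qbinom2_def using m qpoch_Suc[of 2 k] by (simp del: mult_Suc power_Suc mult_Suc_right)
  have e3: "qbinom2 q m k = qpoch q 2 m / (qpoch q 2 k * (qpoch q 2 d * (1 - q ^ (2 * Suc d))))"
    unfolding qbinom2_def using m qpoch_Suc[of 2 d] by (simp add: Suc_diff_le del: mult_Suc power_Suc mult_Suc_right)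
  have md: "m - k = Suc d" using m by simp
  show ?thesis unfolding e1 e2 e3 eq md
    using nz qp by (simp add: divide_simps) (simp add: algebra_simps)
next
  case False
  then show ?thesis
    using qpoch_nz[of 2] by (cases "k = m") (auto simp: qbinom2_def)
qed

text \<open>
  \<open>R i j k\<close> is the column of the operator of a site 0, that is, the image of \<open>|i, j, k\<rangle>\<close>.
\<close>

definition R :: "nat \<Rightarrow> nat \<Rightarrow> nat \<Rightarrow> 'k vec3" where
  "R i j k a b c = S3_0 q a b c i j k"

lemma R_nz_D: "R i j k a b c \<noteq> 0 \<Longrightarrow> a + b = i + j \<and> b + c = j + k"
  by (auto simp: R_def S3_0_def split: if_splits)

lemma R_sum:
  assumes "a + b = i + j" "b + c = j + k"
  shows "R i j k a b c = (\<Sum>m\<le>b. (- 1) ^ (b - m)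
          * q powi (int i * (int c - int j) + (int k + 1) * (int b - int m) + int m * (int m - int k))
          * (qpoch q 2 (c + m) / qpoch q 2 c) * qbinom2 q i m * qbinom2 q j (b - m))"
proof -
  have "{(l, m). l + m = b} = (\<lambda>m. (b - m, m)) ` {..b}" by (auto simp: image_iff)
  moreover have "inj_on (\<lambda>m. (b - m, m)) {..b}" by (auto simp: inj_on_def)
  ultimately show ?thesis using assms
    by (simp add: R_def S3_0_def sum.reindex of_nat_diff)
qed

lemma R_first_second_0: "R 0 0 k a b c = of_bool (a = 0 \<and> b = 0 \<and> c = k)"
proof (cases "a = 0 \<and> b = 0 \<and> c = k")
  case True
  then show ?thesis by (simp add: R_sum qpoch_nz)
next
  case False
  then show ?thesis using R_nz_D[of 0 0 k a b c] by fastforce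
qed

lemma powi_combine: "q ^ n * q powi e = q powi (int n + e)" "q powi e * q ^ n = q powi (int n + e)"
  using q_nz by (simp_all add: power_int_add mult.commute)

section \<open>Oscillator operators and the R-operator\<close>

definition scl :: "'k \<Rightarrow> 'k vec3 \<Rightarrow> 'k vec3" where
  "scl x f = (\<lambda>a b c. x * f a b c)"

text \<open>
  In terms of the oscillators this is \<open>K\<^sub>3 a\<^sub>1\<^sup>+ + K\<^sub>1 a\<^sub>2\<^sup>+ a\<^sub>3\<^sup>-\<close>, the operator that \<open>R\<close> makes out of
  \<open>K\<^sub>2 a\<^sub>1\<^sup>+\<close>.
\<close>

definition raise1' :: "'k vec3 \<Rightarrow> 'k vec3" where
  "raise1' f = (\<lambda>a b c. q ^ c * (if a = 0 then 0 else f (a - 1) b c)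
    + q ^ a * (1 - q ^ (2 * (c + 1))) * (if b = 0 then 0 else f a (b - 1) (c + 1)))"

text \<open>
  The q-Pascal rule for the factor that contains \<open>i\<close> splits the sum into two sums.  Term by term these are the
  two sums on the right; the powers of \<open>q\<close> agree by the conservation laws.
\<close>

lemma R_intertwines_raise1_supported:
  assumes "a + b = Suc i + j" "b + c = j + k"
  shows "q ^ j * R (Suc i) j k a b c = raise1' (R i j k) a b c"
proof -
  define t where "t m B = (- 1) ^ (b - m)
          * q powi (int (Suc i) * (int c - int j) + (int k + 1) * (int b - int m) + int m * (int m - int k))
          * (qpoch q 2 (c + m) / qpoch q 2 c) * B * qbinom2 q j (b - m)" for m B
  have t_add: "t m (B + C) = t m B + t m C" for m B C
    by (simp only: t_def distrib_left distrib_right)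
  have "R (Suc i) j k a b c = (\<Sum>m\<le>b. t m (qbinom2 q (Suc i) m))"
    using assms by (simp add: R_sum t_def)
  also have "\<dots> = (\<Sum>m\<le>b. t m (qbinom2 q i m)
     + t m (if m = 0 then 0 else q ^ (2 * (i - (m - 1))) * qbinom2 q i (m - 1)))"
  proof (rule sum.cong [OF refl])
    fix m show "t m (qbinom2 q (Suc i) m) = t m (qbinom2 q i m)
     + t m (if m = 0 then 0 else q ^ (2 * (i - (m - 1))) * qbinom2 q i (m - 1))"
      by (cases m) (simp_all add: t_add [symmetric] qbinom2_Pascal)
  qed
  finally have main: "R (Suc i) j k a b c = (\<Sum>m\<le>b. t m (qbinom2 q i m))
     + (\<Sum>m\<le>b. t m (if m = 0 then 0 else q ^ (2 * (i - (m - 1))) * qbinom2 q i (m - 1)))"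
    by (simp add: sum.distrib)
  (* For a = 0 each term has m > i or b - m > j, since b exceeds i + j. *)
  have first: "q ^ j * (\<Sum>m\<le>b. t m (qbinom2 q i m)) = q ^ c * (if a = 0 then 0 else R i j k (a - 1) b c)"
  proof (cases a)
    case 0
    have "t m (qbinom2 q i m) = 0" if "m \<le> b" for m
    proof (cases "m \<le> i")
      case True
      then have "b - m > j" using assms 0 that by simp
      then show ?thesis by (simp add: t_def qbinom2_eq_0)
    qed (simp add: t_def qbinom2_eq_0)
    then show ?thesis using 0 by simp
  next
    case (Suc a')
    have kk: "int k = int b + int c - int j" using assms by simp
    have "q ^ j * (\<Sum>m\<le>b. t m (qbinom2 q i m)) = q ^ c * R i j k a' b c"
      using assms Suc
      apply (simp add: R_sum t_def sum_distrib_left)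
      apply (rule sum.cong [OF refl])
      subgoal for m
        using powi_combine(1)[of j "(1 + int i) * (int c - int j) + (int k + 1) * (int b - int m) + int m * (int m - int k)"]
          powi_combine(1)[of c "int i * (int c - int j) + (int k + 1) * (int b - int m) + int m * (int m - int k)"]
        by (simp add: kk algebra_simps)
      done
    then show ?thesis using Suc by simp
  qed
  have second: "q ^ j * (\<Sum>m\<le>b. t m (if m = 0 then 0 else q ^ (2 * (i - (m - 1))) * qbinom2 q i (m - 1)))
    = q ^ a * (1 - q ^ (2 * (c + 1))) * (if b = 0 then 0 else R i j k a (b - 1) (c + 1))"
  proof (cases b)
    case 0
    then show ?thesis by (simp add: t_def)
  next
    case (Suc b')
    have kk: "int k = int b' + 1 + int c - int j" using assms Suc by simp
    have aa: "int a = int i + int j - int b'" using assms Suc by simp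
    have qp: "(1 - q ^ (2 * (c + 1))) / qpoch q 2 (Suc c) = 1 / qpoch q 2 c"
      using q_pow[of "2 * (c + 1)"] qpoch_nz[of 2] by (simp add: qpoch_Suc divide_simps)
    have "q ^ j * t (Suc m) (q ^ (2 * (i - m)) * qbinom2 q i m)
        = q ^ a * ((1 - q ^ (2 * (c + 1))) * ((- 1) ^ (b' - m)
          * q powi (int i * (int (Suc c) - int j) + (int k + 1) * (int b' - int m) + int m * (int m - int k))
          * (qpoch q 2 (Suc c + m) / qpoch q 2 (Suc c)) * qbinom2 q i m * qbinom2 q j (b' - m)))"
      if "m \<le> b'" for m
    proof (cases "m \<le> i")
      case True
      have e: "q ^ j * (q ^ (2 * (i - m)) *
         q powi (int (Suc i) * (int c - int j) + (int k + 1) * (int b - int (Suc m)) + int (Suc m) * (int (Suc m) - int k)))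
       = q ^ a * q powi (int i * (int (Suc c) - int j) + (int k + 1) * (int b' - int m) + int m * (int m - int k))"
        unfolding powi_combine using True Suc
        by (simp add: of_nat_diff kk aa) (simp add: algebra_simps)
      have "q ^ j * t (Suc m) (q ^ (2 * (i - m)) * qbinom2 q i m)
        = (q ^ j * (q ^ (2 * (i - m)) *
         q powi (int (Suc i) * (int c - int j) + (int k + 1) * (int b - int (Suc m)) + int (Suc m) * (int (Suc m) - int k))))
          * ((- 1) ^ (b' - m) * qpoch q 2 (Suc c + m) * qbinom2 q i m * qbinom2 q j (b' - m))
           * (1 / qpoch q 2 c)"
        unfolding t_def using Suc by simp
      also have "\<dots> = (q ^ a * q powi (int i * (int (Suc c) - int j) + (int k + 1) * (int b' - int m) + int m * (int m - int k)))
          * ((- 1) ^ (b' - m) * qpoch q 2 (Suc c + m) * qbinom2 q i m * qbinom2 q j (b' - m))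
           * ((1 - q ^ (2 * (c + 1))) / qpoch q 2 (Suc c))"
        unfolding e qp ..
      finally show ?thesis by simp
    qed (simp add: t_def qbinom2_eq_0)
    then show ?thesis
      using Suc assms unfolding Suc
      by (simp add: sum.atMost_Suc_shift R_sum sum_distrib_left t_def [of 0] del: of_nat_Suc power_Suc mult_Suc_right sum.atMost_Suc)
        (simp add: algebra_simps)
  qed
  show ?thesis unfolding main raise1'_def distrib_left first second ..
qed

lemma R_intertwines_raise1: "scl (q ^ j) (R (Suc i) j k) = raise1' (R i j k)"
  unfolding scl_def
proof (intro ext)
  fix a b c
  show "q ^ j * R (Suc i) j k a b c = raise1' (R i j k) a b c"
  proof (cases "a + b = Suc i + j \<and> b + c = j + k")
    case True
    then show ?thesis using R_intertwines_raise1_supported by blast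
  next
    case False
    moreover have "R (Suc i) j k a b c = 0" using False R_nz_D by blast
    moreover have "a \<noteq> 0 \<Longrightarrow> R i j k (a - 1) b c = 0" using False R_nz_D[of i j k "a - 1" b c] by (cases a) force+
    moreover have "b \<noteq> 0 \<Longrightarrow> R i j k a (b - 1) (c + 1) = 0" using False R_nz_D[of i j k a "b - 1" "c + 1"] by (cases b) force+
    ultimately show ?thesis by (cases "a = 0"; cases "b = 0"; simp add: raise1'_def)
  qed
qed

text \<open>
  The operators without a prime are \<open>K\<^sub>2 a\<^sub>1\<^sup>+\<close>, \<open>a\<^sub>2\<^sup>+\<close>, \<open>a\<^sub>2\<^sup>-\<close>, \<open>K\<^sub>2 a\<^sub>3\<^sup>+\<close> and \<open>K\<^sub>2 a\<^sub>3\<^sup>-\<close>.  Their primed partners are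
  \<open>K\<^sub>3 a\<^sub>1\<^sup>+ + K\<^sub>1 a\<^sub>2\<^sup>+ a\<^sub>3\<^sup>-\<close>, \<open>a\<^sub>1\<^sup>+ a\<^sub>3\<^sup>+ - q K\<^sub>1 K\<^sub>3 a\<^sub>2\<^sup>+\<close>, \<open>a\<^sub>1\<^sup>- a\<^sub>3\<^sup>- - q K\<^sub>1 K\<^sub>3 a\<^sub>2\<^sup>-\<close>, \<open>K\<^sub>1 a\<^sub>3\<^sup>+ + K\<^sub>3 a\<^sub>1\<^sup>- a\<^sub>2\<^sup>+\<close> and
  \<open>K\<^sub>1 a\<^sub>3\<^sup>- + K\<^sub>3 a\<^sub>1\<^sup>+ a\<^sub>2\<^sup>-\<close>.  Conjugation by \<open>R\<close> interchanges an operator with its partner.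
\<close>

definition raise1 :: "'k vec3 \<Rightarrow> 'k vec3" where
  "raise1 f = (\<lambda>a b c. q ^ b * (if a = 0 then 0 else f (a - 1) b c))"

definition raise2 :: "'k vec3 \<Rightarrow> 'k vec3" where
  "raise2 f = (\<lambda>a b c. if b = 0 then 0 else f a (b - 1) c)"

definition raise2' :: "'k vec3 \<Rightarrow> 'k vec3" where
  "raise2' f = (\<lambda>a b c. (if a = 0 \<or> c = 0 then 0 else f (a - 1) b (c - 1))
     - q ^ (1 + a + c) * (if b = 0 then 0 else f a (b - 1) c))"

definition lower2 :: "'k vec3 \<Rightarrow> 'k vec3" where
  "lower2 f = (\<lambda>a b c. (1 - q ^ (2 * (b + 1))) * f a (b + 1) c)"

definition lower2' :: "'k vec3 \<Rightarrow> 'k vec3" where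
  "lower2' f = (\<lambda>a b c. (1 - q ^ (2 * (a + 1))) * (1 - q ^ (2 * (c + 1))) * f (a + 1) b (c + 1)
     - q ^ (1 + a + c) * (1 - q ^ (2 * (b + 1))) * f a (b + 1) c)"

definition raise3 :: "'k vec3 \<Rightarrow> 'k vec3" where
  "raise3 f = (\<lambda>a b c. q ^ b * (if c = 0 then 0 else f a b (c - 1)))"

definition raise3' :: "'k vec3 \<Rightarrow> 'k vec3" where
  "raise3' f = (\<lambda>a b c. q ^ a * (if c = 0 then 0 else f a b (c - 1))
     + q ^ c * (1 - q ^ (2 * (a + 1))) * (if b = 0 then 0 else f (a + 1) (b - 1) c))"

definition lower3 :: "'k vec3 \<Rightarrow> 'k vec3" where
  "lower3 f = (\<lambda>a b c. q ^ b * (1 - q ^ (2 * (c + 1))) * f a b (c + 1))"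

definition lower3' :: "'k vec3 \<Rightarrow> 'k vec3" where
  "lower3' f = (\<lambda>a b c. q ^ a * (1 - q ^ (2 * (c + 1))) * f a b (c + 1)
     + q ^ c * (1 - q ^ (2 * (b + 1))) * (if a = 0 then 0 else f (a - 1) (b + 1) c))"

text \<open>
  This is the diagonal operator \<open>K\<^sub>1\<^sup>u K\<^sub>2\<^sup>v K\<^sub>3\<^sup>w\<close>.
\<close>

definition wt :: "nat \<Rightarrow> nat \<Rightarrow> nat \<Rightarrow> 'k vec3 \<Rightarrow> 'k vec3" where
  "wt u v w f = (\<lambda>a b c. q ^ (u * a + v * b + w * c) * f a b c)"

lemmas op_defs = raise1_def raise1'_def raise2_def raise2'_def lower2_def lower2'_def
  raise3_def raise3'_def lower3_def lower3'_def wt_def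

lemma op_linear:
  "raise1 (f + g) = raise1 f + raise1 g" "raise1 (f - g) = raise1 f - raise1 g" "raise1 (scl x f) = scl x (raise1 f)" "raise1 (- f) = - raise1 f"
  "raise1' (f + g) = raise1' f + raise1' g" "raise1' (f - g) = raise1' f - raise1' g" "raise1' (scl x f) = scl x (raise1' f)" "raise1' (- f) = - raise1' f"
  "raise2 (f + g) = raise2 f + raise2 g" "raise2 (f - g) = raise2 f - raise2 g" "raise2 (scl x f) = scl x (raise2 f)" "raise2 (- f) = - raise2 f"
  "raise2' (f + g) = raise2' f + raise2' g" "raise2' (f - g) = raise2' f - raise2' g" "raise2' (scl x f) = scl x (raise2' f)" "raise2' (- f) = - raise2' f"
  "lower2 (f + g) = lower2 f + lower2 g" "lower2 (f - g) = lower2 f - lower2 g" "lower2 (scl x f) = scl x (lower2 f)" "lower2 (- f) = - lower2 f"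
  "lower2' (f + g) = lower2' f + lower2' g" "lower2' (f - g) = lower2' f - lower2' g" "lower2' (scl x f) = scl x (lower2' f)" "lower2' (- f) = - lower2' f"
  "raise3 (f + g) = raise3 f + raise3 g" "raise3 (f - g) = raise3 f - raise3 g" "raise3 (scl x f) = scl x (raise3 f)" "raise3 (- f) = - raise3 f"
  "raise3' (f + g) = raise3' f + raise3' g" "raise3' (f - g) = raise3' f - raise3' g" "raise3' (scl x f) = scl x (raise3' f)" "raise3' (- f) = - raise3' f"
  "lower3 (f + g) = lower3 f + lower3 g" "lower3 (f - g) = lower3 f - lower3 g" "lower3 (scl x f) = scl x (lower3 f)" "lower3 (- f) = - lower3 f"
  "lower3' (f + g) = lower3' f + lower3' g" "lower3' (f - g) = lower3' f - lower3' g" "lower3' (scl x f) = scl x (lower3' f)" "lower3' (- f) = - lower3' f"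
  by (simp_all add: op_defs scl_def fun_eq_iff algebra_simps)

lemma op_0 [simp]: "raise1 0 = 0" "raise1' 0 = 0" "raise2 0 = 0" "raise2' 0 = 0" "lower2 0 = 0" "lower2' 0 = 0"
  "raise3 0 = 0" "raise3' 0 = 0" "lower3 0 = 0" "lower3' 0 = 0" "scl x 0 = 0"
  by (simp_all add: op_defs scl_def fun_eq_iff)

lemma scl_simps:
  "scl x (scl y f) = scl (x * y) f" "scl x (f + g) = scl x f + scl x g"
  "scl x (f - g) = scl x f - scl x g" "scl 1 f = f" "scl 0 f = 0" "scl x (- f) = - scl x f"
  by (simp_all add: scl_def fun_eq_iff algebra_simps)

lemma vec3_eqI:
  fixes f g :: "'k vec3"
  assumes "f 0 0 0 = g 0 0 0" "\<And>c. f 0 0 (Suc c) = g 0 0 (Suc c)" "\<And>b. f 0 (Suc b) 0 = g 0 (Suc b) 0"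
    "\<And>b c. f 0 (Suc b) (Suc c) = g 0 (Suc b) (Suc c)" "\<And>a. f (Suc a) 0 0 = g (Suc a) 0 0"
    "\<And>a c. f (Suc a) 0 (Suc c) = g (Suc a) 0 (Suc c)" "\<And>a b. f (Suc a) (Suc b) 0 = g (Suc a) (Suc b) 0"
    "\<And>a b c. f (Suc a) (Suc b) (Suc c) = g (Suc a) (Suc b) (Suc c)"
  shows "f = g"
proof (intro ext)
  show "f a b c = g a b c" for a b c
    by (cases a; cases b; cases c) (simp_all add: assms)
qed

text \<open>
  The primed operators satisfy the same commutation relations as their partners.  These instances move
  a primed operator past the two operators that build the columns of \<open>R\<close>.
\<close>

lemma commute1:
  "raise1' (raise2' f) = scl q (raise2' (raise1' f))"
  "lower3' (raise1' f) = raise1' (lower3' f)"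
  "lower3' (raise2' f) = scl q (raise2' (lower3' f))"
  "raise3' (raise1' f) = raise1' (raise3' f)"
  "raise3' (raise2' f) = scl q (raise2' (raise3' f))"
  "lower2' (raise1' f) = scl q (raise1' (lower2' f))"
  "lower2' (raise2' f) = scl (q ^ 2) (raise2' (lower2' f)) + scl (1 - q ^ 2) f"
  by ((rule vec3_eqI; simp add: op_defs scl_def algebra_simps power_add q_double power2_eq_square)+)

text \<open>
  The same for the operators without a prime, where the relations being copied are those of the primed
  partners with \<open>K\<^sub>2 a\<^sub>1\<^sup>+\<close> and \<open>a\<^sub>2\<^sup>+\<close>.
\<close>

lemma commute2:
  "raise1 (raise1' f) = raise1' (raise1 f)"
  "raise1 (raise2' f) = raise2' (raise1 f)"
  "raise2 (raise1' f) = raise1' (raise2 f)"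
  "raise2 (raise2' f) = raise2' (raise2 f)"
  "lower3 (raise1' f) = scl q (raise1' (lower3 f))"
  "lower3 (raise2' f) = scl (q ^ 2) (raise2' (lower3 f)) + scl (1 - q ^ 2) (raise1 f)"
  "raise3 (raise1' f) = scl q (raise1' (raise3 f)) + scl (1 - q ^ 2) (raise2' (wt 0 1 1 f))"
  "raise3 (raise2' f) = raise2' (raise3 f)"
  "lower2 (raise1' f) = scl (q ^ 2) (raise1' (lower2 f)) + scl (1 - q ^ 2) (lower3' f)"
  "lower2 (raise2' f) = raise2' (lower2 f) - scl (q * (1 - q ^ 2)) (wt 1 2 1 f)"
  by ((rule vec3_eqI; simp add: op_defs scl_def algebra_simps power_add q_double power2_eq_square)+)

lemma R_Suc1: "R (Suc i) j k = scl (inverse (q ^ j)) (raise1' (R i j k))"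
  using q_nz by (simp add: R_intertwines_raise1 [symmetric] scl_simps)

text \<open>
  Up to a nonzero factor the vector \<open>|i, j, k\<rangle>\<close> arises from \<open>|0, 0, k\<rangle>\<close> by applying \<open>a\<^sub>2\<^sup>+\<close> first and then \<open>K\<^sub>2 a\<^sub>1\<^sup>+\<close>.
\<close>

lemma R_induct [case_names base up2 up1]:
  assumes "\<And>k. P 0 0 k" "\<And>j k. (\<And>k. P 0 j k) \<Longrightarrow> P 0 (Suc j) k"
    "\<And>i j k. (\<And>j k. P i j k) \<Longrightarrow> P (Suc i) j k"
  shows "P i j k"
proof (induction i arbitrary: j k)
  case (0 j k)
  show ?case
  proof (induction j arbitrary: k)
    case 0
    show ?case by (rule assms(1))
  next
    case (Suc j)
    show ?case by (rule assms(2)) (rule Suc)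
  qed
next
  case (Suc i)
  show ?case by (rule assms(3)) (rule Suc)
qed

lemma R_first_0: "a + b = j \<Longrightarrow> b + c = j + k \<Longrightarrow>
  R 0 j k a b c = (- 1) ^ b * q ^ ((k + 1) * b) * qbinom2 q j b"
proof -
  assume *: "a + b = j" "b + c = j + k"
  have "R 0 j k a b c = (\<Sum>m\<le>b. if m = 0 then (- 1) ^ b * q powi ((int k + 1) * int b) * qbinom2 q j b else 0)"
    unfolding R_sum [OF add_0_left [symmetric, THEN trans [OF *(1)]] *(2)]
    using qpoch_nz[of 2 c] by (intro sum.cong) (auto simp: qbinom2_eq_0)
  also have "(int k + 1) * int b = int ((k + 1) * b)" by (simp add: algebra_simps)
  finally show ?thesis unfolding power_int_of_nat by simp
qed

text \<open>
  With \<open>i = 0\<close> the sum that defines \<open>R\<close> has a single term, and the recursion in \<open>j\<close> is the q-Pascal rule.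
\<close>

lemma R_Suc2_of_0: "R 0 (Suc j) k a b c = raise2' (R 0 j k) a b c"
proof (cases "a + b = Suc j \<and> b + c = Suc j + k")
  case False
  have "R 0 (Suc j) k a b c = 0" using False R_nz_D by fastforce
  moreover have "a \<noteq> 0 \<Longrightarrow> c \<noteq> 0 \<Longrightarrow> R 0 j k (a - 1) b (c - 1) = 0"
    using False R_nz_D[of 0 j k "a - 1" b "c - 1"] by (cases a; cases c) force+
  moreover have "b \<noteq> 0 \<Longrightarrow> R 0 j k a (b - 1) c = 0"
    using False R_nz_D[of 0 j k a "b - 1" c] by (cases b) force+
  ultimately show ?thesis by (cases "a = 0"; cases "c = 0"; cases "b = 0"; simp add: raise2'_def)
next
  case True
  have ac: "c = a + k" using True by simp
  show ?thesis
  proof (cases b)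
    case 0
    then have "a = Suc j" "c = Suc (j + k)" using True by auto
    with 0 show ?thesis by (simp add: raise2'_def R_first_0)
  next
    case (Suc b')
    have L: "R 0 (Suc j) k a b c = (- 1) ^ b * q ^ ((k + 1) * b) * (qbinom2 q j b + q ^ (2 * (j - b')) * qbinom2 q j b')"
      using True Suc by (simp add: R_first_0 qbinom2_Pascal)
    have one: "(if a = 0 \<or> c = 0 then 0 else R 0 j k (a - 1) b (c - 1)) = (- 1) ^ b * q ^ ((k + 1) * b) * qbinom2 q j b"
    proof (cases "a = 0")
      case True': True
      then show ?thesis using True Suc qbinom2_eq_0[of j b] by simp
    next
      case False
      then have "c \<noteq> 0" using ac by simp
      then show ?thesis using False True by (simp add: R_first_0)
    qed
    have ja: "j - b' = a" using True Suc by arith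
    have two: "R 0 j k a b' c = (- 1) ^ b' * q ^ ((k + 1) * b') * qbinom2 q j b'"
      using True Suc by (simp add: R_first_0)
    have "(k + 1) * b + 2 * a = (1 + a + c) + (k + 1) * b'"
      by (simp add: Suc ac)
    then have e: "q ^ ((k + 1) * b) * q ^ (2 * a) = q ^ (1 + a + c) * q ^ ((k + 1) * b')"
      unfolding power_add [symmetric] by (rule arg_cong)
    have "(- 1) ^ b * q ^ ((k + 1) * b) * (q ^ (2 * a) * qbinom2 q j b')
        = (- 1) ^ b * (q ^ ((k + 1) * b) * q ^ (2 * a)) * qbinom2 q j b'"
      by (simp only: mult.assoc)
    also have "\<dots> = - (q ^ (1 + a + c) * ((- 1) ^ b' * q ^ ((k + 1) * b') * qbinom2 q j b'))"
      unfolding e by (simp add: Suc)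
    finally have "(- 1) ^ b * q ^ ((k + 1) * b) * (q ^ (2 * a) * qbinom2 q j b')
        = - (q ^ (1 + a + c) * ((- 1) ^ b' * q ^ ((k + 1) * b') * qbinom2 q j b'))" .
    then show ?thesis unfolding L raise2'_def one ja distrib_left using Suc two by simp
  qed
qed

text \<open>
  For \<open>i > 0\<close> the defining sum does not split term by term, but \<open>K\<^sub>2 a\<^sub>1\<^sup>+\<close> q-commutes with \<open>a\<^sub>2\<^sup>+\<close> in the same
  way as their primed partners do, so the case \<open>i = 0\<close> propagates.
\<close>

lemma R_Suc2: "R i (Suc j) k = raise2' (R i j k)"
proof (induction i arbitrary: j k)
  case 0
  show ?case by (intro ext R_Suc2_of_0)
next
  case (Suc i)
  have e: "inverse (q ^ Suc j) * q = inverse (q ^ j)"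
    using q_nz by (simp add: field_simps)
  have "R (Suc i) (Suc j) k = scl (inverse (q ^ Suc j)) (raise1' (raise2' (R i j k)))"
    by (simp add: R_Suc1 Suc)
  also have "\<dots> = scl (inverse (q ^ j)) (raise2' (raise1' (R i j k)))"
    by (simp only: commute1 scl_simps e)
  also have "\<dots> = raise2' (R (Suc i) j k)"
    by (simp add: R_Suc1 op_linear)
  finally show ?case .
qed

text \<open>
  The conservation laws say that \<open>R\<close> commutes with \<open>K\<^sub>2 K\<^sub>3\<close> and \<open>K\<^sub>1 K\<^sub>2\<close>.
\<close>

lemma R_weight: "wt 0 1 1 (R i j k) = scl (q ^ (j + k)) (R i j k)"
  "wt 1 2 1 (R i j k) = scl (q ^ (i + 2 * j + k)) (R i j k)"
proof -
  have "q ^ (b + c) * R i j k a b c = q ^ (j + k) * R i j k a b c" for a b c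
    using R_nz_D[of i j k a b c] by fastforce
  then show "wt 0 1 1 (R i j k) = scl (q ^ (j + k)) (R i j k)"
    unfolding wt_def scl_def fun_eq_iff by simp
  have "q ^ (a + 2 * b + c) * R i j k a b c = q ^ (i + 2 * j + k) * R i j k a b c" for a b c
  proof (cases "R i j k a b c = 0")
    case False
    then have "a + 2 * b + c = i + 2 * j + k" using R_nz_D[OF False] by arith
    then show ?thesis by metis
  qed simp
  then show "wt 1 2 1 (R i j k) = scl (q ^ (i + 2 * j + k)) (R i j k)"
    unfolding wt_def scl_def fun_eq_iff by simp
qed

text \<open>
  In this and the following lemmas the left side is the image under \<open>R\<close> of an operator applied to \<open>|i, j, k\<rangle>\<close>, and
  the right side is its partner applied to the image of \<open>|i, j, k\<rangle>\<close>.  A truncated index such as \<open>k - 1\<close> occurs with a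
  coefficient that vanishes when the truncation takes effect.
\<close>

lemma R_intertwines_lower3: "scl (q ^ j * (1 - q ^ (2 * k))) (R i j (k - 1)) = lower3' (R i j k)"
proof (induction i j k rule: R_induct)
  case (base k)
  show ?case unfolding lower3'_def scl_def fun_eq_iff
    by (cases k) (auto simp: R_first_second_0)
next
  case (up2 j k)
  have "scl (q ^ Suc j * (1 - q ^ (2 * k))) (R 0 (Suc j) (k - 1))
    = scl q (raise2' (scl (q ^ j * (1 - q ^ (2 * k))) (R 0 j (k - 1))))"
    by (simp add: R_Suc2 op_linear scl_simps mult.assoc)
  also have "\<dots> = lower3' (R 0 (Suc j) k)" unfolding up2 by (simp add: commute1 R_Suc2)
  finally show ?case .
next
  case (up1 i j k)
  have "scl (q ^ j * (1 - q ^ (2 * k))) (R (Suc i) j (k - 1))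
    = scl (inverse (q ^ j)) (raise1' (scl (q ^ j * (1 - q ^ (2 * k))) (R i j (k - 1))))"
    by (simp add: R_Suc1 op_linear scl_simps mult.commute)
  also have "\<dots> = lower3' (R (Suc i) j k)" unfolding up1 by (simp add: commute1 R_Suc1 op_linear)
  finally show ?case .
qed

lemma R_intertwines_raise3: "scl (q ^ j) (R i j (Suc k)) = raise3' (R i j k)"
proof (induction i j k rule: R_induct)
  case (base k)
  show ?case unfolding raise3'_def scl_def fun_eq_iff
    by (auto simp: R_first_second_0)
next
  case (up2 j k)
  have "scl (q ^ Suc j) (R 0 (Suc j) (Suc k)) = scl q (raise2' (scl (q ^ j) (R 0 j (Suc k))))"
    by (simp add: R_Suc2 op_linear scl_simps)
  also have "\<dots> = raise3' (R 0 (Suc j) k)" unfolding up2 by (simp add: commute1 R_Suc2)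
  finally show ?case .
next
  case (up1 i j k)
  have "scl (q ^ j) (R (Suc i) j (Suc k)) = scl (inverse (q ^ j)) (raise1' (scl (q ^ j) (R i j (Suc k))))"
    by (simp add: R_Suc1 op_linear scl_simps mult.commute)
  also have "\<dots> = raise3' (R (Suc i) j k)" unfolding up1 by (simp add: commute1 R_Suc1 op_linear)
  finally show ?case .
qed

lemma R_intertwines_lower2: "scl (1 - q ^ (2 * j)) (R i (j - 1) k) = lower2' (R i j k)"
proof (induction i j k rule: R_induct)
  case (base k)
  show ?case unfolding lower2'_def scl_def fun_eq_iff
    by (auto simp: R_first_second_0)
next
  case (up2 j k)
  have "scl (q ^ 2) (raise2' (scl (1 - q ^ (2 * j)) (R 0 (j - 1) k))) = scl (q ^ 2 * (1 - q ^ (2 * j))) (R 0 j k)"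
    by (cases j) (simp_all add: op_linear scl_simps R_Suc2)
  then have "scl (1 - q ^ (2 * Suc j)) (R 0 j k)
    = scl (q ^ 2) (raise2' (scl (1 - q ^ (2 * j)) (R 0 (j - 1) k))) + scl (1 - q ^ 2) (R 0 j k)"
    by (simp add: scl_def fun_eq_iff algebra_simps power2_eq_square)
  also have "\<dots> = lower2' (R 0 (Suc j) k)" unfolding up2 by (simp add: commute1 R_Suc2)
  finally show ?case by simp
next
  case (up1 i j k)
  have "scl (1 - q ^ (2 * j)) (R (Suc i) (j - 1) k)
    = scl (q * inverse (q ^ j)) (raise1' (scl (1 - q ^ (2 * j)) (R i (j - 1) k)))"
    using q_nz by (cases j) (simp_all add: R_Suc1 op_linear scl_simps field_simps)
  also have "\<dots> = lower2' (R (Suc i) j k)" unfolding up1 by (simp add: commute1 R_Suc1 op_linear scl_simps mult.commute)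
  finally show ?case .
qed

text \<open>
  From here on the operator that acts before \<open>R\<close> is the primed one.
\<close>

lemma R_intertwines_raise1': "scl (q ^ k) (R (Suc i) j k) + scl (q ^ i * (1 - q ^ (2 * k))) (R i (Suc j) (k - 1)) = raise1 (R i j k)"
proof (induction i j k rule: R_induct)
  case (base k)
  show ?case unfolding R_Suc1 R_Suc2 scl_def op_defs fun_eq_iff
    by (cases k) (auto simp: R_first_second_0 algebra_simps power_add q_double intro!: gr0I)
next
  case (up2 j k)
  have "scl (q ^ k) (R (Suc 0) (Suc j) k) + scl (q ^ 0 * (1 - q ^ (2 * k))) (R 0 (Suc (Suc j)) (k - 1))
    = raise2' (scl (q ^ k) (R (Suc 0) j k) + scl (q ^ 0 * (1 - q ^ (2 * k))) (R 0 (Suc j) (k - 1)))"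
    by (simp only: op_linear R_Suc2 [symmetric])
  also have "\<dots> = raise1 (R 0 (Suc j) k)" unfolding up2 by (simp add: commute2 R_Suc2)
  finally show ?case .
next
  case (up1 i j k)
  have "scl (q ^ k) (R (Suc (Suc i)) j k) + scl (q ^ Suc i * (1 - q ^ (2 * k))) (R (Suc i) (Suc j) (k - 1))
    = scl (inverse (q ^ j)) (raise1' (scl (q ^ k) (R (Suc i) j k) + scl (q ^ i * (1 - q ^ (2 * k))) (R i (Suc j) (k - 1))))"
    using q_nz by (simp add: op_linear scl_simps R_intertwines_raise1 [symmetric]) (simp add: scl_def fun_eq_iff field_simps)
  also have "\<dots> = raise1 (R (Suc i) j k)" unfolding up1 by (simp add: commute2 R_Suc1 op_linear)
  finally show ?case .
qed

lemma R_intertwines_raise2': "R (Suc i) j (Suc k) - scl (q ^ (1 + i + k)) (R i (Suc j) k) = raise2 (R i j k)"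
proof (induction i j k rule: R_induct)
  case (base k)
  show ?case unfolding R_Suc1 R_Suc2 scl_def op_defs fun_eq_iff
    by (auto simp: R_first_second_0 algebra_simps power_add q_double)
next
  case (up2 j k)
  have "R (Suc 0) (Suc j) (Suc k) - scl (q ^ (1 + 0 + k)) (R 0 (Suc (Suc j)) k)
    = raise2' (R (Suc 0) j (Suc k) - scl (q ^ (1 + 0 + k)) (R 0 (Suc j) k))"
    by (simp only: op_linear R_Suc2 [symmetric])
  also have "\<dots> = raise2 (R 0 (Suc j) k)" unfolding up2 by (simp add: commute2 R_Suc2)
  finally show ?case .
next
  case (up1 i j k)
  have "R (Suc (Suc i)) j (Suc k) - scl (q ^ (1 + Suc i + k)) (R (Suc i) (Suc j) k)
    = scl (inverse (q ^ j)) (raise1' (R (Suc i) j (Suc k) - scl (q ^ (1 + i + k)) (R i (Suc j) k)))"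
    using q_nz by (simp add: op_linear scl_simps R_intertwines_raise1 [symmetric]) (simp add: scl_def fun_eq_iff field_simps)
  also have "\<dots> = raise2 (R (Suc i) j k)" unfolding up1 by (simp add: commute2 R_Suc1 op_linear)
  finally show ?case .
qed

lemma R_intertwines_lower3': "scl (q ^ i * (1 - q ^ (2 * k))) (R i j (k - 1)) + scl (q ^ k * (1 - q ^ (2 * j))) (R (Suc i) (j - 1) k)
   = lower3 (R i j k)"
proof (induction i j k rule: R_induct)
  case (base k)
  show ?case unfolding lower3_def scl_def fun_eq_iff
    by (cases k) (auto simp: R_first_second_0)
next
  case (up2 j k)
  let ?S = "\<lambda>i j k. scl (q ^ i * (1 - q ^ (2 * k))) (R i j (k - 1)) + scl (q ^ k * (1 - q ^ (2 * j))) (R (Suc i) (j - 1) k)"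
  have "?S 0 (Suc j) k = scl (q ^ 2) (raise2' (?S 0 j k)) + scl (1 - q ^ 2) (raise1 (R 0 j k))"
    unfolding R_intertwines_raise1' [symmetric]
    by (cases j; simp add: op_linear scl_simps R_Suc2 [symmetric])
      (simp_all add: scl_def fun_eq_iff algebra_simps power2_eq_square q_double)
  also have "\<dots> = lower3 (R 0 (Suc j) k)" unfolding up2 by (simp add: commute2 R_Suc2)
  finally show ?case .
next
  case (up1 i j k)
  let ?S = "\<lambda>i j k. scl (q ^ i * (1 - q ^ (2 * k))) (R i j (k - 1)) + scl (q ^ k * (1 - q ^ (2 * j))) (R (Suc i) (j - 1) k)"
  have "?S (Suc i) j k = scl (q * inverse (q ^ j)) (raise1' (?S i j k))"
    using q_nz
    by (cases j; simp add: op_linear scl_simps R_intertwines_raise1 [symmetric])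
      (simp_all add: scl_def fun_eq_iff field_simps)
  also have "\<dots> = lower3 (R (Suc i) j k)" unfolding up1 by (simp add: commute2 R_Suc1 op_linear scl_simps mult.commute)
  finally show ?case .
qed

lemma R_intertwines_raise3': "scl (q ^ i) (R i j (Suc k)) + scl (q ^ k * (1 - q ^ (2 * i))) (R (i - 1) (Suc j) k)
   = raise3 (R i j k)"
proof (induction i j k rule: R_induct)
  case (base k)
  show ?case unfolding raise3_def scl_def fun_eq_iff
    by (auto simp: R_first_second_0)
next
  case (up2 j k)
  let ?S = "\<lambda>i j k. scl (q ^ i) (R i j (Suc k)) + scl (q ^ k * (1 - q ^ (2 * i))) (R (i - 1) (Suc j) k)"
  have "?S 0 (Suc j) k = raise2' (?S 0 j k)"
    by (simp add: op_linear R_Suc2 [symmetric] scl_simps)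
  also have "\<dots> = raise3 (R 0 (Suc j) k)" unfolding up2 by (simp add: commute2 R_Suc2)
  finally show ?case .
next
  case (up1 i j k)
  let ?S = "\<lambda>i j k. scl (q ^ i) (R i j (Suc k)) + scl (q ^ k * (1 - q ^ (2 * i))) (R (i - 1) (Suc j) k)"
  have "?S (Suc i) j k = scl (inverse (q ^ j)) (scl q (raise1' (?S i j k)) + scl (1 - q ^ 2) (raise2' (wt 0 1 1 (R i j k))))"
    unfolding R_weight using q_nz
    by (cases i; simp add: op_linear scl_simps R_intertwines_raise1 [symmetric] R_Suc2 [symmetric])
      (simp_all add: scl_def fun_eq_iff field_simps power2_eq_square power_add q_double)
  also have "\<dots> = raise3 (R (Suc i) j k)" unfolding up1 by (simp add: commute2 R_Suc1 op_linear)
  finally show ?case .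
qed

lemma R_intertwines_lower2': "scl ((1 - q ^ (2 * i)) * (1 - q ^ (2 * k))) (R (i - 1) j (k - 1))
    - scl (q ^ (1 + i + k) * (1 - q ^ (2 * j))) (R i (j - 1) k) = lower2 (R i j k)"
proof (induction i j k rule: R_induct)
  case (base k)
  show ?case unfolding lower2_def scl_def fun_eq_iff
    by (auto simp: R_first_second_0)
next
  case (up2 j k)
  let ?S = "\<lambda>i j k. scl ((1 - q ^ (2 * i)) * (1 - q ^ (2 * k))) (R (i - 1) j (k - 1)) - scl (q ^ (1 + i + k) * (1 - q ^ (2 * j))) (R i (j - 1) k)"
  have "?S 0 (Suc j) k = raise2' (?S 0 j k) - scl (q * (1 - q ^ 2)) (wt 1 2 1 (R 0 j k))"
    unfolding R_weight
    by (cases j; simp add: op_linear scl_simps R_Suc2 [symmetric])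
      (simp_all add: scl_def fun_eq_iff algebra_simps power2_eq_square power_add q_double)
  also have "\<dots> = lower2 (R 0 (Suc j) k)" unfolding up2 by (simp add: commute2 R_Suc2)
  finally show ?case .
next
  case (up1 i j k)
  let ?S = "\<lambda>i j k. scl ((1 - q ^ (2 * i)) * (1 - q ^ (2 * k))) (R (i - 1) j (k - 1)) - scl (q ^ (1 + i + k) * (1 - q ^ (2 * j))) (R i (j - 1) k)"
  have "?S (Suc i) j k = scl (inverse (q ^ j)) (scl (q ^ 2) (raise1' (?S i j k)) + scl (1 - q ^ 2) (lower3' (R i j k)))"
    unfolding R_intertwines_lower3 [symmetric] using q_nz
    by (cases i; cases j; simp add: op_linear scl_simps R_intertwines_raise1 [symmetric])
      (simp_all add: scl_def fun_eq_iff field_simps power2_eq_square power_add q_double)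
  also have "\<dots> = lower2 (R (Suc i) j k)" unfolding up1 by (simp add: commute2 R_Suc1 op_linear)
  finally show ?case .
qed

section \<open>The local exchange relation\<close>

text \<open>
  The four entries of \<open>(M \<Phi>) R = R (\<Phi> M)\<close> for the matrices \<open>M\<close> and \<open>\<Phi>\<close> of the introduction.  The first letter in
  the name is the row and the second the column.

  The diagonal entries are \<open>a\<^sub>1\<^sup>+ a\<^sub>2\<^sup>- a\<^sub>3\<^sup>+\<close> and \<open>a\<^sub>1\<^sup>- a\<^sub>2\<^sup>+ a\<^sub>3\<^sup>-\<close> up to diagonal terms, that is, one of \<open>a\<^sub>2\<^sup>+\<close> and \<open>a\<^sub>2\<^sup>-\<close> times the partner
  of the other, corrected by \<open>K\<^sub>1 K\<^sub>2\<^sup>2 K\<^sub>3\<close> and \<open>K\<^sub>2 K\<^sub>3\<close>, which commute with \<open>R\<close>.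
\<close>

lemma twisted_uu: "- (q ^ (c + 1) * (q ^ a - q ^ (b + 1))) * R x y m a b c
    + (1 - q ^ (2 * (c + 1))) * (1 - q ^ (2 * (a + 1))) * (if b = 0 then 0 else R x y m (a + 1) (b - 1) (c + 1))
  = - (q ^ (m + 1) * (q ^ x - q ^ (y + 1))) * R x y m a b c + (1 - q ^ (2 * y)) * R (x + 1) (y - 1) (m + 1) a b c"
proof -
  have "raise2 (lower2' (R x y m)) = scl (1 - q ^ (2 * y)) (R (Suc x) (y - 1) (Suc m))
      - scl (q ^ (1 + x + m) * (1 - q ^ (2 * y))) (R x y m)"
    unfolding R_intertwines_lower2 [symmetric] op_linear
    by (cases y) (simp_all add: R_intertwines_raise2' [symmetric] scl_simps mult.commute)
  then have e: "raise2 (lower2' (R x y m)) a b c = (1 - q ^ (2 * y)) * R (Suc x) (y - 1) (Suc m) a b c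
      - q ^ (1 + x + m) * (1 - q ^ (2 * y)) * R x y m a b c"
    by (simp add: scl_def)
  have w1: "q ^ (b + c) * R x y m a b c = q ^ (y + m) * R x y m a b c"
    using fun_cong [OF fun_cong [OF fun_cong [OF R_weight(1)]], of x y m a b c] by (simp add: wt_def scl_def)
  have w2: "q ^ (a + 2 * b + c) * R x y m a b c = q ^ (x + 2 * y + m) * R x y m a b c"
    using fun_cong [OF fun_cong [OF fun_cong [OF R_weight(2)]], of x y m a b c] by (simp add: wt_def scl_def)
  have "- (q ^ (c + 1) * (q ^ a - q ^ (b + 1))) * R x y m a b c
    + (1 - q ^ (2 * (c + 1))) * (1 - q ^ (2 * (a + 1))) * (if b = 0 then 0 else R x y m (a + 1) (b - 1) (c + 1))
    = raise2 (lower2' (R x y m)) a b c - q * (q ^ (a + 2 * b + c) * R x y m a b c) + q ^ 2 * (q ^ (b + c) * R x y m a b c)"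
    unfolding raise2_def lower2'_def
    by (cases b) (simp_all add: algebra_simps power_add q_double power2_eq_square)
  also have "\<dots> = - (q ^ (m + 1) * (q ^ x - q ^ (y + 1))) * R x y m a b c + (1 - q ^ (2 * y)) * R (x + 1) (y - 1) (m + 1) a b c"
    unfolding e w1 w2 by (simp add: algebra_simps power_add q_double power2_eq_square)
  finally show ?thesis .
qed

lemma twisted_ww: "(1 - q ^ (2 * (b + 1))) * (if a = 0 \<or> c = 0 then 0 else R x y m (a - 1) (b + 1) (c - 1))
    + q ^ c * (q ^ b - q ^ (a + 1)) * R x y m a b c
  = (1 - q ^ (2 * m)) * (1 - q ^ (2 * x)) * R (x - 1) (y + 1) (m - 1) a b c
    + q ^ m * (q ^ y - q ^ (x + 1)) * R x y m a b c"
proof -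
  have "raise2' (lower2 (R x y m)) = scl ((1 - q ^ (2 * x)) * (1 - q ^ (2 * m))) (R (x - 1) (Suc y) (m - 1))
      - scl (q ^ (1 + x + m) * (1 - q ^ (2 * y))) (R x y m)"
    unfolding R_intertwines_lower2' [symmetric] op_linear
    by (cases y) (simp_all add: R_Suc2 [symmetric] scl_simps mult.commute)
  then have e: "raise2' (lower2 (R x y m)) a b c = (1 - q ^ (2 * x)) * (1 - q ^ (2 * m)) * R (x - 1) (Suc y) (m - 1) a b c
      - q ^ (1 + x + m) * (1 - q ^ (2 * y)) * R x y m a b c"
    by (simp add: scl_def)
  have w1: "q ^ (b + c) * R x y m a b c = q ^ (y + m) * R x y m a b c"
    using fun_cong [OF fun_cong [OF fun_cong [OF R_weight(1)]], of x y m a b c] by (simp add: wt_def scl_def)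
  have w2: "q ^ (a + 2 * b + c) * R x y m a b c = q ^ (x + 2 * y + m) * R x y m a b c"
    using fun_cong [OF fun_cong [OF fun_cong [OF R_weight(2)]], of x y m a b c] by (simp add: wt_def scl_def)
  have "(1 - q ^ (2 * (b + 1))) * (if a = 0 \<or> c = 0 then 0 else R x y m (a - 1) (b + 1) (c - 1))
    + q ^ c * (q ^ b - q ^ (a + 1)) * R x y m a b c
    = raise2' (lower2 (R x y m)) a b c - q * (q ^ (a + 2 * b + c) * R x y m a b c) + q ^ (b + c) * R x y m a b c"
    unfolding raise2'_def lower2_def
    by (cases b; cases "a = 0 \<or> c = 0") (simp_all add: algebra_simps power_add q_double power2_eq_square)
  also have "\<dots> = (1 - q ^ (2 * m)) * (1 - q ^ (2 * x)) * R (x - 1) (y + 1) (m - 1) a b c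
    + q ^ m * (q ^ y - q ^ (x + 1)) * R x y m a b c"
    unfolding e w1 w2 by (simp add: algebra_simps power_add q_double power2_eq_square)
  finally show ?thesis .
qed

text \<open>
  The off-diagonal entries of \<open>M \<Phi>\<close> have the form \<open>X - q X'\<close> or \<open>X' - q X\<close> with \<open>X\<close> one of \<open>K\<^sub>2 a\<^sub>3\<^sup>-\<close>, \<open>K\<^sub>2 a\<^sub>3\<^sup>+\<close> and \<open>X'\<close> its
  partner, and those of \<open>\<Phi> M\<close> are obtained by exchanging \<open>X\<close> and \<open>X'\<close>.
\<close>

lemma twisted_uw: "- (q ^ (c + 1) * (1 - q ^ (2 * (b + 1)))) * (if a = 0 then 0 else R x y m (a - 1) (b + 1) c)
    + (1 - q ^ (2 * (c + 1))) * (q ^ b - q ^ (a + 1)) * R x y m a b (c + 1)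
  = (1 - q ^ (2 * m)) * (q ^ x - q ^ (y + 1)) * R x y (m - 1) a b c
    + q ^ m * (1 - q ^ (2 * y)) * R (x + 1) (y - 1) m a b c"
proof -
  have "lower3 (R x y m) - scl q (lower3' (R x y m)) = scl (q ^ x * (1 - q ^ (2 * m))) (R x y (m - 1))
      + scl (q ^ m * (1 - q ^ (2 * y))) (R (Suc x) (y - 1) m) - scl q (scl (q ^ y * (1 - q ^ (2 * m))) (R x y (m - 1)))"
    unfolding R_intertwines_lower3 R_intertwines_lower3' ..
  from fun_cong [OF fun_cong [OF fun_cong [OF this]], of a b c] show ?thesis
    by (simp add: lower3_def lower3'_def scl_def algebra_simps power_add)
qed

lemma twisted_wu: "(q ^ a - q ^ (b + 1)) * (if c = 0 then 0 else R x y m a b (c - 1))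
    + q ^ c * (1 - q ^ (2 * (a + 1))) * (if b = 0 then 0 else R x y m (a + 1) (b - 1) c)
  = - (q ^ (m + 1) * (1 - q ^ (2 * x))) * R (x - 1) (y + 1) m a b c
    + (q ^ y - q ^ (x + 1)) * R x y (m + 1) a b c"
proof -
  have "raise3' (R x y m) - scl q (raise3 (R x y m)) = scl (q ^ y) (R x y (Suc m))
      - scl q (scl (q ^ x) (R x y (Suc m)) + scl (q ^ m * (1 - q ^ (2 * x))) (R (x - 1) (Suc y) m))"
    unfolding R_intertwines_raise3 R_intertwines_raise3' ..
  from fun_cong [OF fun_cong [OF fun_cong [OF this]], of a b c] show ?thesis
    by (simp add: raise3_def raise3'_def scl_def algebra_simps power_add)
qed

text \<open>
  The differences of the two sides of the four entries, named so that the passage from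
  \<open>(M \<Phi>) R = R (\<Phi> M)\<close> to \<open>\<Phi> R M = M R \<Phi>\<close> can be written as \<open>\<Phi> R M - M R \<Phi> = M (M \<Phi> R - R \<Phi> M) M\<close>.
\<close>

definition defect_uu :: "nat \<Rightarrow> nat \<Rightarrow> nat \<Rightarrow> nat \<Rightarrow> nat \<Rightarrow> nat \<Rightarrow> 'k" where
  "defect_uu x y m a b c = - (q ^ (c + 1) * (q ^ a - q ^ (b + 1))) * R x y m a b c
    + (1 - q ^ (2 * (c + 1))) * (1 - q ^ (2 * (a + 1))) * (if b = 0 then 0 else R x y m (a + 1) (b - 1) (c + 1))
  - (- (q ^ (m + 1) * (q ^ x - q ^ (y + 1))) * R x y m a b c + (1 - q ^ (2 * y)) * R (x + 1) (y - 1) (m + 1) a b c)"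

definition defect_uw :: "nat \<Rightarrow> nat \<Rightarrow> nat \<Rightarrow> nat \<Rightarrow> nat \<Rightarrow> nat \<Rightarrow> 'k" where
  "defect_uw x y m a b c = - (q ^ (c + 1) * (1 - q ^ (2 * (b + 1)))) * (if a = 0 then 0 else R x y m (a - 1) (b + 1) c)
    + (1 - q ^ (2 * (c + 1))) * (q ^ b - q ^ (a + 1)) * R x y m a b (c + 1)
  - ((1 - q ^ (2 * m)) * (q ^ x - q ^ (y + 1)) * R x y (m - 1) a b c
    + q ^ m * (1 - q ^ (2 * y)) * R (x + 1) (y - 1) m a b c)"

definition defect_wu :: "nat \<Rightarrow> nat \<Rightarrow> nat \<Rightarrow> nat \<Rightarrow> nat \<Rightarrow> nat \<Rightarrow> 'k" where
  "defect_wu x y m a b c = (q ^ a - q ^ (b + 1)) * (if c = 0 then 0 else R x y m a b (c - 1))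
    + q ^ c * (1 - q ^ (2 * (a + 1))) * (if b = 0 then 0 else R x y m (a + 1) (b - 1) c)
  - (- (q ^ (m + 1) * (1 - q ^ (2 * x))) * R (x - 1) (y + 1) m a b c
    + (q ^ y - q ^ (x + 1)) * R x y (m + 1) a b c)"

definition defect_ww :: "nat \<Rightarrow> nat \<Rightarrow> nat \<Rightarrow> nat \<Rightarrow> nat \<Rightarrow> nat \<Rightarrow> 'k" where
  "defect_ww x y m a b c = (1 - q ^ (2 * (b + 1))) * (if a = 0 \<or> c = 0 then 0 else R x y m (a - 1) (b + 1) (c - 1))
    + q ^ c * (q ^ b - q ^ (a + 1)) * R x y m a b c
  - ((1 - q ^ (2 * m)) * (1 - q ^ (2 * x)) * R (x - 1) (y + 1) (m - 1) a b c
    + q ^ m * (q ^ y - q ^ (x + 1)) * R x y m a b c)"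

lemma defect_eq_0: "defect_uu x y m a b c = 0" "defect_uw x y m a b c = 0" "defect_wu x y m a b c = 0" "defect_ww x y m a b c = 0"
  unfolding defect_uu_def defect_uw_def defect_wu_def defect_ww_def
  by (simp_all only: twisted_uu twisted_uw twisted_wu twisted_ww diff_self)

text \<open>
  The four entries of \<open>\<Phi> R M = M R \<Phi>\<close>.  Each proof expands the corresponding entry of
  \<open>M (M \<Phi> R - R \<Phi> M) M\<close>, where \<open>M\<^sup>2 = 1\<close> makes all terms cancel but two on each side.
\<close>

lemma exchange_uu: "- (q ^ (m + 1) * (q ^ a - q ^ (b + 1))) * R x y m a b c
    + (1 - q ^ (2 * (b + 1))) * (if a = 0 then 0 else R x y (m + 1) (a - 1) (b + 1) c)
  = - (q ^ (c + 1) * (q ^ x - q ^ (y + 1))) * R x y m a b c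
    + (1 - q ^ (2 * (c + 1))) * (1 - q ^ (2 * x)) * R (x - 1) (y + 1) m a b (c + 1)" (is "?l = ?r")
proof -
  have "?l - ?r = (- (q ^ (c + 1))) * ((- (q ^ (m + 1))) * defect_uu x y m a b c + defect_uw x y (m + 1) a b c)
    + (1 - q ^ (2 * (c + 1))) * ((- (q ^ (m + 1))) * defect_wu x y m a b (c + 1) + defect_ww x y (m + 1) a b (c + 1))"
    unfolding defect_uu_def defect_uw_def defect_wu_def defect_ww_def
    by (cases "a = 0"; cases "b = 0"; simp add: algebra_simps power_add q_double power2_eq_square)
  also have "\<dots> = 0"
    by (simp only: defect_eq_0 mult_zero_right add_0 if_cancel)
  finally show ?thesis by (simp only: right_minus_eq)
qed

lemma exchange_uw: "(1 - q ^ (2 * m)) * (q ^ a - q ^ (b + 1)) * R x y (m - 1) a b c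
    + q ^ m * (1 - q ^ (2 * (b + 1))) * (if a = 0 then 0 else R x y m (a - 1) (b + 1) c)
  = - (q ^ (c + 1) * (1 - q ^ (2 * y))) * R (x + 1) (y - 1) m a b c
    + (1 - q ^ (2 * (c + 1))) * (q ^ y - q ^ (x + 1)) * R x y m a b (c + 1)" (is "?l = ?r")
proof -
  have "?l - ?r = (- (q ^ (c + 1))) * ((1 - q ^ (2 * m)) * defect_uu x y (m - 1) a b c + q ^ m * defect_uw x y m a b c)
    + (1 - q ^ (2 * (c + 1))) * ((1 - q ^ (2 * m)) * defect_wu x y (m - 1) a b (c + 1) + q ^ m * defect_ww x y m a b (c + 1))"
    unfolding defect_uu_def defect_uw_def defect_wu_def defect_ww_def
    by (cases "a = 0"; cases "b = 0"; cases m; simp add: algebra_simps power_add q_double power2_eq_square)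
  also have "\<dots> = 0"
    by (simp only: defect_eq_0 mult_zero_right add_0 if_cancel)
  finally show ?thesis by (simp only: right_minus_eq)
qed

lemma exchange_wu: "- (q ^ (m + 1) * (1 - q ^ (2 * (a + 1)))) * (if b = 0 then 0 else R x y m (a + 1) (b - 1) c)
    + (q ^ b - q ^ (a + 1)) * R x y (m + 1) a b c
  = (q ^ x - q ^ (y + 1)) * (if c = 0 then 0 else R x y m a b (c - 1))
    + q ^ c * (1 - q ^ (2 * x)) * R (x - 1) (y + 1) m a b c" (is "?l = ?r")
proof -
  have "?l - ?r = (if c = 0 then 0 else (- (q ^ (m + 1))) * defect_uu x y m a b (c - 1) + defect_uw x y (m + 1) a b (c - 1))
    + q ^ c * ((- (q ^ (m + 1))) * defect_wu x y m a b c + defect_ww x y (m + 1) a b c)"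
    unfolding defect_uu_def defect_uw_def defect_wu_def defect_ww_def
    by (cases "a = 0"; cases "b = 0"; cases c; simp add: algebra_simps power_add q_double power2_eq_square)
  also have "\<dots> = 0"
    by (simp only: defect_eq_0 mult_zero_right add_0 if_cancel)
  finally show ?thesis by (simp only: right_minus_eq)
qed

lemma exchange_ww: "(1 - q ^ (2 * m)) * (1 - q ^ (2 * (a + 1))) * (if b = 0 then 0 else R x y (m - 1) (a + 1) (b - 1) c)
    + q ^ m * (q ^ b - q ^ (a + 1)) * R x y m a b c
  = (1 - q ^ (2 * y)) * (if c = 0 then 0 else R (x + 1) (y - 1) m a b (c - 1))
    + q ^ c * (q ^ y - q ^ (x + 1)) * R x y m a b c" (is "?l = ?r")
proof -
  have "?l - ?r = (if c = 0 then 0 else (1 - q ^ (2 * m)) * defect_uu x y (m - 1) a b (c - 1) + q ^ m * defect_uw x y m a b (c - 1))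
    + q ^ c * ((1 - q ^ (2 * m)) * defect_wu x y (m - 1) a b c + q ^ m * defect_ww x y m a b c)"
    unfolding defect_uu_def defect_uw_def defect_wu_def defect_ww_def
    by (cases "a = 0"; cases "b = 0"; cases c; cases m; simp add: algebra_simps power_add q_double power2_eq_square)
  also have "\<dots> = 0"
    by (simp only: defect_eq_0 mult_zero_right add_0 if_cancel)
  finally show ?thesis by (simp only: right_minus_eq)
qed

text \<open>
  The weight of the neighbouring sites (0, 1) for the auxiliary states \<open>c\<close> (upper) and \<open>m\<close> (lower).  The upper indices are
  \<open>a, b\<close> on the site 0 and \<open>v', w'\<close> on the site 1, the lower ones \<open>x, y\<close> and \<open>v, w\<close>.  The state between
  the sites is computed from the conservation law of the first site; when the subtraction truncates,
  that site contributes 0.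
\<close>

definition weight01 :: "nat \<Rightarrow> nat \<Rightarrow> nat \<Rightarrow> nat \<Rightarrow> nat \<Rightarrow> nat \<Rightarrow> nat \<Rightarrow> nat \<Rightarrow> nat \<Rightarrow> nat \<Rightarrow> 'k" where
  "weight01 a b v' w' c x y v w m = S3 q 0 a b c x y (c + b - y) * S3 q 1 v' w' (c + b - y) v w m"

text \<open>
  The same for the neighbouring sites (1, 0).
\<close>

definition weight10 :: "nat \<Rightarrow> nat \<Rightarrow> nat \<Rightarrow> nat \<Rightarrow> nat \<Rightarrow> nat \<Rightarrow> nat \<Rightarrow> nat \<Rightarrow> nat \<Rightarrow> nat \<Rightarrow> 'k" where
  "weight10 v' w' a b c v w x y m = S3 q 1 v' w' c v w (c + w' - w) * S3 q 0 a b (c + w' - w) x y m"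

lemma S3_eq_R: "S3 q 0 a b c i j k = R i j k a b c"
  by (simp add: S3_def R_def)

lemma R_eq_0: "b + c \<noteq> j + k \<Longrightarrow> R i j k a b c = 0" "a + b \<noteq> i + j \<Longrightarrow> R i j k a b c = 0"
  using R_nz_D by blast+

lemma S3_1_values:
  "S3 q 1 0 0 c 0 0 k = of_bool (c = k)" "S3 q 1 1 1 c 1 1 k = of_bool (c = k)"
  "S3 q 1 0 1 c 0 1 k = - (of_bool (c = k) * q ^ (k + 1))" "S3 q 1 1 0 c 1 0 k = of_bool (c = k) * q ^ k"
  "S3 q 1 0 1 c 1 0 k = of_bool (c + 1 = k) * (1 - q ^ (2 * k))" "S3 q 1 1 0 c 0 1 k = of_bool (c = k + 1)"
  "a + b \<noteq> i + j \<Longrightarrow> S3 q 1 a b c i j k = 0"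
  using S3_conservation [of q 1 a b c i j k] by (auto simp: S3_def S3_1_def)

lemmas S3_1_values' = S3_1_values [unfolded One_nat_def]

text \<open>
  The site 1 fixes the state between the sites as \<open>m'\<close>, whereas \<open>weight01\<close> computes it from the site 0.  When the
  two disagree, both sides vanish.
\<close>

lemma weight01_eq:
  assumes *: "\<And>d. c + b = y + d \<Longrightarrow> S3 q 1 v' w' d v w m = of_bool (d = m') * t"
  shows "weight01 a b v' w' c x y v w m = t * R x y m' a b c"
proof (cases "c + b = y + m'")
  case True
  then have "c + b - y = m'" by simp
  then show ?thesis using * [OF True] by (simp add: weight01_def S3_eq_R)
next
  case False
  then have z: "R x y m' a b c = 0" by (intro R_eq_0(1)) simp
  show ?thesis
  proof (cases "y \<le> c + b")
    case True
    then have "c + b = y + (c + b - y)" by simp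
    from * [OF this] False True have "S3 q 1 v' w' (c + b - y) v w m = 0" by auto
    then show ?thesis by (simp add: weight01_def z)
  next
    case False
    then have "R x y (c + b - y) a b c = 0" by (intro R_eq_0(1)) simp
    then show ?thesis by (simp add: weight01_def z S3_eq_R)
  qed
qed

lemma weight01_values:
  "weight01 a b 0 0 c x y 0 0 m = R x y m a b c"
  "weight01 a b 1 1 c x y 1 1 m = R x y m a b c"
  "weight01 a b 0 1 c x y 0 1 m = - (q ^ (m + 1)) * R x y m a b c"
  "weight01 a b 1 0 c x y 1 0 m = q ^ m * R x y m a b c"
  "weight01 a b 0 1 c x y 1 0 m = (1 - q ^ (2 * m)) * R x y (m - 1) a b c"
  "weight01 a b 1 0 c x y 0 1 m = R x y (m + 1) a b c"
  "v' + w' \<noteq> v + w \<Longrightarrow> weight01 a b v' w' c x y v w m = 0"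
proof -
  show "weight01 a b 0 0 c x y 0 0 m = R x y m a b c"
    using weight01_eq [where t = 1 and m = m and m' = m] by (simp add: S3_1_values')
  show "weight01 a b 1 1 c x y 1 1 m = R x y m a b c"
    using weight01_eq [where t = 1 and m = m and m' = m] by (simp add: S3_1_values')
  show "weight01 a b 0 1 c x y 0 1 m = - (q ^ (m + 1)) * R x y m a b c"
    by (rule weight01_eq) (simp add: S3_1_values')
  show "weight01 a b 1 0 c x y 1 0 m = q ^ m * R x y m a b c"
    by (rule weight01_eq) (simp add: S3_1_values')
  show "weight01 a b 0 1 c x y 1 0 m = (1 - q ^ (2 * m)) * R x y (m - 1) a b c"
    by (rule weight01_eq) (cases m, simp_all add: S3_1_values')
  show "weight01 a b 1 0 c x y 0 1 m = R x y (m + 1) a b c"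
    using weight01_eq [where t = 1 and m = m and m' = "m + 1"] by (simp add: S3_1_values')
  show "v' + w' \<noteq> v + w \<Longrightarrow> weight01 a b v' w' c x y v w m = 0"
    by (simp add: weight01_def S3_1_values')
qed

lemma weight10_values:
  "weight10 0 0 a b c 0 0 x y m = R x y m a b c"
  "weight10 1 1 a b c 1 1 x y m = R x y m a b c"
  "weight10 0 1 a b c 0 1 x y m = - (q ^ (c + 1)) * R x y m a b c"
  "weight10 1 0 a b c 1 0 x y m = q ^ c * R x y m a b c"
  "weight10 0 1 a b c 1 0 x y m = (1 - q ^ (2 * (c + 1))) * R x y m a b (c + 1)"
  "weight10 1 0 a b c 0 1 x y m = (if c = 0 then 0 else R x y m a b (c - 1))"
  "v' + w' \<noteq> v + w \<Longrightarrow> weight10 v' w' a b c v w x y m = 0"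
  by (cases c; simp add: weight10_def S3_eq_R S3_1_values')+

definition den :: "nat \<Rightarrow> nat \<Rightarrow> 'k" where "den x y = 1 - q ^ (x + y + 1)"

lemma den_nz: "den x y \<noteq> 0"
  using q_pow[of "x + y + 1"] by (simp add: den_def)

text \<open>
  The coefficients of the normalised \<open>\<Phi>\<close>, for a state with labels \<open>x, y\<close> on the site 0 and \<open>v, w\<close> on the site 1:
  \<open>stay\<close> leaves the labels alone, and \<open>hop\<close> accompanies the passage between \<open>u\<close> and \<open>w\<close>, in which \<open>v\<close> becomes \<open>1 - v\<close> while
  \<open>x + v\<close> and \<open>y + w\<close> do not change.  On the states with \<open>v = w\<close> the map is the identity.
\<close>

definition stay :: "nat \<Rightarrow> nat \<Rightarrow> nat \<Rightarrow> nat \<Rightarrow> 'k" where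
  "stay x y v w = (if v = w then 1
     else (if v = 0 then q ^ x - q ^ (y + 1) else q ^ y - q ^ (x + 1)) / den x y)"

definition hop :: "nat \<Rightarrow> nat \<Rightarrow> nat \<Rightarrow> nat \<Rightarrow> 'k" where
  "hop x y v w = (if v = w then 0
     else (if v = 0 then 1 - q ^ (2 * x) else 1 - q ^ (2 * y)) / den x y)"

text \<open>
  The coefficients of \<open>\<Phi>\<close> read along a row: the coefficient of the given state in the image of the state from which it
  can be reached by a hop.  It is 0 when that state would have a negative label.
\<close>

definition hop_row :: "nat \<Rightarrow> nat \<Rightarrow> nat \<Rightarrow> nat \<Rightarrow> 'k" where
  "hop_row a b v w = (if v = w then 0
     else (if v = 0 then (if a = 0 then 0 else 1 - q ^ (2 * (b + 1)))
           else (if b = 0 then 0 else 1 - q ^ (2 * (a + 1)))) / den a b)"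

text \<open>
  This is \<open>\<Phi> R M = M R \<Phi>\<close>, together with the trivial blocks \<open>v = w\<close>, with the columns of \<open>\<Phi>\<close> on the right and its
  rows on the left.
\<close>

lemma local_exchange:
  assumes v: "v \<in> {0, 1}" "w \<in> {0, 1}" "v' \<in> {0, 1}" "w' \<in> {0, 1}"
  shows "stay a b v' w' * weight01 a b v' w' c x y v w m
      + hop_row a b v' w' * weight01 (a + 2 * v' - 1) (b + 2 * w' - 1) (1 - v') (1 - w') c x y v w m
    = stay x y v w * weight10 v' w' a b c v w x y m
      + hop x y v w * weight10 v' w' a b c (1 - v) (1 - w) (x + 2 * v - 1) (y + 2 * w - 1) m"
    (is "?goal")
proof (cases "v = w \<or> v' = w'")
  case True
  have le: "v \<le> 1" "w \<le> 1" "v' \<le> 1" "w' \<le> 1" using v by auto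
  show ?thesis
  proof (cases "v + w = v' + w'")
    case eq: True
    have 1: "v = w" "v' = w'" "v = v'" using True eq le by arith+
    have "v = 0 \<or> v = 1" using v by auto
    then have "weight01 a b v v c x y v v m = weight10 v v a b c v v x y m"
      by (elim disjE) (simp_all only: weight01_values weight10_values)
    then show ?thesis using 1 by (simp add: stay_def hop_def hop_row_def)
  next
    case ne: False
    have 2: "v + w \<noteq> v' + w'" "1 - v' + (1 - w') \<noteq> v + w \<or> v' = w'" "1 - v + (1 - w) \<noteq> v' + w' \<or> v = w"
      using True ne le by arith+
    have "weight01 a b v' w' c x y v w m = 0" "weight10 v' w' a b c v w x y m = 0"
      using 2(1) weight01_values(7) weight10_values(7) by metis+
    moreover have "hop_row a b v' w' * weight01 (a + 2 * v' - 1) (b + 2 * w' - 1) (1 - v') (1 - w') c x y v w m = 0"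
      using 2(2) weight01_values(7) [of "1 - v'" "1 - w'" v w] by (auto simp: hop_row_def)
    moreover have "hop x y v w * weight10 v' w' a b c (1 - v) (1 - w) (x + 2 * v - 1) (y + 2 * w - 1) m = 0"
      using 2(3) weight10_values(7) [of v' w' "1 - v" "1 - w"] by (auto simp: hop_def)
    ultimately show ?thesis by (simp only: mult_zero_right add_0)
  qed
next
  case False
  then consider (uu) "v' = 0" "w' = 1" "v = 0" "w = 1" | (uw) "v' = 0" "w' = 1" "v = 1" "w = 0"
    | (wu) "v' = 1" "w' = 0" "v = 0" "w = 1" | (ww) "v' = 1" "w' = 0" "v = 1" "w = 0"
    using v by auto
  note cases4 = this
  show ?thesis
  proof (cases "a + b = x + y")
    (* Both products conserve the total label of the site 0, and so does the hop. *)
    case ne: False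
    have z1: "weight01 a' b' v' w' c x y v w m = 0" if "a' + b' = a + b" for a' b' v' w'
      unfolding weight01_def S3_eq_R using ne that R_eq_0(2) by simp
    have z2: "weight10 v' w' a b c v w x' y' m = 0" if "x' + y' = x + y" for x' y' v w
      unfolding weight10_def S3_eq_R using ne that R_eq_0(2) by simp
    have "hop_row a b v' w' = 0 \<or> a + 2 * v' - 1 + (b + 2 * w' - 1) = a + b"
      using cases4 by cases (auto simp: hop_row_def)
    moreover have "hop x y v w = 0 \<or> x + 2 * v - 1 + (y + 2 * w - 1) = x + y"
      using v by (cases "x = 0"; cases "y = 0"; auto simp: hop_def)
    ultimately have "hop_row a b v' w' * weight01 (a + 2 * v' - 1) (b + 2 * w' - 1) (1 - v') (1 - w') c x y v w m = 0"
      "hop x y v w * weight10 v' w' a b c (1 - v) (1 - w) (x + 2 * v - 1) (y + 2 * w - 1) m = 0"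
      using z1 z2 by (metis mult_zero_left mult_zero_right)+
    then show ?thesis by (simp only: z1 z2 mult_zero_right add_0)
  next
    case True
    then have d: "den a b = den x y" by (simp add: den_def)
    (* The denominator of Phi depends only on the total label, so it is common to all terms. *)
    have fr: "X * A + Y * B = Z * C + W * D \<Longrightarrow> X / den x y * A + Y / den x y * B = Z / den x y * C + W / den x y * D"
      for X A Y B Z C W D
      by (simp only: times_divide_eq_left add_divide_distrib [symmetric])
    note S = weight01_values [unfolded One_nat_def] weight10_values [unfolded One_nat_def] stay_def hop_def hop_row_def d
    from cases4 show ?thesis
    proof cases
      case uu
      have "(q ^ a - q ^ (b + 1)) * (- (q ^ (m + 1)) * R x y m a b c)
          + (if a = 0 then 0 else 1 - q ^ (2 * (b + 1))) * R x y (m + 1) (a - 1) (b + 1) c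
        = (q ^ x - q ^ (y + 1)) * (- (q ^ (c + 1)) * R x y m a b c)
          + (1 - q ^ (2 * x)) * ((1 - q ^ (2 * (c + 1))) * R (x - 1) (y + 1) m a b (c + 1))"
        using exchange_uu [of m a b x y c] by (cases "a = 0") (simp_all add: algebra_simps)
      from fr [OF this] show ?thesis unfolding uu using d by (cases "a = 0") (simp_all add: S)
    next
      case uw
      have "(q ^ a - q ^ (b + 1)) * ((1 - q ^ (2 * m)) * R x y (m - 1) a b c)
          + (if a = 0 then 0 else 1 - q ^ (2 * (b + 1))) * (q ^ m * R x y m (a - 1) (b + 1) c)
        = (q ^ y - q ^ (x + 1)) * ((1 - q ^ (2 * (c + 1))) * R x y m a b (c + 1))
          + (1 - q ^ (2 * y)) * (- (q ^ (c + 1)) * R (x + 1) (y - 1) m a b c)"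
        using exchange_uw [of m a b x y c] by (cases "a = 0") (simp_all add: algebra_simps)
      from fr [OF this] show ?thesis unfolding uw using d by (cases "a = 0") (simp_all add: S)
    next
      case wu
      have "(q ^ b - q ^ (a + 1)) * R x y (m + 1) a b c
          + (if b = 0 then 0 else 1 - q ^ (2 * (a + 1))) * (- (q ^ (m + 1)) * R x y m (a + 1) (b - 1) c)
        = (q ^ x - q ^ (y + 1)) * (if c = 0 then 0 else R x y m a b (c - 1))
          + (1 - q ^ (2 * x)) * (q ^ c * R (x - 1) (y + 1) m a b c)"
        using exchange_wu [of m a b x y c] by (cases "b = 0") (simp_all add: algebra_simps)
      from fr [OF this] show ?thesis unfolding wu using d by (cases "b = 0") (simp_all add: S)
    next
      case ww
      have "(q ^ b - q ^ (a + 1)) * (q ^ m * R x y m a b c)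
          + (if b = 0 then 0 else 1 - q ^ (2 * (a + 1))) * ((1 - q ^ (2 * m)) * R x y (m - 1) (a + 1) (b - 1) c)
        = (q ^ y - q ^ (x + 1)) * (q ^ c * R x y m a b c)
          + (1 - q ^ (2 * y)) * (if c = 0 then 0 else R (x + 1) (y - 1) m a b (c - 1))"
        using exchange_ww [of m a b x y c] by (cases "b = 0") (simp_all add: algebra_simps)
      from fr [OF this] show ?thesis unfolding ww using d by (cases "b = 0") (simp_all add: S)
    qed
  qed
qed

section \<open>The path of the auxiliary oscillator\<close>

text \<open>
  The state of the auxiliary oscillator in front of site \<open>l\<close>, when it starts as \<open>c\<close> and the conservation law
  \<open>b\<^sub>l + c\<^sub>l = j\<^sub>l + c\<^sub>l\<^sub>+\<^sub>1\<close> holds at every site.  If a subtraction truncates, no admissible path exists and a site on the path has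
  weight 0.
\<close>

primrec aux_path :: "nat list \<Rightarrow> nat list \<Rightarrow> nat \<Rightarrow> nat \<Rightarrow> nat" where
  "aux_path b j c 0 = c"
| "aux_path b j c (Suc l) = aux_path b j c l + b ! l - j ! l"

text \<open>
  The matrix element of the product of all local operators between the auxiliary states \<open>c\<close> and \<open>k\<close>.  The sum
  over the intermediate states has a single term.
\<close>

definition chain :: "nat list \<Rightarrow> nat list \<Rightarrow> nat list \<Rightarrow> nat list \<Rightarrow> nat list \<Rightarrow> nat \<Rightarrow> nat \<Rightarrow> 'k" where
  "chain \<epsilon> a b i j c k = of_bool (aux_path b j c (length \<epsilon>) = k) *
    (\<Prod>l<length \<epsilon>. S3 q (\<epsilon> ! l) (a ! l) (b ! l) (aux_path b j c l) (i ! l) (j ! l) (aux_path b j c (Suc l)))"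

lemma aux_path_Cons: "aux_path (b # bs) (j # js) c (Suc l) = aux_path bs js (c + b - j) l"
  by (induction l) auto

lemma chain_Cons: "chain (e # \<epsilon>) (a # as) (b # bs) (i # is) (j # js) c k
  = S3 q e a b c i j (c + b - j) * chain \<epsilon> as bs is js (c + b - j) k"
  unfolding chain_def list.size add_Suc_right add_0_right prod.lessThan_Suc_shift aux_path_Cons
  by (simp del: aux_path.simps(2) add: aux_path_Cons)

text \<open>
  The state behind two neighbouring sites depends only on the sums of their labels, hence not on their order and
  not on a hop.
\<close>

lemma chain_0_1: "chain (0 # 1 # \<epsilon>) (a # v' # as) (b # w' # bs) (x # v # is) (y # w # js) c k
  = weight01 a b v' w' c x y v w (c + b + w' - (y + w)) * chain \<epsilon> as bs is js (c + b + w' - (y + w)) k"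
  using S3_conservation [of q 0 a b c x y "c + b - y"]
  by (cases "S3 q 0 a b c x y (c + b - y) = 0") (auto simp: chain_Cons weight01_def)

lemma chain_1_0: "chain (1 # 0 # \<epsilon>) (v' # a # as) (w' # b # bs) (v # x # is) (w # y # js) c k
  = weight10 v' w' a b c v w x y (c + b + w' - (y + w)) * chain \<epsilon> as bs is js (c + b + w' - (y + w)) k"
proof (cases "S3 q 1 v' w' c v w (c + w' - w) = 0")
  case False
  then have "w' + c = w + (c + w' - w)" using S3_conservation by blast
  then have "c + w' - w + b - y = c + b + w' - (y + w)" by arith
  then show ?thesis by (simp add: chain_Cons weight10_def)
qed (simp add: chain_Cons weight10_def)

definition swap_sites :: "nat \<Rightarrow> nat list \<Rightarrow> nat list" where
  "swap_sites p xs = xs[p := xs ! Suc p, Suc p := xs ! p]"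

text \<open>
  The effect of a hop on the labels: the site 0 at position \<open>p\<close> and the site 1 at position \<open>Suc p\<close> keep their
  sum, and the label of the site 1 is flipped.
\<close>

definition flip_sites :: "nat \<Rightarrow> nat list \<Rightarrow> nat list" where
  "flip_sites p xs = xs[p := xs ! p + 2 * xs ! Suc p - 1, Suc p := 1 - xs ! Suc p]"

lemma swap_flip_sites_simps [simp]:
  "swap_sites 0 (x # y # zs) = y # x # zs" "swap_sites (Suc p) (x # zs) = x # swap_sites p zs"
  "flip_sites 0 (x # y # zs) = (x + 2 * y - 1) # (1 - y) # zs" "flip_sites (Suc p) (x # zs) = x # flip_sites p zs"
  "length (swap_sites p zs) = length zs" "length (flip_sites p zs) = length zs"
  by (simp_all add: swap_sites_def flip_sites_def)

text \<open>
  The sites before \<open>p\<close> contribute a common factor by induction on \<open>p\<close>, the sites after \<open>Suc p\<close> because the state behind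
  the exchanged pair is the same in all four terms.
\<close>

lemma chain_exchange:
  assumes "Suc p < length \<epsilon>" "\<epsilon> ! p = 0" "\<epsilon> ! Suc p = 1"
    "length a = length \<epsilon>" "length b = length \<epsilon>" "length i = length \<epsilon>" "length j = length \<epsilon>"
    "a ! Suc p \<in> {0, 1}" "b ! Suc p \<in> {0, 1}" "i ! Suc p \<in> {0, 1}" "j ! Suc p \<in> {0, 1}"
  shows "stay (a ! p) (b ! p) (a ! Suc p) (b ! Suc p) * chain \<epsilon> a b i j c k
      + hop_row (a ! p) (b ! p) (a ! Suc p) (b ! Suc p) * chain \<epsilon> (flip_sites p a) (flip_sites p b) i j c k
    = stay (i ! p) (j ! p) (i ! Suc p) (j ! Suc p) * chain (swap_sites p \<epsilon>) (swap_sites p a) (swap_sites p b) (swap_sites p i) (swap_sites p j) c k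
      + hop (i ! p) (j ! p) (i ! Suc p) (j ! Suc p)
        * chain (swap_sites p \<epsilon>) (swap_sites p a) (swap_sites p b) (swap_sites p (flip_sites p i)) (swap_sites p (flip_sites p j)) c k"
  using assms
proof (induction p arbitrary: \<epsilon> a b i j c)
  case 0
  have split2: "\<exists>x y zs. xs = x # y # zs" if "length xs = length \<epsilon>" for xs :: "nat list"
    using that 0(1) by (metis Suc_length_conv Suc_less_eq2 length_greater_0_conv list.exhaust less_imp_Suc_add add_Suc)
  obtain e1 e2 \<epsilon>0 where e: "\<epsilon> = e1 # e2 # \<epsilon>0" using split2 [of \<epsilon>] by auto
  obtain a0 v' as where a: "a = a0 # v' # as" using split2 0 by blast
  obtain b0 w' bs where b: "b = b0 # w' # bs" using split2 0 by blast
  obtain x v is0 where i: "i = x # v # is0" using split2 0 by blast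
  obtain y w js where j: "j = y # w # js" using split2 0 by blast
  have vs: "v \<in> {0, 1}" "w \<in> {0, 1}" "v' \<in> {0, 1}" "w' \<in> {0, 1}"
    using 0 by (simp_all add: a b i j)
  have e12: "e1 = 0" "e2 = 1" using 0 e by auto
  define M where "M = c + b0 + w' - (y + w)"
  (* A flip whose subtraction truncates changes the sum of the labels, but then its coefficient is 0. *)
  have M1: "hop_row a0 b0 v' w' = 0 \<or> c + (b0 + 2 * w' - 1) + (1 - w') - (y + w) = M"
    unfolding M_def hop_row_def using vs by auto
  have M2: "hop x y v w = 0 \<or> c + b0 + w' - (y + 2 * w - 1 + (1 - w)) = M"
    unfolding M_def hop_def using vs by (cases "y = 0") auto
  let ?C = "chain \<epsilon>0 as bs is0 js M k"
  have "stay a0 b0 v' w' * chain \<epsilon> a b i j c k + hop_row a0 b0 v' w' * chain \<epsilon> (flip_sites 0 a) (flip_sites 0 b) i j c k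
    = (stay a0 b0 v' w' * weight01 a0 b0 v' w' c x y v w M
      + hop_row a0 b0 v' w' * weight01 (a0 + 2 * v' - 1) (b0 + 2 * w' - 1) (1 - v') (1 - w') c x y v w M) * ?C"
    using M1 unfolding e e12 a b i j swap_flip_sites_simps chain_0_1 M_def [symmetric]
    by (auto simp: distrib_right)
  also have "\<dots> = (stay x y v w * weight10 v' w' a0 b0 c v w x y M
      + hop x y v w * weight10 v' w' a0 b0 c (1 - v) (1 - w) (x + 2 * v - 1) (y + 2 * w - 1) M) * ?C"
    unfolding local_exchange [OF vs] ..
  also have "\<dots> = stay x y v w * chain (swap_sites 0 \<epsilon>) (swap_sites 0 a) (swap_sites 0 b) (swap_sites 0 i) (swap_sites 0 j) c k
      + hop x y v w * chain (swap_sites 0 \<epsilon>) (swap_sites 0 a) (swap_sites 0 b) (swap_sites 0 (flip_sites 0 i)) (swap_sites 0 (flip_sites 0 j)) c k"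
    using M2 unfolding e e12 a b i j swap_flip_sites_simps chain_1_0 M_def [symmetric]
    by (auto simp: distrib_right)
  finally show ?case by (simp add: a b i j)
next
  case (Suc p)
  obtain e \<epsilon>0 where e: "\<epsilon> = e # \<epsilon>0" using Suc.prems by (cases \<epsilon>) auto
  obtain a0 as where a: "a = a0 # as" using Suc.prems by (cases a) auto
  obtain b0 bs where b: "b = b0 # bs" using Suc.prems by (cases b) auto
  obtain i0 is0 where i: "i = i0 # is0" using Suc.prems by (cases i) auto
  obtain j0 js where j: "j = j0 # js" using Suc.prems by (cases j) auto
  have IH: "stay (as ! p) (bs ! p) (as ! Suc p) (bs ! Suc p) * chain \<epsilon>0 as bs is0 js c k
      + hop_row (as ! p) (bs ! p) (as ! Suc p) (bs ! Suc p) * chain \<epsilon>0 (flip_sites p as) (flip_sites p bs) is0 js c k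
    = stay (is0 ! p) (js ! p) (is0 ! Suc p) (js ! Suc p) * chain (swap_sites p \<epsilon>0) (swap_sites p as) (swap_sites p bs) (swap_sites p is0) (swap_sites p js) c k
      + hop (is0 ! p) (js ! p) (is0 ! Suc p) (js ! Suc p)
        * chain (swap_sites p \<epsilon>0) (swap_sites p as) (swap_sites p bs) (swap_sites p (flip_sites p is0)) (swap_sites p (flip_sites p js)) c k" for c
    using Suc.prems by (intro Suc.IH) (auto simp: e a b i j)
  have L: "X * (S * C1) + Y * (S * C2) = S * (X * C1 + Y * C2)" for X S C1 Y C2 :: 'k
    by (simp add: algebra_simps)
  show ?case
    unfolding e a b i j swap_flip_sites_simps chain_Cons nth_Cons_Suc L IH ..
qed

end

section \<open>Coefficients of the trace and boundary operators\<close>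

lemma sum_eq_single_of_support:
  fixes f :: "'a \<Rightarrow> 'b::comm_monoid_add"
  assumes "\<And>c. P c \<Longrightarrow> f c \<noteq> 0 \<Longrightarrow> c = p" "P p"
  shows "(\<Sum>c | P c \<and> f c \<noteq> 0. f c) = f p"
proof (cases "f p = 0")
  case True
  then have "{c. P c \<and> f c \<noteq> 0} = {}" using assms(1) by blast
  then show ?thesis using True by simp
next
  case False
  then have "{c. P c \<and> f c \<noteq> 0} = {p}" using assms by blast
  then show ?thesis by simp
qed

context generic_q
begin

lemma aux_path_Suc_eq: "b ! l + aux_path b j c l = j ! l + m \<Longrightarrow> m = aux_path b j c (Suc l)"
  by simp

text \<open>
  The list of intermediate states of a nonzero term is the path starting from its first entry.
\<close>

lemma tr_coeff_chain:
  assumes n: "n = length \<epsilon>" "n \<ge> 1"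
  shows "(\<Sum>c | length c = n \<and> c ! 0 = r \<and> tr_term q \<epsilon> (a, b) (i, j) c \<noteq> 0. tr_term q \<epsilon> (a, b) (i, j) c)
     = chain \<epsilon> a b i j r r"
proof -
  let ?t = "tr_term q \<epsilon> (a, b) (i, j)"
  let ?f = "\<lambda>l. S3 q (\<epsilon> ! l) (a ! l) (b ! l)"
  define p where "p = map (aux_path b j r) [0..<n]"
  have t: "?t c = (\<Prod>l<n. ?f l (c ! l) (i ! l) (j ! l) (c ! (Suc l mod n)))" for c
    by (simp add: tr_term_def n(1))
  have uniq: "c = p" if c: "length c = n" "c ! 0 = r" "?t c \<noteq> 0" for c
  proof -
    have nz: "?f l (c ! l) (i ! l) (j ! l) (c ! (Suc l mod n)) \<noteq> 0" if "l < n" for l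
      using c(3) that unfolding t by auto
    have "c ! k = aux_path b j r k" if "k < n" for k using that
    proof (induction k)
      case (Suc k)
      then have "b ! k + aux_path b j r k = j ! k + c ! Suc k"
        using S3_conservation [OF nz [of k]] by simp
      then show ?case by (rule aux_path_Suc_eq)
    qed (simp add: c)
    then show ?thesis using c(1) by (intro nth_equalityI) (auto simp: p_def)
  qed
  have p: "length p = n" "p ! 0 = r" using n(2) by (simp_all add: p_def)
  have "(\<Sum>c | length c = n \<and> c ! 0 = r \<and> ?t c \<noteq> 0. ?t c) = ?t p"
    unfolding conj_assoc [symmetric] by (rule sum_eq_single_of_support) (use uniq p in blast)+
  also have "?t p = chain \<epsilon> a b i j r r"
  proof (cases "aux_path b j r n = r")
    case True
    have "p ! (Suc l mod n) = aux_path b j r (Suc l)" if "l < n" for l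
      using that n(2) True by (cases "Suc l = n") (auto simp: p_def simp del: aux_path.simps(2))
    moreover have "p ! l = aux_path b j r l" if "l < n" for l
      using that by (simp add: p_def)
    ultimately show ?thesis using True
      by (simp add: t chain_def n(1) [symmetric] del: aux_path.simps(2))
  next
    case False
    then obtain m where m: "n = Suc m" using n(2) by (cases n) auto
    have "?f m (p ! m) (i ! m) (j ! m) (p ! (Suc m mod n)) = 0"
    proof (rule ccontr)
      assume "?f m (p ! m) (i ! m) (j ! m) (p ! (Suc m mod n)) \<noteq> 0"
      from S3_conservation [OF this] have "b ! m + p ! m = j ! m + r"
        using p(2) m by simp
      then have "b ! m + aux_path b j r m = j ! m + r"
        using m by (simp add: p_def del: upt_Suc)
      from aux_path_Suc_eq [OF this] show False using False m by simp
    qed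
    then have "?t p = 0" unfolding t using m by auto
    then show ?thesis using False by (simp add: chain_def n(1) [symmetric])
  qed
  finally show ?thesis .
qed

text \<open>
  Here the first state is \<open>s * r\<close>, and the last one has the form \<open>t * l\<close>.  At most one \<open>l\<close> contributes.  The sum over
  all \<open>l\<close> below an arbitrary bound makes it possible to compare different labels with the same range of
  summation.
\<close>

lemma bd_coeff_chain:
  assumes n: "n = length \<epsilon>" "n \<ge> 1" and "t > 0" and N: "aux_path b j (s * r) n \<le> N"
  shows "(\<Sum>c | length c = Suc n \<and> c ! 0 = r \<and> bd_term s t q \<epsilon> (a, b) (i, j) c \<noteq> 0. bd_term s t q \<epsilon> (a, b) (i, j) c)
     = (\<Sum>l\<le>N. qpoch q 2 (s * r) / (qpoch q (s\<^sup>2) r * qpoch q (t\<^sup>2) l) * chain \<epsilon> a b i j (s * r) (t * l))"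
proof -
  let ?t = "bd_term s t q \<epsilon> (a, b) (i, j)"
  let ?f = "\<lambda>l. S3 q (\<epsilon> ! l) (a ! l) (b ! l)"
  let ?g = "\<lambda>l. qpoch q 2 (s * r) / (qpoch q (s\<^sup>2) r * qpoch q (t\<^sup>2) l)"
  let ?pt = "aux_path b j (s * r)"
  define l0 where "l0 = ?pt n div t"
  define p where "p = map (\<lambda>k. if k = 0 then r else if k = n then l0 else ?pt k) [0..<Suc n]"
  have t: "?t c = ?g (c ! n) * (\<Prod>l<n. ?f l (if l = 0 then s * r else c ! l) (i ! l) (j ! l)
      (if Suc l = n then t * c ! n else c ! Suc l))" if "c ! 0 = r" for c
    using that by (simp add: bd_term_def Let_def n(1) prod.atLeast1_atMost_eq cong: if_cong)
  have l0N: "l0 \<le> N"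
    unfolding l0_def using N div_le_dividend [of "?pt n" t] by linarith
  have p: "length p = Suc n" "p ! 0 = r" "p ! n = l0" using n by (auto simp: p_def simp del: upt_Suc)
  have p_k: "(if k = 0 then s * r else p ! k) = ?pt k" if "k < n" for k
    using that by (simp add: p_def del: upt_Suc)
  have uniq: "c = p" if c: "length c = Suc n" "c ! 0 = r" "?t c \<noteq> 0" for c
  proof -
    have nz: "?f l (if l = 0 then s * r else c ! l) (i ! l) (j ! l)
      (if Suc l = n then t * c ! n else c ! Suc l) \<noteq> 0" if "l < n" for l
      using c(3) that unfolding t [OF c(2)] by auto
    have step: "(if Suc l = n then t * c ! n else c ! Suc l) = ?pt (Suc l)"
      if "l < n" "(if l = 0 then s * r else c ! l) = ?pt l" for l
      using nz [OF that(1)] S3_conservation unfolding that(2) by (intro aux_path_Suc_eq) blast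
    have *: "(if k = 0 then s * r else c ! k) = ?pt k" if "k < n" for k using that
    proof (induction k)
      case (Suc k)
      then have "(if Suc k = n then t * c ! n else c ! Suc k) = ?pt (Suc k)"
        using step [of k] by (metis Suc_lessD)
      then show ?case using Suc.prems by (auto simp del: aux_path.simps(2) split: if_splits)
    qed simp
    obtain m where m: "n = Suc m" using n(2) by (cases n) auto
    have "t * c ! n = ?pt n" using step [of m] * [of m] m by simp
    then have "l0 = t * c ! n div t" by (simp only: l0_def)
    then have "c ! n = l0" using \<open>t > 0\<close> by simp
    moreover have "c ! k = p ! k" if "k < n" for k
      using * [OF that] p_k [OF that] c(2) p(2) by (cases "k = 0") auto
    ultimately show ?thesis using c(1) p
      by (intro nth_equalityI) (auto simp: less_Suc_eq)
  qed
  have "(\<Sum>c | length c = Suc n \<and> c ! 0 = r \<and> ?t c \<noteq> 0. ?t c) = ?t p"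
    unfolding conj_assoc [symmetric] by (rule sum_eq_single_of_support) (use uniq p in blast)+
  also have "?t p = ?g l0 * chain \<epsilon> a b i j (s * r) (t * l0)"
  proof (cases "?pt n = t * l0")
    case True
    have "(if Suc l = n then t * p ! n else p ! Suc l) = ?pt (Suc l)" if "l < n" for l
      using that True p(3) p_k [of "Suc l"] by (auto simp del: aux_path.simps(2))
    then have "(\<Prod>l<n. ?f l (if l = 0 then s * r else p ! l) (i ! l) (j ! l) (if Suc l = n then t * p ! n else p ! Suc l))
      = (\<Prod>l<n. ?f l (?pt l) (i ! l) (j ! l) (?pt (Suc l)))"
      using p_k by (intro prod.cong refl) (simp only: lessThan_iff)
    then show ?thesis using True
      unfolding t [OF p(2)] chain_def n(1) [symmetric] p(3) by (simp del: aux_path.simps(2))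
  next
    case False
    obtain m where m: "n = Suc m" using n(2) by (cases n) auto
    have z: "?f m (if m = 0 then s * r else p ! m) (i ! m) (j ! m) (if Suc m = n then t * p ! n else p ! Suc m) = 0"
    proof (rule ccontr)
      assume "?f m (if m = 0 then s * r else p ! m) (i ! m) (j ! m) (if Suc m = n then t * p ! n else p ! Suc m) \<noteq> 0"
      from S3_conservation [OF this] have "b ! m + ?pt m = j ! m + t * l0"
        using p_k [of m] p(3) m by simp
      from aux_path_Suc_eq [OF this] show False using False m by simp
    qed
    have "(\<Prod>l<n. ?f l (if l = 0 then s * r else p ! l) (i ! l) (j ! l) (if Suc l = n then t * p ! n else p ! Suc l)) = 0"
      by (intro prod_zero finite_lessThan bexI [of _ m]) (rule z, simp add: m)
    then show ?thesis using False
      unfolding t [OF p(2)] chain_def n(1) [symmetric] by simp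
  qed
  also have "?g l0 * chain \<epsilon> a b i j (s * r) (t * l0) = (\<Sum>l\<le>N. if l = l0 then ?g l0 * chain \<epsilon> a b i j (s * r) (t * l0) else 0)"
    using l0N by simp
  also have "\<dots> = (\<Sum>l\<le>N. ?g l * chain \<epsilon> a b i j (s * r) (t * l))"
  proof (intro sum.cong refl)
    fix l
    have "chain \<epsilon> a b i j (s * r) (t * l) = 0" if "l \<noteq> l0"
    proof -
      have "?pt n \<noteq> t * l" using that \<open>t > 0\<close> by (metis l0_def nonzero_mult_div_cancel_left not_gr_zero)
      then show ?thesis by (simp add: chain_def n(1) [symmetric])
    qed
    then show "(if l = l0 then ?g l0 * chain \<epsilon> a b i j (s * r) (t * l0) else 0) = ?g l * chain \<epsilon> a b i j (s * r) (t * l)"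
      by simp
  qed
  finally show ?thesis .
qed

text \<open>
  Coefficientwise this is \<open>chain_exchange\<close> with the auxiliary states \<open>r\<close> and \<open>r\<close>.
\<close>

lemma tr_elem_exchange:
  fixes \<epsilon> :: "nat list" and \<rho> :: "'k fps"
  defines "T \<equiv> \<lambda>\<epsilon> a b i j. tr_elem \<rho> q \<epsilon> (a, b) (i, j)"
  assumes "Suc p < length \<epsilon>" "\<epsilon> ! p = 0" "\<epsilon> ! Suc p = 1"
    "length a = length \<epsilon>" "length b = length \<epsilon>" "length i = length \<epsilon>" "length j = length \<epsilon>"
    "a ! Suc p \<in> {0, 1}" "b ! Suc p \<in> {0, 1}" "i ! Suc p \<in> {0, 1}" "j ! Suc p \<in> {0, 1}"
  shows "fps_const (stay (a ! p) (b ! p) (a ! Suc p) (b ! Suc p)) * T \<epsilon> a b i j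
      + fps_const (hop_row (a ! p) (b ! p) (a ! Suc p) (b ! Suc p)) * T \<epsilon> (flip_sites p a) (flip_sites p b) i j
    = fps_const (stay (i ! p) (j ! p) (i ! Suc p) (j ! Suc p)) * T (swap_sites p \<epsilon>) (swap_sites p a) (swap_sites p b) (swap_sites p i) (swap_sites p j)
      + fps_const (hop (i ! p) (j ! p) (i ! Suc p) (j ! Suc p))
        * T (swap_sites p \<epsilon>) (swap_sites p a) (swap_sites p b) (swap_sites p (flip_sites p i)) (swap_sites p (flip_sites p j))"
proof -
  let ?A = "\<lambda>\<epsilon> a b i j. Abs_fps (\<lambda>r. chain \<epsilon> a b i j r r)"
  have T: "T \<epsilon>' a b i j = \<rho> * ?A \<epsilon>' a b i j" if "length \<epsilon>' = length \<epsilon>" for \<epsilon>' a b i j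
    unfolding T_def tr_elem_def using that assms(2) by (subst tr_coeff_chain) auto
  have "fps_const (stay (a ! p) (b ! p) (a ! Suc p) (b ! Suc p)) * ?A \<epsilon> a b i j
      + fps_const (hop_row (a ! p) (b ! p) (a ! Suc p) (b ! Suc p)) * ?A \<epsilon> (flip_sites p a) (flip_sites p b) i j
    = fps_const (stay (i ! p) (j ! p) (i ! Suc p) (j ! Suc p)) * ?A (swap_sites p \<epsilon>) (swap_sites p a) (swap_sites p b) (swap_sites p i) (swap_sites p j)
      + fps_const (hop (i ! p) (j ! p) (i ! Suc p) (j ! Suc p))
        * ?A (swap_sites p \<epsilon>) (swap_sites p a) (swap_sites p b) (swap_sites p (flip_sites p i)) (swap_sites p (flip_sites p j))"
    using chain_exchange [OF assms(2-)] by (intro fps_ext) simp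
  then have "\<rho> * (fps_const (stay (a ! p) (b ! p) (a ! Suc p) (b ! Suc p)) * ?A \<epsilon> a b i j
      + fps_const (hop_row (a ! p) (b ! p) (a ! Suc p) (b ! Suc p)) * ?A \<epsilon> (flip_sites p a) (flip_sites p b) i j)
    = \<rho> * (fps_const (stay (i ! p) (j ! p) (i ! Suc p) (j ! Suc p)) * ?A (swap_sites p \<epsilon>) (swap_sites p a) (swap_sites p b) (swap_sites p i) (swap_sites p j)
      + fps_const (hop (i ! p) (j ! p) (i ! Suc p) (j ! Suc p))
        * ?A (swap_sites p \<epsilon>) (swap_sites p a) (swap_sites p b) (swap_sites p (flip_sites p i)) (swap_sites p (flip_sites p j)))"
    by (rule arg_cong)
  then show ?thesis by (simp only: T swap_flip_sites_simps distrib_left mult.left_commute)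
qed

text \<open>
  Coefficientwise this is a linear combination of instances of \<open>chain_exchange\<close>, one for each end state \<open>t * l\<close>.
\<close>

lemma bd_elem_exchange:
  fixes \<epsilon> :: "nat list" and \<rho> :: "'k fps" and s t :: nat
  defines "T \<equiv> \<lambda>\<epsilon> a b i j. bd_elem s t \<rho> q \<epsilon> (a, b) (i, j)"
  assumes "Suc p < length \<epsilon>" "\<epsilon> ! p = 0" "\<epsilon> ! Suc p = 1"
    "length a = length \<epsilon>" "length b = length \<epsilon>" "length i = length \<epsilon>" "length j = length \<epsilon>"
    "a ! Suc p \<in> {0, 1}" "b ! Suc p \<in> {0, 1}" "i ! Suc p \<in> {0, 1}" "j ! Suc p \<in> {0, 1}" and t: "t > 0"
  shows "fps_const (stay (a ! p) (b ! p) (a ! Suc p) (b ! Suc p)) * T \<epsilon> a b i j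
      + fps_const (hop_row (a ! p) (b ! p) (a ! Suc p) (b ! Suc p)) * T \<epsilon> (flip_sites p a) (flip_sites p b) i j
    = fps_const (stay (i ! p) (j ! p) (i ! Suc p) (j ! Suc p)) * T (swap_sites p \<epsilon>) (swap_sites p a) (swap_sites p b) (swap_sites p i) (swap_sites p j)
      + fps_const (hop (i ! p) (j ! p) (i ! Suc p) (j ! Suc p))
        * T (swap_sites p \<epsilon>) (swap_sites p a) (swap_sites p b) (swap_sites p (flip_sites p i)) (swap_sites p (flip_sites p j))"
proof -
  let ?g = "\<lambda>r l. qpoch q 2 (s * r) / (qpoch q (s\<^sup>2) r * qpoch q (t\<^sup>2) l)"
  let ?n = "length \<epsilon>"
  define N where "N r = aux_path b j (s * r) ?n + aux_path (flip_sites p b) j (s * r) ?n + aux_path (swap_sites p b) (swap_sites p j) (s * r) ?n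
    + aux_path (swap_sites p b) (swap_sites p (flip_sites p j)) (s * r) ?n" for r
  let ?A = "\<lambda>\<epsilon> a b i j. Abs_fps (\<lambda>r. \<Sum>l\<le>N r. ?g r l * chain \<epsilon> a b i j (s * r) (t * l))"
  have T: "T \<epsilon>' a' b' i' j' = \<rho> * ?A \<epsilon>' a' b' i' j'"
    if "length \<epsilon>' = ?n" "\<And>r. aux_path b' j' (s * r) ?n \<le> N r" for \<epsilon>' a' b' i' j'
  proof -
    have "(\<Sum>c | length c = Suc (length \<epsilon>') \<and> c ! 0 = r \<and> bd_term s t q \<epsilon>' (a', b') (i', j') c \<noteq> 0.
        bd_term s t q \<epsilon>' (a', b') (i', j') c) = (\<Sum>l\<le>N r. ?g r l * chain \<epsilon>' a' b' i' j' (s * r) (t * l))" for r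
      by (rule bd_coeff_chain) (use that assms(2) t in auto)
    then show ?thesis unfolding T_def bd_elem_def by simp
  qed
  have "fps_const (stay (a ! p) (b ! p) (a ! Suc p) (b ! Suc p)) * ?A \<epsilon> a b i j
      + fps_const (hop_row (a ! p) (b ! p) (a ! Suc p) (b ! Suc p)) * ?A \<epsilon> (flip_sites p a) (flip_sites p b) i j
    = fps_const (stay (i ! p) (j ! p) (i ! Suc p) (j ! Suc p)) * ?A (swap_sites p \<epsilon>) (swap_sites p a) (swap_sites p b) (swap_sites p i) (swap_sites p j)
      + fps_const (hop (i ! p) (j ! p) (i ! Suc p) (j ! Suc p))
        * ?A (swap_sites p \<epsilon>) (swap_sites p a) (swap_sites p b) (swap_sites p (flip_sites p i)) (swap_sites p (flip_sites p j))"
    (is "?L = ?R")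
  proof (rule fps_ext)
    fix r
    have L: "X * (\<Sum>l\<le>M. g l * C l) + Y * (\<Sum>l\<le>M. g l * D l) = (\<Sum>l\<le>M. g l * (X * C l + Y * D l))"
      for X Y M and g C D :: "nat \<Rightarrow> 'k"
      by (simp add: sum_distrib_left distrib_left sum.distrib mult.left_commute)
    show "fps_nth ?L r = fps_nth ?R r"
      unfolding fps_add_nth fps_mult_left_const_nth fps_nth_Abs_fps L chain_exchange [OF assms(2-12)] ..
  qed
  then have "\<rho> * ?L = \<rho> * ?R" by (rule arg_cong)
  moreover have "T \<epsilon> a b i j = \<rho> * ?A \<epsilon> a b i j" by (rule T) (simp_all add: N_def)
  moreover have "T \<epsilon> (flip_sites p a) (flip_sites p b) i j = \<rho> * ?A \<epsilon> (flip_sites p a) (flip_sites p b) i j" by (rule T) (simp_all add: N_def)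
  moreover have "T (swap_sites p \<epsilon>) (swap_sites p a) (swap_sites p b) (swap_sites p i) (swap_sites p j)
      = \<rho> * ?A (swap_sites p \<epsilon>) (swap_sites p a) (swap_sites p b) (swap_sites p i) (swap_sites p j)" by (rule T) (simp_all add: N_def)
  moreover have "T (swap_sites p \<epsilon>) (swap_sites p a) (swap_sites p b) (swap_sites p (flip_sites p i)) (swap_sites p (flip_sites p j))
      = \<rho> * ?A (swap_sites p \<epsilon>) (swap_sites p a) (swap_sites p b) (swap_sites p (flip_sites p i)) (swap_sites p (flip_sites p j))" by (rule T) (simp_all add: N_def)
  ultimately show ?thesis by (simp only: distrib_left mult.left_commute)
qed

end

section \<open>Matrices with finite columns and extension of scalars\<close>

abbreviation WB :: "nat list \<Rightarrow> label set" where "WB \<epsilon> \<equiv> W_basis \<epsilon> \<times> W_basis \<epsilon>"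

lemma lookup_mat_op:
  fixes M :: "label \<Rightarrow> label \<Rightarrow> 'r::comm_ring_1"
  assumes fin: "\<And>x. finite {y \<in> WB \<epsilon>. M y x \<noteq> 0}" and X: "finite X" "Poly_Mapping.keys v \<subseteq> X"
  shows "Poly_Mapping.lookup (mat_op \<epsilon> M v) y
    = (if y \<in> WB \<epsilon> then \<Sum>x\<in>X. M y x * Poly_Mapping.lookup v x else 0)"
proof -
  have inner: "(\<Sum>ab | ab \<in> WB \<epsilon> \<and> M ab x \<noteq> 0. Poly_Mapping.lookup (Poly_Mapping.single ab (M ab x * c)) y)
      = (if y \<in> WB \<epsilon> then M y x * c else 0)" for x c
  proof -
    have "(\<Sum>ab | ab \<in> WB \<epsilon> \<and> M ab x \<noteq> 0. Poly_Mapping.lookup (Poly_Mapping.single ab (M ab x * c)) y)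
      = (\<Sum>ab | ab \<in> WB \<epsilon> \<and> M ab x \<noteq> 0. if ab = y then M ab x * c else 0)"
      by (intro sum.cong refl) (simp add: lookup_single when_def)
    also have "\<dots> = (if y \<in> {ab \<in> WB \<epsilon>. M ab x \<noteq> 0} then M y x * c else 0)"
      by (rule sum.delta [OF fin])
    finally show ?thesis by auto
  qed
  have "Poly_Mapping.lookup (mat_op \<epsilon> M v) y
      = (\<Sum>x\<in>Poly_Mapping.keys v. if y \<in> WB \<epsilon> then M y x * Poly_Mapping.lookup v x else 0)"
    unfolding mat_op_def lookup_sum inner ..
  also have "\<dots> = (\<Sum>x\<in>X. if y \<in> WB \<epsilon> then M y x * Poly_Mapping.lookup v x else 0)"
    by (rule sum.mono_neutral_left [OF X]) (simp add: in_keys_iff)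
  finally show ?thesis by simp
qed

lemma WW_iff: "v \<in> WW \<epsilon> \<longleftrightarrow> (\<forall>x. x \<notin> WB \<epsilon> \<longrightarrow> Poly_Mapping.lookup v x = 0)"
  by (auto simp: WW_def in_keys_iff subset_iff)

lemma mat_op_in_WW:
  fixes M :: "label \<Rightarrow> label \<Rightarrow> 'r::comm_ring_1"
  assumes "\<And>x. finite {y \<in> WB \<epsilon>. M y x \<noteq> 0}"
  shows "mat_op \<epsilon> M v \<in> WW \<epsilon>"
  unfolding WW_iff using lookup_mat_op [OF assms finite_keys order_refl] by simp

lemma linear_mat_op:
  fixes M :: "label \<Rightarrow> label \<Rightarrow> 'k::field"
  assumes fin: "\<And>x. finite {y \<in> WB \<epsilon>. M y x \<noteq> 0}"
  shows "Vector_Spaces.linear scale scale (mat_op \<epsilon> M)"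
proof -
  note lk = lookup_mat_op [OF fin]
  have add: "mat_op \<epsilon> M (v + w) = mat_op \<epsilon> M v + mat_op \<epsilon> M w" for v w
  proof (rule poly_mapping_eqI)
    fix y
    let ?X = "Poly_Mapping.keys v \<union> Poly_Mapping.keys w"
    have l: "Poly_Mapping.lookup (mat_op \<epsilon> M u) y = (if y \<in> WB \<epsilon> then \<Sum>x\<in>?X. M y x * Poly_Mapping.lookup u x else 0)"
      if "Poly_Mapping.keys u \<subseteq> ?X" for u
      by (rule lk [OF _ that]) simp
    have "Poly_Mapping.lookup (mat_op \<epsilon> M (v + w)) y
        = Poly_Mapping.lookup (mat_op \<epsilon> M v) y + Poly_Mapping.lookup (mat_op \<epsilon> M w) y"
      unfolding l [OF keys_add] l [OF Un_upper1] l [OF Un_upper2]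
      by (cases "y \<in> WB \<epsilon>") (simp_all only: if_True if_False lookup_add distrib_left sum.distrib add_0)
    then show "Poly_Mapping.lookup (mat_op \<epsilon> M (v + w)) y = Poly_Mapping.lookup (mat_op \<epsilon> M v + mat_op \<epsilon> M w) y"
      by (simp only: lookup_add)
  qed
  have scl: "mat_op \<epsilon> M (scale c v) = scale c (mat_op \<epsilon> M v)" for c v
  proof (rule poly_mapping_eqI)
    fix y
    have "Poly_Mapping.keys (scale c v) \<subseteq> Poly_Mapping.keys v" by (auto simp: in_keys_iff)
    then show "Poly_Mapping.lookup (mat_op \<epsilon> M (scale c v)) y = Poly_Mapping.lookup (scale c (mat_op \<epsilon> M v)) y"
      by (simp add: lk [where X = "Poly_Mapping.keys v"] sum_distrib_left mult.left_commute)
  qed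
  show ?thesis
    unfolding Vector_Spaces.linear_iff using add scl vector_space_scale by blast
qed

lemma lookup_extend_z:
  assumes "finite X" "Poly_Mapping.keys v \<subseteq> X"
  shows "Poly_Mapping.lookup (extend_z \<Phi> v) y
    = (\<Sum>x\<in>X. fps_const (Poly_Mapping.lookup (\<Phi> (Poly_Mapping.single x 1)) y) * Poly_Mapping.lookup v x)"
proof -
  have inner: "(\<Sum>y'\<in>Poly_Mapping.keys w. Poly_Mapping.lookup
        (Poly_Mapping.single y' (fps_const (Poly_Mapping.lookup w y') * c)) y)
      = fps_const (Poly_Mapping.lookup w y) * c" for w :: "label \<Rightarrow>\<^sub>0 'a" and c
  proof -
    have "(\<Sum>y'\<in>Poly_Mapping.keys w. Poly_Mapping.lookup
        (Poly_Mapping.single y' (fps_const (Poly_Mapping.lookup w y') * c)) y)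
      = (\<Sum>y'\<in>Poly_Mapping.keys w. if y' = y then fps_const (Poly_Mapping.lookup w y') * c else 0)"
      by (intro sum.cong refl) (simp add: lookup_single when_def)
    also have "\<dots> = (if y \<in> Poly_Mapping.keys w then fps_const (Poly_Mapping.lookup w y) * c else 0)"
      by (rule sum.delta [OF finite_keys])
    finally show ?thesis by (auto simp: in_keys_iff)
  qed
  have "Poly_Mapping.lookup (extend_z \<Phi> v) y = (\<Sum>x\<in>Poly_Mapping.keys v.
      fps_const (Poly_Mapping.lookup (\<Phi> (Poly_Mapping.single x 1)) y) * Poly_Mapping.lookup v x)"
    unfolding extend_z_def Let_def lookup_sum inner ..
  also have "\<dots> = (\<Sum>x\<in>X. fps_const (Poly_Mapping.lookup (\<Phi> (Poly_Mapping.single x 1)) y) * Poly_Mapping.lookup v x)"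
    by (rule sum.mono_neutral_left [OF assms]) (simp add: in_keys_iff)
  finally show ?thesis .
qed

lemma lookup_linear:
  assumes "Vector_Spaces.linear scale scale \<Psi>" and Y: "finite Y" "Poly_Mapping.keys w \<subseteq> Y"
  shows "Poly_Mapping.lookup (\<Psi> w) z
    = (\<Sum>y\<in>Y. Poly_Mapping.lookup w y * Poly_Mapping.lookup (\<Psi> (Poly_Mapping.single y 1)) z)"
proof -
  interpret \<Psi>: Vector_Spaces.linear scale scale \<Psi> by fact
  have "w = (\<Sum>y\<in>Y. scale (Poly_Mapping.lookup w y) (Poly_Mapping.single y 1))"
  proof (rule poly_mapping_eqI)
    fix x
    have "(\<Sum>y\<in>Y. Poly_Mapping.lookup (scale (Poly_Mapping.lookup w y) (Poly_Mapping.single y 1)) x)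
        = (\<Sum>y\<in>Y. if y = x then Poly_Mapping.lookup w y else 0)"
      by (intro sum.cong refl) (simp add: lookup_single when_def)
    also have "\<dots> = Poly_Mapping.lookup w x"
      using Y by (auto simp: in_keys_iff)
    finally show "Poly_Mapping.lookup w x
        = Poly_Mapping.lookup (\<Sum>y\<in>Y. scale (Poly_Mapping.lookup w y) (Poly_Mapping.single y 1)) x"
      by (simp add: lookup_sum)
  qed
  then have "\<Psi> w = \<Psi> (\<Sum>y\<in>Y. scale (Poly_Mapping.lookup w y) (Poly_Mapping.single y 1))"
    by (rule arg_cong)
  also have "\<dots> = (\<Sum>y\<in>Y. scale (Poly_Mapping.lookup w y) (\<Psi> (Poly_Mapping.single y 1)))"
    by (simp only: \<Psi>.sum \<Psi>.scale)
  finally show ?thesis by (simp add: lookup_sum)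
qed

lemma fps_const_sum: "fps_const (sum f A) = (\<Sum>x\<in>A. fps_const (f x))"
  by (induction A rule: infinite_finite_induct) (simp_all flip: fps_const_add)

text \<open>
  Extension of scalars is a functor.  Linearity is used for the outer map, whose values are needed on images of basis
  vectors.
\<close>

lemma extend_z_compose:
  assumes "Vector_Spaces.linear scale scale \<Psi>"
  shows "extend_z \<Psi> (extend_z \<Phi> v) = extend_z (\<Psi> \<circ> \<Phi>) v"
proof (rule poly_mapping_eqI)
  fix z
  let ?K = "Poly_Mapping.keys v" and ?l = "Poly_Mapping.lookup"
  define Y where "Y = (\<Union>x\<in>?K. Poly_Mapping.keys (\<Phi> (Poly_Mapping.single x 1)))"
  have fY: "finite Y" by (simp add: Y_def)
  have kY: "Poly_Mapping.keys (extend_z \<Phi> v) \<subseteq> Y"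
  proof
    fix y assume "y \<in> Poly_Mapping.keys (extend_z \<Phi> v)"
    then have "(\<Sum>x\<in>?K. fps_const (?l (\<Phi> (Poly_Mapping.single x 1)) y) * ?l v x) \<noteq> 0"
      by (simp add: in_keys_iff lookup_extend_z [OF finite_keys order_refl])
    then obtain x where "x \<in> ?K" "?l (\<Phi> (Poly_Mapping.single x 1)) y \<noteq> 0"
      by (metis (no_types, lifting) fps_const_0_eq_0 mult_zero_left sum.neutral)
    then show "y \<in> Y" by (auto simp: Y_def in_keys_iff)
  qed
  have "?l (extend_z \<Psi> (extend_z \<Phi> v)) z = (\<Sum>y\<in>Y. fps_const (?l (\<Psi> (Poly_Mapping.single y 1)) z)
      * (\<Sum>x\<in>?K. fps_const (?l (\<Phi> (Poly_Mapping.single x 1)) y) * ?l v x))"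
    by (subst lookup_extend_z [OF fY kY]) (simp only: lookup_extend_z [OF finite_keys order_refl])
  also have "\<dots> = (\<Sum>x\<in>?K. (\<Sum>y\<in>Y. fps_const (?l (\<Phi> (Poly_Mapping.single x 1)) y * ?l (\<Psi> (Poly_Mapping.single y 1)) z)) * ?l v x)"
    unfolding sum_distrib_left sum_distrib_right
    by (rule trans [OF sum.swap]) (intro sum.cong refl, simp only: fps_const_mult [symmetric] mult_ac)
  also have "\<dots> = (\<Sum>x\<in>?K. fps_const (?l (\<Psi> (\<Phi> (Poly_Mapping.single x 1))) z) * ?l v x)"
  proof (intro sum.cong refl)
    fix x assume "x \<in> ?K"
    then have "Poly_Mapping.keys (\<Phi> (Poly_Mapping.single x 1)) \<subseteq> Y" by (auto simp: Y_def)
    note e = lookup_linear [OF assms fY this, of z]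
    show "(\<Sum>y\<in>Y. fps_const (?l (\<Phi> (Poly_Mapping.single x 1)) y * ?l (\<Psi> (Poly_Mapping.single y 1)) z)) * ?l v x
        = fps_const (?l (\<Psi> (\<Phi> (Poly_Mapping.single x 1))) z) * ?l v x"
      unfolding e fps_const_sum ..
  qed
  also have "\<dots> = ?l (extend_z (\<Psi> \<circ> \<Phi>) v) z"
    by (simp add: lookup_extend_z [OF finite_keys order_refl])
  finally show "?l (extend_z \<Psi> (extend_z \<Phi> v)) z = ?l (extend_z (\<Psi> \<circ> \<Phi>) v) z" .
qed

lemma extend_z_ident:
  assumes "\<And>x. x \<in> Poly_Mapping.keys v \<Longrightarrow> \<Phi> (Poly_Mapping.single x 1) = Poly_Mapping.single x 1"
  shows "extend_z \<Phi> v = v"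
proof (rule poly_mapping_eqI)
  fix y
  have "Poly_Mapping.lookup (extend_z \<Phi> v) y = (\<Sum>x\<in>Poly_Mapping.keys v. if x = y then Poly_Mapping.lookup v x else 0)"
    unfolding lookup_extend_z [OF finite_keys order_refl]
    by (intro sum.cong refl) (simp add: assms lookup_single when_def)
  also have "\<dots> = Poly_Mapping.lookup v y" by (auto simp: in_keys_iff)
  finally show "Poly_Mapping.lookup (extend_z \<Phi> v) y = Poly_Mapping.lookup v y" .
qed

lemma single_in_WW: "x \<in> WB \<epsilon> \<Longrightarrow> Poly_Mapping.single x 1 \<in> WW \<epsilon>"
  by (auto simp: WW_iff lookup_single when_def)

lemma extend_z_in_WW:
  assumes "\<And>w. w \<in> WW \<epsilon> \<Longrightarrow> \<Phi> w \<in> WW \<epsilon>'" "v \<in> WW \<epsilon>"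
  shows "extend_z \<Phi> v \<in> WW \<epsilon>'"
  unfolding WW_iff
proof (intro allI impI)
  fix y assume y: "y \<notin> WB \<epsilon>'"
  have "Poly_Mapping.lookup (\<Phi> (Poly_Mapping.single x 1)) y = 0" if "x \<in> Poly_Mapping.keys v" for x
  proof -
    have "x \<in> WB \<epsilon>" using that assms(2) by (auto simp: WW_def)
    then have "\<Phi> (Poly_Mapping.single x 1) \<in> WW \<epsilon>'" using assms(1) single_in_WW by blast
    then show ?thesis using y unfolding WW_iff by blast
  qed
  then show "Poly_Mapping.lookup (extend_z \<Phi> v) y = 0"
    unfolding lookup_extend_z [OF finite_keys order_refl] by (intro sum.neutral) simp
qed

lemma extend_z_mat_op:
  fixes M :: "label \<Rightarrow> label \<Rightarrow> 'k::field"
  assumes fin: "\<And>x. finite {y \<in> WB \<epsilon>. M y x \<noteq> 0}"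
  shows "extend_z (mat_op \<epsilon> M) v = mat_op \<epsilon> (\<lambda>y x. fps_const (M y x)) v"
proof (rule poly_mapping_eqI)
  fix y
  have fin': "finite {y \<in> WB \<epsilon>. fps_const (M y x) \<noteq> 0}" for x using fin by simp
  have "Poly_Mapping.lookup (mat_op \<epsilon> M (Poly_Mapping.single x 1)) y = (if y \<in> WB \<epsilon> then M y x else 0)" for x
    by (subst lookup_mat_op [OF fin, where X = "{x}"]) auto
  then show "Poly_Mapping.lookup (extend_z (mat_op \<epsilon> M) v) y
      = Poly_Mapping.lookup (mat_op \<epsilon> (\<lambda>y x. fps_const (M y x)) v) y"
    by (simp add: lookup_extend_z [OF finite_keys order_refl] lookup_mat_op [OF fin' finite_keys order_refl])
qed

section \<open>Equivalence of site sequences\<close>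

text \<open>
  The inverse is a separate witness, defined and linear on the whole space although it inverts \<open>\<Phi>\<close> only between the
  two subspaces; this lets the two witnesses change roles.
\<close>

definition equivalent ::
  "(nat list \<Rightarrow> (label \<Rightarrow>\<^sub>0 'k::field fps) \<Rightarrow> (label \<Rightarrow>\<^sub>0 'k fps)) set \<Rightarrow> nat list \<Rightarrow> nat list \<Rightarrow> bool" where
  "equivalent \<A> \<epsilon> \<epsilon>' \<longleftrightarrow> (\<exists>\<Phi> \<Psi>. Vector_Spaces.linear scale scale \<Phi> \<and> Vector_Spaces.linear scale scale \<Psi>
     \<and> (\<forall>v\<in>WW \<epsilon>. \<Phi> v \<in> WW \<epsilon>' \<and> \<Psi> (\<Phi> v) = v) \<and> (\<forall>v\<in>WW \<epsilon>'. \<Psi> v \<in> WW \<epsilon> \<and> \<Phi> (\<Psi> v) = v)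
     \<and> (\<forall>A\<in>\<A>. \<forall>v\<in>WW \<epsilon>. extend_z \<Phi> (A \<epsilon> v) = A \<epsilon>' (extend_z \<Phi> v)))"

lemma equivalent_refl: "equivalent \<A> \<epsilon> \<epsilon>"
  unfolding equivalent_def
  by (intro exI [of _ "\<lambda>v. v"]) (simp add: extend_z_ident Vector_Spaces.linear_iff vector_space_scale)

lemma equivalent_trans:
  assumes "equivalent \<A> \<epsilon> \<epsilon>'" "equivalent \<A> \<epsilon>' \<epsilon>''"
  shows "equivalent \<A> \<epsilon> \<epsilon>''"
proof -
  from assms(1) obtain \<Phi> \<Psi> where 1: "Vector_Spaces.linear scale scale \<Phi>" "Vector_Spaces.linear scale scale \<Psi>"
     "\<And>v. v \<in> WW \<epsilon> \<Longrightarrow> \<Phi> v \<in> WW \<epsilon>'" "\<And>v. v \<in> WW \<epsilon> \<Longrightarrow> \<Psi> (\<Phi> v) = v"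
     "\<And>v. v \<in> WW \<epsilon>' \<Longrightarrow> \<Psi> v \<in> WW \<epsilon>" "\<And>v. v \<in> WW \<epsilon>' \<Longrightarrow> \<Phi> (\<Psi> v) = v"
     "\<And>A v. A \<in> \<A> \<Longrightarrow> v \<in> WW \<epsilon> \<Longrightarrow> extend_z \<Phi> (A \<epsilon> v) = A \<epsilon>' (extend_z \<Phi> v)"
    unfolding equivalent_def by blast
  from assms(2) obtain \<Phi>' \<Psi>' where 2: "Vector_Spaces.linear scale scale \<Phi>'" "Vector_Spaces.linear scale scale \<Psi>'"
     "\<And>v. v \<in> WW \<epsilon>' \<Longrightarrow> \<Phi>' v \<in> WW \<epsilon>''" "\<And>v. v \<in> WW \<epsilon>' \<Longrightarrow> \<Psi>' (\<Phi>' v) = v"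
     "\<And>v. v \<in> WW \<epsilon>'' \<Longrightarrow> \<Psi>' v \<in> WW \<epsilon>'" "\<And>v. v \<in> WW \<epsilon>'' \<Longrightarrow> \<Phi>' (\<Psi>' v) = v"
     "\<And>A v. A \<in> \<A> \<Longrightarrow> v \<in> WW \<epsilon>' \<Longrightarrow> extend_z \<Phi>' (A \<epsilon>' v) = A \<epsilon>'' (extend_z \<Phi>' v)"
    unfolding equivalent_def by blast
  have "extend_z (\<Phi>' \<circ> \<Phi>) (A \<epsilon> v) = A \<epsilon>'' (extend_z (\<Phi>' \<circ> \<Phi>) v)" if "A \<in> \<A>" "v \<in> WW \<epsilon>" for A v
  proof -
    have "extend_z (\<Phi>' \<circ> \<Phi>) (A \<epsilon> v) = extend_z \<Phi>' (A \<epsilon>' (extend_z \<Phi> v))"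
      by (simp add: extend_z_compose [OF 2(1), symmetric] 1(7) that)
    also have "\<dots> = A \<epsilon>'' (extend_z \<Phi>' (extend_z \<Phi> v))"
      by (rule 2(7) [OF that(1) extend_z_in_WW [OF 1(3) that(2)]])
    finally show ?thesis by (simp add: extend_z_compose [OF 2(1)])
  qed
  moreover have "Vector_Spaces.linear scale scale (\<Phi>' \<circ> \<Phi>)" "Vector_Spaces.linear scale scale (\<Psi> \<circ> \<Psi>')"
    using 1(1,2) 2(1,2) by (auto intro: Vector_Spaces.linear_compose)
  ultimately show ?thesis
    unfolding equivalent_def using 1(3-6) 2(3-6)
    by (intro exI [of _ "\<Phi>' \<circ> \<Phi>"] exI [of _ "\<Psi> \<circ> \<Psi>'"]) simp
qed

text \<open>
  The inverse intertwines in the other direction because extension of scalars turns it into an inverse of the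
  extended map.
\<close>

lemma equivalent_sym:
  assumes closed: "\<And>A \<epsilon> v. A \<in> \<A> \<Longrightarrow> A \<epsilon> v \<in> WW \<epsilon>"
    and "equivalent \<A> \<epsilon> \<epsilon>'"
  shows "equivalent \<A> \<epsilon>' \<epsilon>"
proof -
  from assms(2) obtain \<Phi> \<Psi> where 1: "Vector_Spaces.linear scale scale \<Phi>" "Vector_Spaces.linear scale scale \<Psi>"
     "\<And>v. v \<in> WW \<epsilon> \<Longrightarrow> \<Phi> v \<in> WW \<epsilon>'" "\<And>v. v \<in> WW \<epsilon> \<Longrightarrow> \<Psi> (\<Phi> v) = v"
     "\<And>v. v \<in> WW \<epsilon>' \<Longrightarrow> \<Psi> v \<in> WW \<epsilon>" "\<And>v. v \<in> WW \<epsilon>' \<Longrightarrow> \<Phi> (\<Psi> v) = v"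
     "\<And>A v. A \<in> \<A> \<Longrightarrow> v \<in> WW \<epsilon> \<Longrightarrow> extend_z \<Phi> (A \<epsilon> v) = A \<epsilon>' (extend_z \<Phi> v)"
    unfolding equivalent_def by blast
  have \<Psi>\<Phi>: "extend_z \<Psi> (extend_z \<Phi> v) = v" if "v \<in> WW \<epsilon>" for v
    unfolding extend_z_compose [OF 1(2)] using that 1(4) single_in_WW
    by (intro extend_z_ident) (auto simp: WW_def)
  have \<Phi>\<Psi>: "extend_z \<Phi> (extend_z \<Psi> v) = v" if "v \<in> WW \<epsilon>'" for v
    unfolding extend_z_compose [OF 1(1)] using that 1(6) single_in_WW
    by (intro extend_z_ident) (auto simp: WW_def)
  have "extend_z \<Psi> (A \<epsilon>' v) = A \<epsilon> (extend_z \<Psi> v)" if "A \<in> \<A>" "v \<in> WW \<epsilon>'" for A v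
  proof -
    have *: "extend_z \<Psi> v \<in> WW \<epsilon>" using extend_z_in_WW [OF 1(5) that(2)] .
    have "extend_z \<Psi> (A \<epsilon>' v) = extend_z \<Psi> (A \<epsilon>' (extend_z \<Phi> (extend_z \<Psi> v)))"
      by (simp add: \<Phi>\<Psi> that)
    also have "\<dots> = extend_z \<Psi> (extend_z \<Phi> (A \<epsilon> (extend_z \<Psi> v)))"
      by (simp add: 1(7) that(1) *)
    also have "\<dots> = A \<epsilon> (extend_z \<Psi> v)" by (rule \<Psi>\<Phi> [OF closed [OF that(1)]])
    finally show ?thesis .
  qed
  with 1(1-6) show ?thesis unfolding equivalent_def
    by (intro exI [of _ \<Psi>] exI [of _ \<Phi>] conjI ballI) simp_all
qed

lemma move_past_ones:
  assumes refl: "\<And>\<epsilon>. E \<epsilon> \<epsilon>" and trans: "\<And>\<epsilon> \<epsilon>' \<epsilon>''. E \<epsilon> \<epsilon>' \<Longrightarrow> E \<epsilon>' \<epsilon>'' \<Longrightarrow> E \<epsilon> \<epsilon>''"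
    and swap: "\<And>xs ys. E (xs @ 0 # 1 # ys) (xs @ 1 # 0 # ys)"
  shows "E (xs @ 0 # replicate k 1 @ ys) (xs @ replicate k 1 @ 0 # ys)"
proof (induction k arbitrary: xs)
  case 0
  show ?case by (simp add: refl)
next
  case (Suc k)
  have "E (xs @ 0 # 1 # replicate k 1 @ ys) ((xs @ [1]) @ 0 # replicate k 1 @ ys)"
    using swap [of xs "replicate k 1 @ ys"] by simp
  from trans [OF this Suc] show ?case by simp
qed

text \<open>
  Every sequence of zeros and ones is carried to the one with all ones in front by exchanges of one kind.  With symmetry
  and transitivity this connects any two rearrangements of the same sequence.
\<close>

lemma sort_zeros_ones:
  fixes E :: "nat list \<Rightarrow> nat list \<Rightarrow> bool"
  assumes refl: "\<And>\<epsilon>. E \<epsilon> \<epsilon>" and trans: "\<And>\<epsilon> \<epsilon>' \<epsilon>''. E \<epsilon> \<epsilon>' \<Longrightarrow> E \<epsilon>' \<epsilon>'' \<Longrightarrow> E \<epsilon> \<epsilon>''"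
    and swap: "\<And>xs ys. E (xs @ 0 # 1 # ys) (xs @ 1 # 0 # ys)" and "set \<epsilon> \<subseteq> {0, 1}"
  shows "E (xs @ \<epsilon>) (xs @ replicate (count (mset \<epsilon>) 1) 1 @ replicate (count (mset \<epsilon>) 0) 0)"
  using assms(4)
proof (induction \<epsilon> arbitrary: xs)
  case Nil
  show ?case by (simp add: refl)
next
  case (Cons e \<epsilon>)
  let ?k = "count (mset \<epsilon>) 1" and ?l = "count (mset \<epsilon>) 0"
  have 1: "E (xs @ e # \<epsilon>) (xs @ e # replicate ?k 1 @ replicate ?l 0)"
    using Cons.IH [of "xs @ [e]"] Cons.prems by simp
  show ?case
  proof (cases "e = 0")
    case True
    have "E (xs @ 0 # replicate ?k 1 @ replicate ?l 0) (xs @ replicate ?k 1 @ 0 # replicate ?l 0)"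
      by (rule move_past_ones [where E = E]) (fact refl, fact trans, fact swap)
    from trans [OF 1 [unfolded True] this] show ?thesis using True by simp
  next
    case False
    then have "e = 1" using Cons.prems by simp
    then show ?thesis using 1 by simp
  qed
qed

section \<open>The exchange of two neighbouring sites\<close>

context generic_q begin

lemma nth_swap_sites: "Suc p < length xs \<Longrightarrow> k < length xs \<Longrightarrow>
  swap_sites p xs ! k = (if k = p then xs ! Suc p else if k = Suc p then xs ! p else xs ! k)"
  by (simp add: swap_sites_def nth_list_update)

lemma nth_flip_sites: "Suc p < length xs \<Longrightarrow> k < length xs \<Longrightarrow>
  flip_sites p xs ! k = (if k = p then xs ! p + 2 * xs ! Suc p - 1 else if k = Suc p then 1 - xs ! Suc p else xs ! k)"
  by (simp add: flip_sites_def nth_list_update)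

lemma swap_swap_sites: "Suc p < length xs \<Longrightarrow> swap_sites p (swap_sites p xs) = xs"
  by (rule nth_equalityI) (simp_all add: nth_swap_sites)

lemma flip_flip_sites: "Suc p < length xs \<Longrightarrow> xs ! Suc p = 1 \<or> xs ! Suc p = 0 \<and> xs ! p > 0 \<Longrightarrow> flip_sites p (flip_sites p xs) = xs"
  by (rule nth_equalityI) (auto simp: nth_flip_sites)

lemma swap_sites_W_basis:
  assumes p: "Suc p < length \<epsilon>" and m: "m \<in> W_basis \<epsilon>"
  shows "swap_sites p m \<in> W_basis (swap_sites p \<epsilon>)"
  unfolding W_basis_def
proof (intro CollectI conjI allI impI)
  have l: "length m = length \<epsilon>" and site: "\<And>k. k < length \<epsilon> \<Longrightarrow> \<epsilon> ! k = 1 \<Longrightarrow> m ! k \<in> {0, 1}"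
    using m unfolding W_basis_def by blast+
  show "length (swap_sites p m) = length (swap_sites p \<epsilon>)" using l by simp
  fix k assume k: "k < length (swap_sites p \<epsilon>)" "swap_sites p \<epsilon> ! k = 1"
  show "swap_sites p m ! k \<in> {0, 1}"
    using k p l site [of k] site [of p] site [of "Suc p"]
    by (cases "k = p"; cases "k = Suc p") (simp_all add: nth_swap_sites)
qed

text \<open>
  The normalised \<open>\<Phi>\<close> squares to the identity.  On the block spanned by \<open>a, b\<close> with \<open>v = 0\<close> and its partner, this is the
  identity \<open>D\<close> with exponents \<open>a\<close> and \<open>b + 1\<close>; the off-diagonal part cancels because the two diagonal entries of the
  block are opposite.
\<close>

lemma stay_hop_row_square:
  assumes "v \<in> {0, 1}" "w \<in> {0, 1}"
  shows "stay a b v w * stay a b v w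
      + hop_row a b v w * hop_row (a + 2 * v - 1) (b + 2 * w - 1) (1 - v) (1 - w) = 1" (is ?sq)
    and "stay a b v w * hop_row a b v w + hop_row a b v w * stay (a + 2 * v - 1) (b + 2 * w - 1) (1 - v) (1 - w) = 0" (is ?off)
proof -
  have shift: "den (Suc a) b = den a (Suc b)" for a b by (simp add: den_def)
  have sq: "X / den a b * (X / den a b) + Y / den a b * (Z / den a b) = 1" if "X * X + Y * Z = den a b * den a b" for X Y Z a b
    using that den_nz [of a b] by (simp add: add_divide_distrib [symmetric])
  have D: "(q ^ a - q ^ b) * (q ^ a - q ^ b) + (1 - q ^ (2 * b)) * (1 - q ^ (2 * a)) = (1 - q ^ (a + b)) * (1 - q ^ (a + b))"
    for a b by (simp add: q_double power_add algebra_simps)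
  have off: "X * Y + Y * - X = 0" for X Y :: 'k by simp
  have "v = 0 \<or> v = 1" "w = 0 \<or> w = 1" using assms by auto
  then consider "v = w" | "v = 0" "w = 1" "a = 0" | a' where "v = 0" "w = 1" "a = Suc a'"
    | "v = 1" "w = 0" "b = 0" | b' where "v = 1" "w = 0" "b = Suc b'"
    by (metis not0_implies_Suc)
  then have "?sq \<and> ?off"
  proof cases
    case 1
    then show ?thesis by (simp add: stay_def hop_row_def)
  next
    case 2
    (* A block of size one: the partner state would have a negative label. *)
    then have "stay a b v w = 1" "hop_row a b v w = 0"
      using den_nz [of 0 b] by (simp_all add: stay_def hop_row_def den_def)
    then show ?thesis by simp
  next
    case (3 a')
    have s1: "stay a b v w = (q ^ Suc a' - q ^ Suc b) / den a b"
      and h1: "hop_row a b v w = (1 - q ^ (2 * Suc b)) / den a b"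
      using 3 by (simp_all add: stay_def hop_row_def)
    have h2: "hop_row (a + 2 * v - 1) (b + 2 * w - 1) (1 - v) (1 - w) = (1 - q ^ (2 * Suc a')) / den a b"
      and s2: "stay (a + 2 * v - 1) (b + 2 * w - 1) (1 - v) (1 - w) = - ((q ^ Suc a' - q ^ Suc b) / den a b)"
      using 3 by (simp_all add: stay_def hop_row_def shift minus_divide_left)
    have dn: "den a b = 1 - q ^ (Suc a' + Suc b)" using 3 by (simp add: den_def)
    have ?sq unfolding s1 h1 h2
      by (rule sq) (unfold dn, rule D)
    moreover have ?off unfolding s1 h1 s2 by (rule off)
    ultimately show ?thesis ..
  next
    case 4
    then have "stay a b v w = 1" "hop_row a b v w = 0"
      using den_nz [of a 0] by (simp_all add: stay_def hop_row_def den_def)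
    then show ?thesis by simp
  next
    case (5 b')
    have s1: "stay a b v w = (q ^ Suc b' - q ^ Suc a) / den a b"
      and h1: "hop_row a b v w = (1 - q ^ (2 * Suc a)) / den a b"
      using 5 by (simp_all add: stay_def hop_row_def)
    have h2: "hop_row (a + 2 * v - 1) (b + 2 * w - 1) (1 - v) (1 - w) = (1 - q ^ (2 * Suc b')) / den a b"
      and s2: "stay (a + 2 * v - 1) (b + 2 * w - 1) (1 - v) (1 - w) = - ((q ^ Suc b' - q ^ Suc a) / den a b)"
      using 5 by (simp_all add: stay_def hop_row_def shift minus_divide_left)
    have dn: "den a b = 1 - q ^ (Suc b' + Suc a)" using 5 by (simp add: den_def add.commute)
    have ?sq unfolding s1 h1 h2
      by (rule sq) (unfold dn, rule D)
    moreover have ?off unfolding s1 h1 s2 by (rule off)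
    ultimately show ?thesis ..
  qed
  then show ?sq ?off by blast+
qed

text \<open>
  A nonzero hop never truncates, and its coefficient is the row coefficient of the state that it reaches.
\<close>

lemma hop_flip:
  assumes "v \<in> {0, 1}" "w \<in> {0, 1}" "hop x y v w \<noteq> 0"
  shows "(v = 1 \<or> v = 0 \<and> x > 0) \<and> (w = 1 \<or> w = 0 \<and> y > 0)"
    "hop_row (x + 2 * v - 1) (y + 2 * w - 1) (1 - v) (1 - w) = hop x y v w"
proof -
  have d: "den (Suc a) b = den a (Suc b)" for a b by (simp add: den_def)
  have "v = 0 \<or> v = 1" "w = 0 \<or> w = 1" using assms by auto
  moreover have "v \<noteq> w" "v = 0 \<Longrightarrow> x \<noteq> 0" "w = 0 \<Longrightarrow> v = 1 \<Longrightarrow> y \<noteq> 0"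
    using assms(3) by (auto simp: hop_def split: if_splits intro!: gr0I)
  ultimately consider x' where "v = 0" "w = 1" "x = Suc x'" | y' where "v = 1" "w = 0" "y = Suc y'"
    by (metis not0_implies_Suc)
  then show "(v = 1 \<or> v = 0 \<and> x > 0) \<and> (w = 1 \<or> w = 0 \<and> y > 0)"
    "hop_row (x + 2 * v - 1) (y + 2 * w - 1) (1 - v) (1 - w) = hop x y v w"
    by (cases; simp add: hop_def hop_row_def d)+
qed

lemma hop_row_flip:
  assumes "v \<in> {0, 1}" "w \<in> {0, 1}" "hop_row x y v w \<noteq> 0"
  shows "(v = 1 \<or> v = 0 \<and> x > 0) \<and> (w = 1 \<or> w = 0 \<and> y > 0)"
    "hop (x + 2 * v - 1) (y + 2 * w - 1) (1 - v) (1 - w) = hop_row x y v w"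
proof -
  have d: "den (Suc a) b = den a (Suc b)" for a b by (simp add: den_def)
  have "v = 0 \<or> v = 1" "w = 0 \<or> w = 1" using assms by auto
  moreover have "v \<noteq> w" "v = 0 \<Longrightarrow> x \<noteq> 0" "w = 0 \<Longrightarrow> v = 1 \<Longrightarrow> y \<noteq> 0"
    using assms(3) by (auto simp: hop_row_def split: if_splits)
  ultimately consider x' where "v = 0" "w = 1" "x = Suc x'" | y' where "v = 1" "w = 0" "y = Suc y'"
    by (metis not0_implies_Suc)
  then show "(v = 1 \<or> v = 0 \<and> x > 0) \<and> (w = 1 \<or> w = 0 \<and> y > 0)"
    "hop (x + 2 * v - 1) (y + 2 * w - 1) (1 - v) (1 - w) = hop_row x y v w"
    by (cases; simp add: hop_def hop_row_def d)+
qed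

end

locale exchange = generic_q q for q :: "'k::field_char_0" +
  fixes p :: nat and \<epsilon> :: "nat list"
  assumes p: "Suc p < length \<epsilon>" and \<epsilon>_p: "\<epsilon> ! p = 0" and \<epsilon>_Suc_p: "\<epsilon> ! Suc p = 1"
begin

abbreviation "\<epsilon>' \<equiv> swap_sites p \<epsilon>"

text \<open>
  \<open>sw\<close> carries the labels of one order of the sites to the other, \<open>fl\<close> is the hop, and \<open>st\<close>, \<open>ho\<close>, \<open>hr\<close> are the
  coefficients of \<open>\<Phi>\<close> at a label.
\<close>

definition sw :: "label \<Rightarrow> label" where "sw x = (swap_sites p (fst x), swap_sites p (snd x))"
definition fl :: "label \<Rightarrow> label" where "fl x = (flip_sites p (fst x), flip_sites p (snd x))"

definition st :: "label \<Rightarrow> 'k" where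
  "st x = stay (fst x ! p) (snd x ! p) (fst x ! Suc p) (snd x ! Suc p)"
definition ho :: "label \<Rightarrow> 'k" where
  "ho x = hop (fst x ! p) (snd x ! p) (fst x ! Suc p) (snd x ! Suc p)"
definition hr :: "label \<Rightarrow> 'k" where
  "hr x = hop_row (fst x ! p) (snd x ! p) (fst x ! Suc p) (snd x ! Suc p)"

lemma W_D: assumes "m \<in> W_basis \<epsilon>" shows "length m = length \<epsilon>" "m ! Suc p \<in> {0, 1}"
  using assms p \<epsilon>_Suc_p unfolding W_basis_def by blast+

lemma swp_W: "m \<in> W_basis \<epsilon> \<Longrightarrow> swap_sites p m \<in> W_basis \<epsilon>'"
  by (rule swap_sites_W_basis [OF p])

lemma swp_W': "m \<in> W_basis \<epsilon>' \<Longrightarrow> swap_sites p m \<in> W_basis \<epsilon>"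
  using swap_sites_W_basis [of p \<epsilon>' m] p by (simp add: swap_swap_sites)

lemma flp_W: assumes "m \<in> W_basis \<epsilon>" shows "flip_sites p m \<in> W_basis \<epsilon>"
  unfolding W_basis_def
proof (intro CollectI conjI allI impI)
  note l = W_D(1) [OF assms]
  show "length (flip_sites p m) = length \<epsilon>" using l by simp
  fix k assume k: "k < length \<epsilon>" "\<epsilon> ! k = 1"
  then have "k \<noteq> p" using \<epsilon>_p by auto
  moreover have "m ! k \<in> {0, 1}" using assms k unfolding W_basis_def by blast
  ultimately show "flip_sites p m ! k \<in> {0, 1}" using k(1) p l by (cases "k = Suc p") (auto simp: nth_flip_sites)
qed

lemma sw_in: "x \<in> WB \<epsilon> \<Longrightarrow> sw x \<in> WB \<epsilon>'"
  unfolding sw_def mem_Times_iff fst_conv snd_conv using swp_W by blast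

lemma sw_in': "z \<in> WB \<epsilon>' \<Longrightarrow> sw z \<in> WB \<epsilon>"
  unfolding sw_def mem_Times_iff fst_conv snd_conv using swp_W' by blast

lemma fl_in: "x \<in> WB \<epsilon> \<Longrightarrow> fl x \<in> WB \<epsilon>"
  unfolding fl_def mem_Times_iff fst_conv snd_conv using flp_W by blast

lemma sw_sw: "x \<in> WB \<epsilon> \<Longrightarrow> sw (sw x) = x"
  using p W_D(1) unfolding sw_def mem_Times_iff by (simp add: swap_swap_sites)

lemma sw_sw': "z \<in> WB \<epsilon>' \<Longrightarrow> sw (sw z) = z"
  using p unfolding sw_def mem_Times_iff W_basis_def by (simp add: swap_swap_sites)

lemma sw_eq_iff: "x \<in> WB \<epsilon> \<Longrightarrow> y \<in> WB \<epsilon> \<Longrightarrow> sw x = sw y \<longleftrightarrow> x = y"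
  by (metis sw_sw)

lemma label_flip:
  assumes "x \<in> WB \<epsilon>"
  shows "fst x ! Suc p \<in> {0, 1}" "snd x ! Suc p \<in> {0, 1}"
    "fst (fl x) ! p = fst x ! p + 2 * fst x ! Suc p - 1" "fst (fl x) ! Suc p = 1 - fst x ! Suc p"
    "snd (fl x) ! p = snd x ! p + 2 * snd x ! Suc p - 1" "snd (fl x) ! Suc p = 1 - snd x ! Suc p"
    "Suc p < length (fst x)" "Suc p < length (snd x)"
proof -
  have m: "fst x \<in> W_basis \<epsilon>" "snd x \<in> W_basis \<epsilon>" using assms by auto
  show l: "Suc p < length (fst x)" "Suc p < length (snd x)" using m [THEN W_D(1)] p by simp_all
  show "fst x ! Suc p \<in> {0, 1}" "snd x ! Suc p \<in> {0, 1}" using m [THEN W_D(2)] by blast+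
  show "fst (fl x) ! p = fst x ! p + 2 * fst x ! Suc p - 1" "fst (fl x) ! Suc p = 1 - fst x ! Suc p"
    "snd (fl x) ! p = snd x ! p + 2 * snd x ! Suc p - 1" "snd (fl x) ! Suc p = 1 - snd x ! Suc p"
    using l by (simp_all add: fl_def nth_flip_sites)
qed

lemma ho_fl: assumes "x \<in> WB \<epsilon>" "ho x \<noteq> 0" shows "fl (fl x) = x" "hr (fl x) = ho x"
proof -
  note lf = label_flip [OF assms(1)]
  note h = hop_flip [OF lf(1,2) assms(2) [unfolded ho_def]]
  show "fl (fl x) = x"
    using h(1) flip_flip_sites [OF lf(7)] flip_flip_sites [OF lf(8)] by (simp add: fl_def prod_eq_iff)
  show "hr (fl x) = ho x" unfolding hr_def ho_def lf by (rule h(2))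
qed

lemma hr_fl: assumes "x \<in> WB \<epsilon>" "hr x \<noteq> 0" shows "fl (fl x) = x" "ho (fl x) = hr x"
proof -
  note lf = label_flip [OF assms(1)]
  note h = hop_row_flip [OF lf(1,2) assms(2) [unfolded hr_def]]
  show "fl (fl x) = x"
    using h(1) flip_flip_sites [OF lf(7)] flip_flip_sites [OF lf(8)] by (simp add: fl_def prod_eq_iff)
  show "ho (fl x) = hr x" unfolding hr_def ho_def lf by (rule h(2))
qed

lemma st_hr_square:
  assumes "x \<in> WB \<epsilon>"
  shows "st x * st x + hr x * hr (fl x) = 1" "st x * hr x + hr x * st (fl x) = 0"
  using stay_hop_row_square [OF label_flip(1,2) [OF assms]] unfolding st_def hr_def label_flip [OF assms] by blast+

text \<open>
  Reading \<open>\<Phi>\<close> by columns and by rows gives the same matrix.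
\<close>

lemma ho_hr_match:
  assumes "x \<in> WB \<epsilon>" "y \<in> WB \<epsilon>"
  shows "(if y = fl x then ho x else 0) = (if x = fl y then hr y else 0)"
proof -
  have A: "y = fl x \<Longrightarrow> ho x \<noteq> 0 \<Longrightarrow> x = fl y \<and> hr y = ho x" using ho_fl [OF assms(1)] by metis
  have B: "x = fl y \<Longrightarrow> hr y \<noteq> 0 \<Longrightarrow> y = fl x \<and> ho x = hr y" using hr_fl [OF assms(2)] by metis
  show ?thesis using A B by metis
qed

text \<open>
  The matrix of \<open>\<Phi>\<close>, with column \<open>x\<close> in the old order of the sites and row \<open>z\<close> in the new one.  The map \<open>h\<close> is the identity or
  the embedding of the scalars into power series.
\<close>

definition exch :: "('k \<Rightarrow> 'r::comm_ring_1) \<Rightarrow> label \<Rightarrow> label \<Rightarrow> 'r" where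
  "exch h z x = (if z = sw x then h (st x) else 0) + (if z = sw (fl x) then h (ho x) else 0)"

lemma exch_row_sum:
  fixes h :: "'k \<Rightarrow> 'r::comm_ring_1"
  assumes h0: "h 0 = 0" and X: "finite X" "X \<subseteq> WB \<epsilon>" and g: "\<And>x. x \<in> WB \<epsilon> \<Longrightarrow> x \<notin> X \<Longrightarrow> g x = 0"
    and y: "y \<in> WB \<epsilon>"
  shows "(\<Sum>x\<in>X. exch h (sw y) x * g x) = h (st y) * g y + h (hr y) * g (fl y)"
proof -
  have "exch h (sw y) x * g x = (if x = y then h (st y) * g y else 0) + (if x = fl y then h (hr y) * g (fl y) else 0)"
    if "x \<in> X" for x
  proof -
    have x: "x \<in> WB \<epsilon>" using that X by blast
    have F: "(if y = fl x then h (ho x) else 0) = (if x = fl y then h (hr y) else 0)"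
      using arg_cong [OF ho_hr_match [OF x y], of h] h0 by (simp split: if_splits)
    have G: "(if y = x then h (st x) else 0) * g x = (if x = y then h (st y) * g y else 0)"
      "(if x = fl y then h (hr y) else 0) * g x = (if x = fl y then h (hr y) * g (fl y) else 0)"
      by auto
    show ?thesis
      unfolding exch_def sw_eq_iff [OF y x] sw_eq_iff [OF y fl_in [OF x]] F distrib_right G ..
  qed
  then have "(\<Sum>x\<in>X. exch h (sw y) x * g x)
      = (\<Sum>x\<in>X. (if x = y then h (st y) * g y else 0) + (if x = fl y then h (hr y) * g (fl y) else 0))"
    by (rule sum.cong [OF refl])
  also have "\<dots> = h (st y) * g y + h (hr y) * g (fl y)"
    unfolding sum.distrib sum.delta [OF X(1)] using g y fl_in [OF y] by auto
  finally show ?thesis .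
qed

lemma exch_eq_0: "z \<noteq> sw x \<Longrightarrow> z \<noteq> sw (fl x) \<Longrightarrow> exch h z x = 0"
  unfolding exch_def by (simp only: if_False add_0)

lemma finite_exch_column: "finite {z. exch h z x \<noteq> 0}"
proof (rule finite_subset [OF subsetI])
  show "z \<in> {sw x, sw (fl x)}" if "z \<in> {z. exch h z x \<noteq> 0}" for z
    using that exch_eq_0 [of z x h] by blast
qed (intro finite.insertI finite.emptyI)

lemma finite_exch: "finite {z \<in> A. exch h z x \<noteq> 0}"
  by (rule finite_subset [OF _ finite_exch_column]) blast

lemma lookup_mat_exch: "Poly_Mapping.lookup (mat_op \<epsilon>' (exch h) v) u
    = (if u \<in> WB \<epsilon>' then \<Sum>x\<in>Poly_Mapping.keys v. exch h u x * Poly_Mapping.lookup v x else 0)"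
  by (rule lookup_mat_op [where M = "exch h", OF finite_exch finite_keys order_refl])

lemma mat_exch_in_WW: "mat_op \<epsilon>' (exch h) v \<in> WW \<epsilon>'"
  by (rule mat_op_in_WW [where M = "exch h", OF finite_exch])

lemma lookup_mat_exch_sw:
  fixes h :: "'k \<Rightarrow> 'r::comm_ring_1"
  assumes "h 0 = 0" "v \<in> WW \<epsilon>" "y \<in> WB \<epsilon>"
  shows "Poly_Mapping.lookup (mat_op \<epsilon>' (exch h) v) (sw y)
    = h (st y) * Poly_Mapping.lookup v y + h (hr y) * Poly_Mapping.lookup v (fl y)"
proof -
  have "Poly_Mapping.lookup (mat_op \<epsilon>' (exch h) v) (sw y)
      = (\<Sum>x\<in>Poly_Mapping.keys v. exch h (sw y) x * Poly_Mapping.lookup v x)"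
    unfolding lookup_mat_exch using sw_in [OF assms(3)] by (rule if_P)
  also have "\<dots> = h (st y) * Poly_Mapping.lookup v y + h (hr y) * Poly_Mapping.lookup v (fl y)"
  proof (rule exch_row_sum [where h = h and g = "Poly_Mapping.lookup v" and y = y, OF assms(1) finite_keys])
    show "Poly_Mapping.keys v \<subseteq> WB \<epsilon>" using assms(2) by (simp only: WW_def mem_Collect_eq)
    show "Poly_Mapping.lookup v x = 0" if "x \<notin> Poly_Mapping.keys v" for x
      using that by (simp only: in_keys_iff not_not)
  qed (rule assms(3))
  finally show ?thesis .
qed

text \<open>
  Since \<open>\<Phi>\<close> is an involution up to the relabelling \<open>sw\<close>, its inverse is the same matrix conjugated by \<open>sw\<close>.
\<close>

definition exch_inv :: "label \<Rightarrow> label \<Rightarrow> 'k" where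
  "exch_inv x z = exch id (sw x) (sw z)"

lemma finite_exch_inv: "finite {x \<in> WB \<epsilon>. exch_inv x z \<noteq> 0}"
proof (rule finite_subset)
  show "{x \<in> WB \<epsilon>. exch_inv x z \<noteq> 0} \<subseteq> sw ` {u. exch id u (sw z) \<noteq> (0::'k)}"
  proof (rule subsetI)
    fix x assume a: "x \<in> {x \<in> WB \<epsilon>. exch_inv x z \<noteq> 0}"
    have x1: "x \<in> WB \<epsilon>" by (rule CollectD [OF a, THEN conjunct1])
    have x2: "exch_inv x z \<noteq> 0" by (rule CollectD [OF a, THEN conjunct2])
    have "sw x \<in> {u. exch id u (sw z) \<noteq> (0::'k)}" by (rule CollectI) (rule x2 [unfolded exch_inv_def])
    then show "x \<in> sw ` {u. exch id u (sw z) \<noteq> (0::'k)}" by (rule image_eqI [where f = sw and x = "sw x", OF sw_sw [OF x1, symmetric]])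
  qed
  show "finite (sw ` {u. exch id u (sw z) \<noteq> (0::'k)})"
    by (intro finite_imageI finite_exch_column)
qed

lemma lookup_mat_exch_inv:
  assumes "w \<in> WW \<epsilon>'" "y \<in> WB \<epsilon>"
  shows "Poly_Mapping.lookup (mat_op \<epsilon> exch_inv w) y
    = st y * Poly_Mapping.lookup w (sw y) + hr y * Poly_Mapping.lookup w (sw (fl y))"
proof -
  have k: "z \<in> WB \<epsilon>'" if "z \<in> Poly_Mapping.keys w" for z using that assms(1) by (auto simp: WW_def)
  have "Poly_Mapping.lookup (mat_op \<epsilon> exch_inv w) y = (\<Sum>z\<in>Poly_Mapping.keys w. exch id (sw y) (sw z) * Poly_Mapping.lookup w z)"
    unfolding lookup_mat_op [where M = exch_inv, OF finite_exch_inv finite_keys order_refl] exch_inv_def using assms(2) by (rule if_P)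
  also have "\<dots> = (\<Sum>x\<in>sw ` Poly_Mapping.keys w. exch id (sw y) x * Poly_Mapping.lookup w (sw x))"
    by (rule sum.reindex_cong [symmetric, of sw, OF inj_onI])
      (use k sw_sw' in metis, use k sw_sw' in \<open>auto simp: id_def\<close>)
  also have "\<dots> = id (st y) * Poly_Mapping.lookup w (sw y) + id (hr y) * Poly_Mapping.lookup w (sw (fl y))"
  proof (rule exch_row_sum [where h = id and g = "\<lambda>x. Poly_Mapping.lookup w (sw x)" and y = y])
    show "Poly_Mapping.lookup w (sw x) = 0" if "x \<in> WB \<epsilon>" "x \<notin> sw ` Poly_Mapping.keys w" for x
      using that sw_sw by (metis image_eqI in_keys_iff)
    show "sw ` Poly_Mapping.keys w \<subseteq> WB \<epsilon>" using k sw_in' by (metis image_subsetI)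
  qed (simp_all add: assms(2) del: mem_Times_iff)
  finally show ?thesis by simp
qed

lemma WW_eqI:
  fixes u v :: "label \<Rightarrow>\<^sub>0 'r::comm_ring_1"
  assumes "u \<in> WW \<epsilon>'" "v \<in> WW \<epsilon>'" "\<And>y. y \<in> WB \<epsilon> \<Longrightarrow> Poly_Mapping.lookup u (sw y) = Poly_Mapping.lookup v (sw y)"
  shows "u = v"
proof (rule poly_mapping_eqI)
  fix z
  show "Poly_Mapping.lookup u z = Poly_Mapping.lookup v z"
  proof (cases "z \<in> WB \<epsilon>'")
    case True
    then show ?thesis using assms(3) [OF sw_in' [OF True]] by (simp add: sw_sw')
  next
    case False
    then show ?thesis using assms(1,2) unfolding WW_iff by metis
  qed
qed

lemma exch_inv_exch:
  assumes v: "v \<in> WW \<epsilon>"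
  shows "mat_op \<epsilon> exch_inv (mat_op \<epsilon>' (exch id) v) = v"
proof (rule poly_mapping_eqI)
  fix y
  let ?l = "Poly_Mapping.lookup"
  have W': "mat_op \<epsilon>' (exch id) v \<in> WW \<epsilon>'" by (rule mat_exch_in_WW)
  show "?l (mat_op \<epsilon> exch_inv (mat_op \<epsilon>' (exch id) v)) y = ?l v y"
  proof (cases "y \<in> WB \<epsilon>")
    case True
    have l: "?l (mat_op \<epsilon>' (exch id) v) (sw y) = st y * ?l v y + hr y * ?l v (fl y)" if "y \<in> WB \<epsilon>" for y
      using lookup_mat_exch_sw [of id, OF _ v that] by simp
    have "?l (mat_op \<epsilon> exch_inv (mat_op \<epsilon>' (exch id) v)) y
      = st y * (st y * ?l v y + hr y * ?l v (fl y)) + hr y * (st (fl y) * ?l v (fl y) + hr (fl y) * ?l v (fl (fl y)))"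
      unfolding lookup_mat_exch_inv [OF W' True] l [OF True] l [OF fl_in [OF True]] ..
    also have "\<dots> = st y * (st y * ?l v y + hr y * ?l v (fl y)) + hr y * (st (fl y) * ?l v (fl y) + hr (fl y) * ?l v y)"
      using hr_fl(1) [OF True] by (cases "hr y = 0") simp_all
    also have "\<dots> = (st y * st y + hr y * hr (fl y)) * ?l v y + (st y * hr y + hr y * st (fl y)) * ?l v (fl y)"
      by (simp add: algebra_simps)
    finally show ?thesis unfolding st_hr_square [OF True] by simp
  next
    case False
    have "?l v y = 0" using v False unfolding WW_iff by blast
    moreover have "?l (mat_op \<epsilon> exch_inv (mat_op \<epsilon>' (exch id) v)) y = 0"
      using mat_op_in_WW [where M = exch_inv, OF finite_exch_inv] False unfolding WW_iff by blast
    ultimately show ?thesis by (simp only:)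
  qed
qed

lemma exch_exch_inv:
  assumes w: "w \<in> WW \<epsilon>'"
  shows "mat_op \<epsilon>' (exch id) (mat_op \<epsilon> exch_inv w) = w"
proof (rule WW_eqI [OF mat_exch_in_WW w])
  fix y
  assume y: "y \<in> WB \<epsilon>"
  let ?l = "Poly_Mapping.lookup"
  have W: "mat_op \<epsilon> exch_inv w \<in> WW \<epsilon>" by (rule mat_op_in_WW [where M = exch_inv, OF finite_exch_inv])
  have "?l (mat_op \<epsilon>' (exch id) (mat_op \<epsilon> exch_inv w)) (sw y)
    = st y * (st y * ?l w (sw y) + hr y * ?l w (sw (fl y)))
      + hr y * (st (fl y) * ?l w (sw (fl y)) + hr (fl y) * ?l w (sw (fl (fl y))))"
    using lookup_mat_exch_sw [of id, OF _ W y] unfolding lookup_mat_exch_inv [OF w y] lookup_mat_exch_inv [OF w fl_in [OF y]] by simp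
  also have "\<dots> = st y * (st y * ?l w (sw y) + hr y * ?l w (sw (fl y)))
      + hr y * (st (fl y) * ?l w (sw (fl y)) + hr (fl y) * ?l w (sw y))"
    using hr_fl(1) [OF y] by (cases "hr y = 0") simp_all
  also have "\<dots> = (st y * st y + hr y * hr (fl y)) * ?l w (sw y) + (st y * hr y + hr y * st (fl y)) * ?l w (sw (fl y))"
    by (simp add: algebra_simps)
  finally show "?l (mat_op \<epsilon>' (exch id) (mat_op \<epsilon> exch_inv w)) (sw y) = ?l w (sw y)"
    unfolding st_hr_square [OF y] by simp
qed

text \<open>
  The exchange relation for matrix elements is the entry in row \<open>sw y\<close> and column \<open>x\<close> of the matrix identity
  \<open>\<Phi> M = M' \<Phi>\<close>, with the rows of \<open>\<Phi>\<close> on the left and its columns on the right.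
\<close>

lemma exch_intertwines:
  fixes h :: "'k \<Rightarrow> 'r::comm_ring_1" and M M' :: "label \<Rightarrow> label \<Rightarrow> 'r"
  assumes h0: "h 0 = 0" and M: "\<And>x. finite {y \<in> WB \<epsilon>. M y x \<noteq> 0}" and M': "\<And>x. finite {y \<in> WB \<epsilon>'. M' y x \<noteq> 0}"
    and ex: "\<And>x y. x \<in> WB \<epsilon> \<Longrightarrow> y \<in> WB \<epsilon> \<Longrightarrow>
      h (st y) * M y x + h (hr y) * M (fl y) x = h (st x) * M' (sw y) (sw x) + h (ho x) * M' (sw y) (sw (fl x))"
    and v: "v \<in> WW \<epsilon>"
  shows "mat_op \<epsilon>' (exch h) (mat_op \<epsilon> M v) = mat_op \<epsilon>' M' (mat_op \<epsilon>' (exch h) v)"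
proof (rule WW_eqI [OF mat_exch_in_WW mat_op_in_WW [where M = M', OF M']])
  fix y
  assume y: "y \<in> WB \<epsilon>"
  let ?l = "Poly_Mapping.lookup" and ?K = "Poly_Mapping.keys v"
  have K: "x \<in> WB \<epsilon>" if "x \<in> ?K" for x using that v by (auto simp: WW_def)
  (* U contains the support of the image of v, so that both products become finite sums. *)
  define U where "U = sw ` ?K \<union> (\<lambda>x. sw (fl x)) ` ?K"
  have fU: "finite U" by (simp add: U_def)
  have lP: "?l (mat_op \<epsilon>' (exch h) v) u = (if u \<in> WB \<epsilon>' then \<Sum>x\<in>?K. exch h u x * ?l v x else 0)" for u
    by (rule lookup_mat_exch)
  have kU: "Poly_Mapping.keys (mat_op \<epsilon>' (exch h) v) \<subseteq> U"
  proof
    fix u assume "u \<in> Poly_Mapping.keys (mat_op \<epsilon>' (exch h) v)"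
    then have "(\<Sum>x\<in>?K. exch h u x * ?l v x) \<noteq> 0" unfolding in_keys_iff lP by (metis (full_types))
    then obtain x where x: "x \<in> ?K" "exch h u x * ?l v x \<noteq> 0" by (rule sum.not_neutral_contains_not_neutral)
    then have "exch h u x \<noteq> 0" by auto
    then show "u \<in> U" using x(1) by (auto simp: exch_def U_def split: if_splits)
  qed
  have UW: "u \<in> WB \<epsilon>'" if "u \<in> U" for u using that K sw_in fl_in unfolding U_def by blast
  have "?l (mat_op \<epsilon>' (exch h) (mat_op \<epsilon> M v)) (sw y)
      = h (st y) * (\<Sum>x\<in>?K. M y x * ?l v x) + h (hr y) * (\<Sum>x\<in>?K. M (fl y) x * ?l v x)"
    unfolding lookup_mat_exch_sw [where h = h, OF h0 mat_op_in_WW [where M = M, OF M] y] lookup_mat_op [where M = M, OF M finite_keys order_refl]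
    using y fl_in [OF y] by simp
  also have "\<dots> = (\<Sum>x\<in>?K. (h (st y) * M y x + h (hr y) * M (fl y) x) * ?l v x)"
    by (simp add: sum_distrib_left distrib_right sum.distrib mult.assoc)
  also have "\<dots> = (\<Sum>x\<in>?K. (\<Sum>u\<in>U. M' (sw y) u * exch h u x) * ?l v x)"
  proof (intro sum.cong refl)
    fix x assume x: "x \<in> ?K"
    have "(\<Sum>u\<in>U. M' (sw y) u * exch h u x)
      = (\<Sum>u\<in>U. (if u = sw x then M' (sw y) (sw x) * h (st x) else 0)
         + (if u = sw (fl x) then M' (sw y) (sw (fl x)) * h (ho x) else 0))"
      by (intro sum.cong refl) (simp add: exch_def distrib_left)
    also have "\<dots> = h (st x) * M' (sw y) (sw x) + h (ho x) * M' (sw y) (sw (fl x))"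
      unfolding sum.distrib sum.delta [OF fU] using x by (simp add: U_def mult.commute)
    finally show "(h (st y) * M y x + h (hr y) * M (fl y) x) * ?l v x = (\<Sum>u\<in>U. M' (sw y) u * exch h u x) * ?l v x"
      using ex [OF K [OF x] y] by simp
  qed
  also have "\<dots> = (\<Sum>u\<in>U. M' (sw y) u * (\<Sum>x\<in>?K. exch h u x * ?l v x))"
    unfolding sum_distrib_left sum_distrib_right
    by (rule trans [OF sum.swap]) (simp only: mult.assoc)
  also have "\<dots> = (\<Sum>u\<in>U. M' (sw y) u * ?l (mat_op \<epsilon>' (exch h) v) u)"
    unfolding lP using UW by (intro sum.cong refl) simp
  also have "\<dots> = ?l (mat_op \<epsilon>' M' (mat_op \<epsilon>' (exch h) v)) (sw y)"
    unfolding lookup_mat_op [where M = M', OF M' fU kU] using sw_in [OF y] by simp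
  finally show "?l (mat_op \<epsilon>' (exch h) (mat_op \<epsilon> M v)) (sw y) = ?l (mat_op \<epsilon>' M' (mat_op \<epsilon>' (exch h) v)) (sw y)" .
qed

lemma label_conditions:
  assumes "x \<in> WB \<epsilon>"
  shows "length (fst x) = length \<epsilon>" "length (snd x) = length \<epsilon>"
    "fst x ! Suc p \<in> {0, 1}" "snd x ! Suc p \<in> {0, 1}"
  using assms W_D unfolding mem_Times_iff by blast+

lemma extend_z_exch: "extend_z (mat_op \<epsilon>' (exch id)) v = mat_op \<epsilon>' (exch fps_const) v"
proof -
  have "(\<lambda>z x. fps_const (exch id z x)) = exch fps_const"
    by (intro ext) (simp add: exch_def)
  then show ?thesis by (simp add: extend_z_mat_op [where M = "exch id", OF finite_exch])
qed

lemma exch_intertwines_S_tr: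
  assumes "v \<in> WW \<epsilon>"
  shows "extend_z (mat_op \<epsilon>' (exch id)) (S_tr \<rho> q \<epsilon> v) = S_tr \<rho> q \<epsilon>' (extend_z (mat_op \<epsilon>' (exch id)) v)"
  unfolding S_tr_def extend_z_exch
proof (rule exch_intertwines [where h = fps_const and M = "tr_elem \<rho> q \<epsilon>" and M' = "tr_elem \<rho> q \<epsilon>'", OF _ finite_tr_column finite_tr_column _ assms])
  fix x y assume "x \<in> WB \<epsilon>" "y \<in> WB \<epsilon>"
  note xy = label_conditions [OF this(1)] label_conditions [OF this(2)]
  show "fps_const (st y) * tr_elem \<rho> q \<epsilon> y x + fps_const (hr y) * tr_elem \<rho> q \<epsilon> (fl y) x
    = fps_const (st x) * tr_elem \<rho> q \<epsilon>' (sw y) (sw x) + fps_const (ho x) * tr_elem \<rho> q \<epsilon>' (sw y) (sw (fl x))"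
    using tr_elem_exchange [OF p \<epsilon>_p \<epsilon>_Suc_p xy(5,6,1,2,7,8,3,4), of \<rho>]
    by (simp add: st_def ho_def hr_def sw_def fl_def)
qed simp

lemma exch_intertwines_S_bd:
  assumes "v \<in> WW \<epsilon>" "t > 0"
  shows "extend_z (mat_op \<epsilon>' (exch id)) (S_bd s t \<rho> q \<epsilon> v) = S_bd s t \<rho> q \<epsilon>' (extend_z (mat_op \<epsilon>' (exch id)) v)"
  unfolding S_bd_def extend_z_exch
proof (rule exch_intertwines [where h = fps_const and M = "bd_elem s t \<rho> q \<epsilon>" and M' = "bd_elem s t \<rho> q \<epsilon>'", OF _ finite_bd_column finite_bd_column _ assms(1)])
  fix x y assume "x \<in> WB \<epsilon>" "y \<in> WB \<epsilon>"
  note xy = label_conditions [OF this(1)] label_conditions [OF this(2)]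
  show "fps_const (st y) * bd_elem s t \<rho> q \<epsilon> y x + fps_const (hr y) * bd_elem s t \<rho> q \<epsilon> (fl y) x
    = fps_const (st x) * bd_elem s t \<rho> q \<epsilon>' (sw y) (sw x) + fps_const (ho x) * bd_elem s t \<rho> q \<epsilon>' (sw y) (sw (fl x))"
    using bd_elem_exchange [OF p \<epsilon>_p \<epsilon>_Suc_p xy(5,6,1,2,7,8,3,4) assms(2), of s \<rho>]
    by (simp add: st_def ho_def hr_def sw_def fl_def)
qed simp

lemma equivalent_swap_sites:
  assumes "\<And>A. A \<in> \<A> \<Longrightarrow> A = S_tr \<rho>_tr q \<or> (\<exists>s t. t > 0 \<and> A = S_bd s t (\<rho> s t) q)"
  shows "equivalent \<A> \<epsilon> \<epsilon>'"
  unfolding equivalent_def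
proof (intro exI conjI ballI)
  show "Vector_Spaces.linear scale scale (mat_op \<epsilon>' (exch id))" by (rule linear_mat_op [where M = "exch id", OF finite_exch])
  show "Vector_Spaces.linear scale scale (mat_op \<epsilon> exch_inv)" by (rule linear_mat_op [where M = exch_inv, OF finite_exch_inv])
  show "mat_op \<epsilon>' (exch id) v \<in> WW \<epsilon>'" for v :: "label \<Rightarrow>\<^sub>0 'k" by (rule mat_exch_in_WW)
  show "mat_op \<epsilon> exch_inv v \<in> WW \<epsilon>" for v by (rule mat_op_in_WW [where M = exch_inv, OF finite_exch_inv])
  show "mat_op \<epsilon> exch_inv (mat_op \<epsilon>' (exch id) v) = v" if "v \<in> WW \<epsilon>" for v using that by (rule exch_inv_exch)
  show "mat_op \<epsilon>' (exch id) (mat_op \<epsilon> exch_inv v) = v" if "v \<in> WW \<epsilon>'" for v using that by (rule exch_exch_inv)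
  show "extend_z (mat_op \<epsilon>' (exch id)) (A \<epsilon> v) = A \<epsilon>' (extend_z (mat_op \<epsilon>' (exch id)) v)"
    if "A \<in> \<A>" "v \<in> WW \<epsilon>" for A v
    using assms [OF that(1)] exch_intertwines_S_tr [OF that(2)] exch_intertwines_S_bd [OF that(2)] by blast
qed

end

section \<open>Arbitrary permutations of the sites\<close>

theorem proposition2p1:
  fixes q :: "'k::field_char_0"
    and n :: nat
    and \<epsilon> \<epsilon>' :: "nat list"
    and \<rho>_tr :: "'k fps"
    and \<rho> :: "nat \<Rightarrow> nat \<Rightarrow> 'k fps"
  assumes "q \<noteq> 0" and "\<And>m. m > 0 \<Longrightarrow> q ^ m \<noteq> 1"
    and "n \<ge> 1"
    and "length \<epsilon> = n" and "set \<epsilon> \<subseteq> {0, 1}"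
    and "mset \<epsilon>' = mset \<epsilon>"
  shows "\<exists>\<Phi> :: (label \<Rightarrow>\<^sub>0 'k) \<Rightarrow> (label \<Rightarrow>\<^sub>0 'k).
    Vector_Spaces.linear scale scale \<Phi> \<and> bij_betw \<Phi> (WW \<epsilon>) (WW \<epsilon>') \<and>
    (\<forall>v \<in> WW \<epsilon>. extend_z \<Phi> (S_tr \<rho>_tr q \<epsilon> v) = S_tr \<rho>_tr q \<epsilon>' (extend_z \<Phi> v)) \<and>
    (\<forall>s \<in> {1, 2}. \<forall>t \<in> {1, 2}. \<forall>v \<in> WW \<epsilon>.
       extend_z \<Phi> (S_bd s t (\<rho> s t) q \<epsilon> v) = S_bd s t (\<rho> s t) q \<epsilon>' (extend_z \<Phi> v))"
proof -
  interpret generic_q q by standard (fact assms)+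
  define \<A> where "\<A> = insert (S_tr \<rho>_tr q) {S_bd s t (\<rho> s t) q |s t. t > 0}"
  have closed: "A \<epsilon> v \<in> WW \<epsilon>" if "A \<in> \<A>" for A \<epsilon> v
    using that mat_op_in_WW [where M = "tr_elem \<rho>_tr q \<epsilon>", OF finite_tr_column]
      mat_op_in_WW [where M = "bd_elem s t (\<rho> s t) q \<epsilon>" for s t, OF finite_bd_column]
    unfolding \<A>_def S_tr_def S_bd_def by blast
  have trans: "equivalent \<A> \<epsilon>1 \<epsilon>2 \<Longrightarrow> equivalent \<A> \<epsilon>2 \<epsilon>3 \<Longrightarrow> equivalent \<A> \<epsilon>1 \<epsilon>3" for \<epsilon>1 \<epsilon>2 \<epsilon>3
    by (rule equivalent_trans)
  have sym: "equivalent \<A> \<epsilon>1 \<epsilon>2 \<Longrightarrow> equivalent \<A> \<epsilon>2 \<epsilon>1" for \<epsilon>1 \<epsilon>2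
    using equivalent_sym closed by blast
  have swap: "equivalent \<A> (xs @ 0 # 1 # ys) (xs @ 1 # 0 # ys)" for xs ys
  proof -
    interpret exchange q "length xs" "xs @ 0 # 1 # ys"
      by standard (simp_all add: nth_append)
    have "swap_sites (length xs) (xs @ 0 # 1 # ys) = xs @ 1 # 0 # ys"
      by (simp add: swap_sites_def nth_append list_update_append)
    then show ?thesis
      using equivalent_swap_sites [of \<A> \<rho>_tr \<rho>] by (auto simp: \<A>_def)
  qed
  have sort: "equivalent \<A> \<delta> (replicate (count (mset \<delta>) 1) 1 @ replicate (count (mset \<delta>) 0) 0)"
    if "set \<delta> \<subseteq> {0, 1}" for \<delta>
    using sort_zeros_ones [where E = "equivalent \<A>", OF equivalent_refl trans swap that, where xs = "[]"] by simp
  have "set \<epsilon>' \<subseteq> {0, 1}" using assms(5,6) by (metis set_mset_mset)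
  from sym [OF sort [OF this]] have "equivalent \<A> \<epsilon> \<epsilon>'"
    unfolding assms(6) by (rule trans [OF sort [OF assms(5)]])
  then obtain \<Phi> \<Psi> where lin: "Vector_Spaces.linear scale scale \<Phi>"
    and \<Phi>: "\<forall>v\<in>WW \<epsilon>. \<Phi> v \<in> WW \<epsilon>' \<and> \<Psi> (\<Phi> v) = v" "\<forall>v\<in>WW \<epsilon>'. \<Psi> v \<in> WW \<epsilon> \<and> \<Phi> (\<Psi> v) = v"
    and int: "\<forall>A\<in>\<A>. \<forall>v\<in>WW \<epsilon>. extend_z \<Phi> (A \<epsilon> v) = A \<epsilon>' (extend_z \<Phi> v)"
    unfolding equivalent_def by blast
  have "bij_betw \<Phi> (WW \<epsilon>) (WW \<epsilon>')"
    by (rule bij_betw_byWitness [where f' = \<Psi>]) (use \<Phi> in auto)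
  moreover have "S_tr \<rho>_tr q \<in> \<A>" by (simp add: \<A>_def)
  moreover have "S_bd s t (\<rho> s t) q \<in> \<A>" if "t \<in> {1, 2}" for s t
  proof -
    have "t > 0" using that by auto
    then show ?thesis unfolding \<A>_def by blast
  qed
  ultimately show ?thesis using lin int by blast
qed

end
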